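(* Let $a<b$, $\tau>0$, and let $W\in C^3(\mathbb{R})$ satisfy $W(\pm1)=W'(\pm1)=0$, $W''(\pm1)>0$ and $W(u)>0$ for $u\neq\pm1$; set $\lambda:=\min\{W''(1),W''(-1)\}$ and $c_0:=\int_{-1}^1\sqrt{2W(s)}\,ds$. Let $v:[a,b]\to\{-1,+1\}$ be piecewise constant with exactly $N$ jumps at $a<h_1<\dots<h_N<b$, and $r>0$ such that the intervals $(h_i-r,h_i+r)$ are pairwise disjoint, $a\le h_1-r$, $h_N+r\le b$; let $A\in(0,r\sqrt{2\lambda})$ and $f:(0,+\infty)\to(0,+\infty)$. For each $\varepsilon>0$ let $u^\varepsilon$, with $(u^\varepsilon,u^\varepsilon_t)\in C([0,T],H^3(a,b)\times H^1(a,b))$ for every $T>0$, solve $$\tau u_{tt}+u_t=(-\varepsilon^2u_{xx}+W'(u))_{xx}$$ on $(a,b)$ with $u(a,t)=\pm1$, $u(b,t)=\pm1$, $u_{xx}(a,t)=u_{xx}(b,t)=0$ for all $t\ge0$, and initial data $u^\varepsilon(\cdot,0)=u^\varepsilon_0$, $u^\varepsilon_t(\cdot,0)=u^\varepsilon_1$ satisfying $\lim_{\varepsilon\to0}\|u_0^\varepsilon-v\|_{L^1(a,b)}=0$ and $E_\varepsilon[u_0^\varepsilon,\bar u_1^\varepsilon]\le Nc_0+1/f(\varepsilon)$ for all sufficiently small $\varepsilon>0$. Let $T_\varepsilon:=\min\{f(\varepsilon),\exp(A/\varepsilon)\}$. Then $$\sup_{0\le t\le T_\varepsilon}\|\bar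 u^\varepsilon(\cdot,t)-\bar v\|_{L^1(a,b)}\to0\quad\text{as }\varepsilon\to0,$$ and for every $\eta\in(0,1)$, $$\sup_{0\le t\le \varepsilon^\eta T_\varepsilon}\|u^\varepsilon(\cdot,t)-v\|_{L^1(a,b)}\to0\quad\text{as }\varepsilon\to0.$$
   Context: For $g\in L^1(a,b)$ (possibly depending on $t$), $\bar g(x):=\int_a^x g(y)\,dy-\frac{1}{b-a}\int_a^b\int_a^y g(\eta)\,d\eta\,dy$; $\bar u^\varepsilon(\cdot,t)$, $\bar u_1^\varepsilon$, $\bar v$ denote this transform applied to $u^\varepsilon(\cdot,t)$, $u_1^\varepsilon$, $v$. $E_\varepsilon[u,w]:=\frac{\tau}{2\varepsilon}\|w\|_{L^2(a,b)}^2+\int_a^b\left[\frac{\varepsilon}{2}u_x^2+\frac{W(u)}{\varepsilon}\right]dx$. The boundary values $\pm1$ at $a$ and $b$ are fixed constants. *)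

theory Defs
  imports "HOL-Analysis.Analysis"
begin

definition C3 :: "(real \<Rightarrow> real) \<Rightarrow> bool" where
  "C3 W \<longleftrightarrow> (\<forall>x. W differentiable (at x)) \<and> (\<forall>x. deriv W differentiable (at x))
     \<and> (\<forall>x. deriv (deriv W) differentiable (at x))
     \<and> continuous_on UNIV (deriv (deriv (deriv W)))"

text \<open>g' is the (weak) derivative of g on [a,b]; in one dimension this means that
  (the continuous representative of) g is absolutely continuous, namely the
  indefinite integral of the integrable function g'.\<close>
definition weak_deriv_on :: "real \<Rightarrow> real \<Rightarrow> (real \<Rightarrow> real) \<Rightarrow> (real \<Rightarrow> real) \<Rightarrow> bool" where
  "weak_deriv_on a b g g' \<longleftrightarrow> g' integrable_on {a..b} \<and>
     (\<forall>x\<in>{a..b}. g x = g a + integral {a..x} g')"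

definition L2_on :: "real \<Rightarrow> real \<Rightarrow> (real \<Rightarrow> real) \<Rightarrow> bool" where
  "L2_on a b g \<longleftrightarrow> g measurable_on {a..b} \<and> (\<lambda>x. (g x)\<^sup>2) integrable_on {a..b}"

definition L1_dist :: "real \<Rightarrow> real \<Rightarrow> (real \<Rightarrow> real) \<Rightarrow> (real \<Rightarrow> real) \<Rightarrow> real" where
  "L1_dist a b g h = integral {a..b} (\<lambda>x. \<bar>g x - h x\<bar>)"

definition bar :: "real \<Rightarrow> real \<Rightarrow> (real \<Rightarrow> real) \<Rightarrow> real \<Rightarrow> real" where
  "bar a b g x = integral {a..x} g - (1 / (b - a)) * integral {a..b} (\<lambda>y. integral {a..y} g)"

definition energy :: "real \<Rightarrow> real \<Rightarrow> real \<Rightarrow> (real \<Rightarrow> real) \<Rightarrow> real \<Rightarrow> (real \<Rightarrow> real) \<Rightarrow> (real \<Rightarrow> real) \<Rightarrow> real" where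
  "energy a b \<tau> W \<epsilon> u w =
     \<tau> / (2 * \<epsilon>) * integral {a..b} (\<lambda>x. (w x)\<^sup>2)
     + integral {a..b} (\<lambda>x. \<epsilon> / 2 * (deriv u x)\<^sup>2 + W (u x) / \<epsilon>)"

definition hpt :: "real \<Rightarrow> real \<Rightarrow> nat \<Rightarrow> (nat \<Rightarrow> real) \<Rightarrow> nat \<Rightarrow> real" where
  "hpt a b N h i = (if i = 0 then a else if i = N + 1 then b else h i)"

definition jump_profile :: "real \<Rightarrow> real \<Rightarrow> nat \<Rightarrow> (nat \<Rightarrow> real) \<Rightarrow> (real \<Rightarrow> real) \<Rightarrow> bool" where
  "jump_profile a b N h v \<longleftrightarrow>
     (\<forall>i\<le>N. hpt a b N h i < hpt a b N h (i + 1)) \<and>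
     (\<forall>x\<in>{a..b}. v x \<in> {-1, 1}) \<and>
     (\<forall>i\<le>N. \<forall>x\<in>{hpt a b N h i<..<hpt a b N h (i + 1)}.
                \<forall>y\<in>{hpt a b N h i<..<hpt a b N h (i + 1)}. v x = v y) \<and>
     (\<forall>i\<in>{1..N}. \<forall>x\<in>{hpt a b N h (i - 1)<..<h i}.
                \<forall>y\<in>{h i<..<hpt a b N h (i + 1)}. v x \<noteq> v y)"

fun pd :: "bool list \<Rightarrow> (real \<Rightarrow> real \<Rightarrow> real) \<Rightarrow> real \<Rightarrow> real \<Rightarrow> real" where
  "pd [] \<phi> = \<phi>"
| "pd (True # ds) \<phi> = (\<lambda>x t. deriv (\<lambda>y. pd ds \<phi> y t) x)"
| "pd (False # ds) \<phi> = (\<lambda>x t. deriv (\<lambda>s. pd ds \<phi> x s) t)"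

definition test_fun :: "real \<Rightarrow> real \<Rightarrow> (real \<Rightarrow> real \<Rightarrow> real) \<Rightarrow> bool" where
  "test_fun a b \<phi> \<longleftrightarrow>
     (\<forall>ds z. (\<lambda>(x, t). pd ds \<phi> x t) differentiable (at z)) \<and>
     compact (closure {(x, t). \<phi> x t \<noteq> 0}) \<and>
     closure {(x, t). \<phi> x t \<noteq> 0} \<subseteq> {a<..<b} \<times> {0<..}"

text \<open>u (with time derivative ut) is a solution of
  tau u_tt + u_t = (-eps^2 u_xx + W'(u))_xx on (a,b) x (0,+infinity),
  u(a,t) = alpha, u(b,t) = beta, u_xx(a,t) = u_xx(b,t) = 0,
  with (u, u_t) in C([0,T], H^3(a,b) x H^1(a,b)) for every T > 0
  (continuous representatives in x are used).
  The equation holds in the sense of distributions on (a,b) x (0,+infinity).\<close>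
definition is_solution ::
  "real \<Rightarrow> real \<Rightarrow> real \<Rightarrow> (real \<Rightarrow> real) \<Rightarrow> real \<Rightarrow> real \<Rightarrow> real \<Rightarrow>
   (real \<Rightarrow> real \<Rightarrow> real) \<Rightarrow> (real \<Rightarrow> real \<Rightarrow> real) \<Rightarrow> bool" where
  "is_solution a b \<tau> W \<epsilon> \<alpha> \<beta> u ut \<longleftrightarrow>
   (\<exists>ux uxx uxxx utx.
     (\<forall>t\<ge>0. weak_deriv_on a b (\<lambda>x. u x t) (\<lambda>x. ux x t) \<and>
            weak_deriv_on a b (\<lambda>x. ux x t) (\<lambda>x. uxx x t) \<and>
            weak_deriv_on a b (\<lambda>x. uxx x t) (\<lambda>x. uxxx x t) \<and>
            L2_on a b (\<lambda>x. uxxx x t) \<and>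
            weak_deriv_on a b (\<lambda>x. ut x t) (\<lambda>x. utx x t) \<and>
            L2_on a b (\<lambda>x. utx x t)) \<and>
     (\<forall>t\<ge>0. ((\<lambda>s. integral {a..b} (\<lambda>x.
              (u x s - u x t)\<^sup>2 + (ux x s - ux x t)\<^sup>2 + (uxx x s - uxx x t)\<^sup>2
              + (uxxx x s - uxxx x t)\<^sup>2 + (ut x s - ut x t)\<^sup>2 + (utx x s - utx x t)\<^sup>2))
            \<longlongrightarrow> 0) (at t within {0..})) \<and>
     (\<forall>x\<in>{a..b}. \<forall>t\<ge>0. ((\<lambda>s. u x s) has_real_derivative ut x t) (at t within {0..})) \<and>
     (\<forall>t\<ge>0. u a t = \<alpha> \<and> u b t = \<beta> \<and> uxx a t = 0 \<and> uxx b t = 0) \<and>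
     (\<forall>\<phi>. test_fun a b \<phi> \<longrightarrow>
        integral UNIV (\<lambda>(x, t). \<tau> * u x t * pd [False, False] \<phi> x t - u x t * pd [False] \<phi> x t)
        = integral UNIV (\<lambda>(x, t). (- (\<epsilon>\<^sup>2) * uxx x t + deriv W (u x t)) * pd [True, True] \<phi> x t)))"

end

theory Submission
  imports Defs
begin

text \<open>Integrating the equation once in space gives \<open>\<tau> U\<^sub>t\<^sub>t + U\<^sub>t = \<mu>\<^sub>x\<close> for \<open>U = bar u\<close> and
  \<open>\<mu> = - \<epsilon>\<^sup>2 u\<^sub>x\<^sub>x + W' u\<close>, which vanishes at both ends; hence the energy \<open>E\<close> satisfies \<open>E' = - \<parallel>U\<^sub>t\<parallel>\<^sup>2 / \<epsilon>\<close>
  and \<open>\<parallel>U(t) - U(0)\<parallel>\<^sup>2 \<le> t \<epsilon> (E(0) - E(t))\<close>. As long as \<open>U\<close> is \<open>L\<^sup>1\<close>-close to \<open>bar v\<close>, the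
  energy is at least \<open>N c\<^sub>0 - C exp (- A / \<epsilon>)\<close>: near each jump \<open>u\<close> takes values close to both wells, and
  the calibration \<open>tanh (\<kappa> (x - z) / \<epsilon>) (\<Psi> (u x) - \<Psi> s)\<close> with \<open>\<Psi>' = sqrt (2 W)\<close> bounds the energy of the
  two tails. So \<open>U\<close> moves by \<open>O(sqrt \<epsilon>)\<close> up to time \<open>min (f \<epsilon>) (exp (A / \<epsilon>))\<close> and never leaves the
  neighbourhood in which the lower bound holds. The statement on \<open>u\<close> follows from the interpolation
  \<open>\<parallel>u(t) - u(0)\<parallel>\<^sup>2 \<le> \<parallel>u\<^sub>x(t) - u\<^sub>x(0)\<parallel> \<parallel>U(t) - U(0)\<parallel>\<close>.\<close>

section \<open>Lower bound for the energy\<close>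

text \<open>Two points shape the argument. (1) The equation holds only in the sense of
  distributions, and \<open>ut\<close> is only known to be continuous in time. It is therefore
  integrated in time and twice in space, by the du Bois-Reymond lemma in each variable, into an
  identity between two arbitrary times. Derivatives of quadratic quantities are then limits of
  difference quotients in which the time difference has been moved onto \<open>u\<close> or
  \<open>M\<close>. (2) Every rate \<open>A < r * sqrt (2 * \<lambda>)\<close> has to be reached. An
  estimate between two points near the wells alone loses a fixed amount; two tails of length
  \<open>L < r\<close> recover it up to a multiple of
  \<open>exp (- 2 * \<kappa> * L / \<epsilon>)\<close>. The choice
  \<open>\<kappa>\<^sup>2 = \<lambda> / 2\<close> turns \<open>2 * \<kappa> * r\<close> into the
  required bound for \<open>A\<close>, and as \<open>\<kappa>\<^sup>2\<close> is strictly below the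
  curvature at the wells, the growth condition of the calibration holds on whole neighbourhoods of
  them. The remaining length \<open>r - L\<close> is where the points near the wells are
  located.\<close>

lemmas hk_integral_add = Henstock_Kurzweil_Integration.integral_add
  and hk_integral_diff = Henstock_Kurzweil_Integration.integral_diff
  and hk_integral_cong = Henstock_Kurzweil_Integration.integral_cong
  and hk_integral_combine = Henstock_Kurzweil_Integration.integral_combine

lemma has_integral_ftc:
  fixes F f :: "real \<Rightarrow> real"
  assumes "a \<le> b" "\<And>x. x \<in> {a..b} \<Longrightarrow> (F has_real_derivative f x) (at x within {a..b})"
  shows "(f has_integral (F b - F a)) {a..b}"
  using fundamental_theorem_of_calculus[OF assms(1), of F f] assms(2)
  by (simp add: has_real_derivative_iff_has_vector_derivative)

lemma ftc_bound:
  fixes F f e :: "real \<Rightarrow> real"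
  assumes "a \<le> b" "\<And>x. x \<in> {a..b} \<Longrightarrow> (F has_real_derivative f x) (at x within {a..b})"
    and "\<And>x. x \<in> {a..b} \<Longrightarrow> \<bar>f x\<bar> \<le> e x" "e integrable_on {a..b}"
  shows "\<bar>F b - F a\<bar> \<le> integral {a..b} e"
proof -
  have "(f has_integral (F b - F a)) {a..b}"
    using has_integral_ftc assms(1,2) by blast
  then have "F b - F a = integral {a..b} f" "f integrable_on {a..b}"
    by (auto simp: integral_unique)
  then show ?thesis
    using integral_norm_bound_integral[of f "{a..b}" e] assms(3,4) by auto
qed

text \<open>Three quantities start from 0 at the well and are monotone, each feeding the next:
  \<open>W1\<close>, then \<open>(W1 x)\<^sup>2 - 2 * \<kappa>\<^sup>2 * W x\<close>, which says
  \<open>\<kappa> * sqrt (2 * W x) \<le> W1 x\<close>, and finally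
  \<open>W x - \<kappa> * (\<Psi> x - \<Psi> s)\<close>, whose derivative is the difference of these
  two sides.\<close>

lemma half_well_growth:
  fixes W W1 W2 \<Psi> :: "real \<Rightarrow> real"
  assumes DW: "\<And>x. (W has_real_derivative W1 x) (at x)" and DW1: "\<And>x. (W1 has_real_derivative W2 x) (at x)"
    and D\<Psi>: "\<And>x. (\<Psi> has_real_derivative sqrt (2 * W x)) (at x)" and W_nonneg: "\<And>x. W x \<ge> 0"
    and zeros: "W s = 0" "W1 s = 0" and \<kappa>: "\<kappa> > 0" and w: "s \<le> w"
    and W2: "\<And>x. s \<le> x \<Longrightarrow> x \<le> w \<Longrightarrow> W2 x > \<kappa>\<^sup>2"
  shows "\<kappa> * (\<Psi> w - \<Psi> s) \<le> W w"
proof -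
  have W1n: "W1 x \<ge> 0" if x: "s \<le> x" "x \<le> w" for x
  proof -
    have "W1 s \<le> W1 x"
    proof (rule DERIV_nonneg_imp_nondecreasing[OF x(1)])
      fix y assume "s \<le> y" "y \<le> x"
      then have "W2 y \<ge> 0" using W2[of y] x zero_le_power2[of \<kappa>] by linarith
      then show "\<exists>z. (W1 has_real_derivative z) (at y) \<and> 0 \<le> z" using DW1 by blast
    qed
    then show ?thesis using zeros by simp
  qed
  have sq: "\<kappa> * sqrt (2 * W x) \<le> W1 x" if x: "s \<le> x" "x \<le> w" for x
  proof -
    have "(W1 s)\<^sup>2 - 2 * \<kappa>\<^sup>2 * W s \<le> (W1 x)\<^sup>2 - 2 * \<kappa>\<^sup>2 * W x"
    proof (rule DERIV_nonneg_imp_nondecreasing[OF x(1)])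
      fix y assume y: "s \<le> y" "y \<le> x"
      have "((\<lambda>w. (W1 w)\<^sup>2 - 2 * \<kappa>\<^sup>2 * W w) has_real_derivative 2 * W1 y * (W2 y - \<kappa>\<^sup>2)) (at y)"
        by (auto intro!: derivative_eq_intros DW DW1 simp: algebra_simps)
      moreover have "0 \<le> 2 * W1 y * (W2 y - \<kappa>\<^sup>2)" using W1n[of y] W2[of y] y x by auto
      ultimately show "\<exists>z. ((\<lambda>w. (W1 w)\<^sup>2 - 2 * \<kappa>\<^sup>2 * W w) has_real_derivative z) (at y) \<and> 0 \<le> z" by blast
    qed
    then have "2 * \<kappa>\<^sup>2 * W x \<le> (W1 x)\<^sup>2" using zeros by simp
    then show ?thesis
      using W1n[OF x] W_nonneg[of x] by (auto intro: power2_le_imp_le simp: power_mult_distrib)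
  qed
  have "W s - \<kappa> * (\<Psi> s - \<Psi> s) \<le> W w - \<kappa> * (\<Psi> w - \<Psi> s)"
  proof (rule DERIV_nonneg_imp_nondecreasing[OF w])
    fix y assume y: "s \<le> y" "y \<le> w"
    have "((\<lambda>w. W w - \<kappa> * (\<Psi> w - \<Psi> s)) has_real_derivative W1 y - \<kappa> * sqrt (2 * W y)) (at y)"
      by (auto intro!: derivative_eq_intros DW D\<Psi>)
    then show "\<exists>z. ((\<lambda>w. W w - \<kappa> * (\<Psi> w - \<Psi> s)) has_real_derivative z) (at y) \<and> 0 \<le> z"
      using sq[OF y] by (intro exI[of _ "W1 y - \<kappa> * sqrt (2 * W y)"]) auto
  qed
  then show ?thesis using zeros by simp
qed

text \<open>\<open>\<Psi>\<close> is the phase function of Modica and Mortola;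
  \<open>\<Psi> 1 - \<Psi> (-1)\<close> is the cost of one transition. The inequality between
  \<open>W2 s\<close> and \<open>\<kappa>\<^sup>2\<close> is strict so that it persists near each
  well by continuity.\<close>

locale double_well =
  fixes W W1 W2 \<Psi> :: "real \<Rightarrow> real" and \<kappa> :: real
  assumes DW: "\<And>w. (W has_real_derivative W1 w) (at w)"
    and DW1: "\<And>w. (W1 has_real_derivative W2 w) (at w)"
    and W2_cont: "\<And>w. isCont W2 w"
    and W_nonneg: "\<And>w. W w \<ge> 0"
    and W_well: "\<And>s. s \<in> {-1, 1} \<Longrightarrow> W s = 0"
    and W1_well: "\<And>s. s \<in> {-1, 1} \<Longrightarrow> W1 s = 0"
    and W2_well: "\<And>s. s \<in> {-1, 1} \<Longrightarrow> W2 s > \<kappa>\<^sup>2"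
    and W_pos: "\<And>w. w \<noteq> 1 \<Longrightarrow> w \<noteq> -1 \<Longrightarrow> W w > 0"
    and D\<Psi>: "\<And>w. (\<Psi> has_real_derivative sqrt (2 * W w)) (at w)"
    and \<kappa>_pos: "\<kappa> > 0"
begin

lemma \<Psi>_mono: "x \<le> y \<Longrightarrow> \<Psi> x \<le> \<Psi> y"
  by (rule DERIV_nonneg_imp_nondecreasing[of x y \<Psi>]) (use D\<Psi> W_nonneg in \<open>auto intro!: exI\<close>)

lemma W_cont: "isCont W w" and \<Psi>_cont: "isCont \<Psi> w"
  using DW D\<Psi> DERIV_isCont by blast+

lemma well_growth:
  assumes s: "s \<in> {-1, 1}"
  obtains \<rho> where "\<rho> > 0" "\<And>w. \<bar>w - s\<bar> \<le> \<rho> \<Longrightarrow> \<kappa> * \<bar>\<Psi> w - \<Psi> s\<bar> \<le> W w"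
proof -
  have "\<forall>\<^sub>F w in nhds s. W2 w > \<kappa>\<^sup>2"
    using order_tendstoD(1)[of W2 "W2 s" "nhds s"] W2_cont[of s] W2_well[OF s]
    by (simp add: isCont_def tendsto_at_iff_tendsto_nhds)
  then obtain d where d: "d > 0" "\<And>w. dist w s < d \<Longrightarrow> W2 w > \<kappa>\<^sup>2"
    unfolding eventually_nhds_metric by blast
  define \<rho> where "\<rho> = d/2"
  have W2: "W2 w > \<kappa>\<^sup>2" if "\<bar>w - s\<bar> \<le> \<rho>" for w
    using d that unfolding \<rho>_def dist_real_def by auto
  have zeros: "W s = 0" "W1 s = 0"
    using s W_well W1_well by auto
  have right: "\<kappa> * (\<Psi> w - \<Psi> s) \<le> W w" if "s \<le> w" "w \<le> s + \<rho>" for w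
    by (rule half_well_growth[OF DW DW1 D\<Psi> W_nonneg zeros \<kappa>_pos that(1)]) (use W2 that in auto)
  have left: "\<kappa> * (\<Psi> s - \<Psi> w) \<le> W w" if w: "w \<le> s" "s - \<rho> \<le> w" for w
  proof -
    \<comment> \<open>Reflection: \<open>- \<Psi> (- x)\<close> is an antiderivative of
      \<open>sqrt (2 * W (- x))\<close>, and the left side of the well at \<open>s\<close> becomes
      the right side of a well at \<open>- s\<close>.\<close>
    have "\<kappa> * (- \<Psi> (- (- w)) - - \<Psi> (- (- s))) \<le> W (- (- w))"
    proof (rule half_well_growth[where W = "\<lambda>x. W (- x)" and ?W1.0 = "\<lambda>x. - W1 (- x)" and ?W2.0 = "\<lambda>x. W2 (- x)"])
      show "((\<lambda>x. W (- x)) has_real_derivative - W1 (- x)) (at x)"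
        "((\<lambda>x. - W1 (- x)) has_real_derivative W2 (- x)) (at x)"
        "((\<lambda>x. - \<Psi> (- x)) has_real_derivative sqrt (2 * W (- x))) (at x)" for x
        using DW[of "- x", unfolded DERIV_mirror] DERIV_minus[OF DW1[of "- x", unfolded DERIV_mirror]]
          DERIV_minus[OF D\<Psi>[of "- x", unfolded DERIV_mirror]] by (simp_all only: minus_minus)
    qed (use w W2 W_nonneg zeros \<kappa>_pos in auto)
    then show ?thesis by simp
  qed
  show ?thesis
  proof (rule that)
    show "\<rho> > 0" using d \<rho>_def by simp
    show "\<kappa> * \<bar>\<Psi> w - \<Psi> s\<bar> \<le> W w" if "\<bar>w - s\<bar> \<le> \<rho>" for w
      using right[of w] left[of w] \<Psi>_mono[of s w] \<Psi>_mono[of w s] that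
      by (cases "s \<le> w") (auto simp: abs_if)
  qed
qed

definition edens :: "real \<Rightarrow> (real \<Rightarrow> real) \<Rightarrow> (real \<Rightarrow> real) \<Rightarrow> real \<Rightarrow> real" where
  "edens \<epsilon> w w' x = \<epsilon> / 2 * (w' x)\<^sup>2 + W (w x) / \<epsilon>"

lemma edens_nonneg: "\<epsilon> > 0 \<Longrightarrow> edens \<epsilon> w w' x \<ge> 0"
  unfolding edens_def using W_nonneg by auto

lemma edens_cont:
  assumes "continuous_on S w" "continuous_on S w'" "\<epsilon> > 0"
  shows "continuous_on S (edens \<epsilon> w w')"
proof -
  have "continuous_on UNIV W" using W_cont continuous_at_imp_continuous_on by blast
  then have "continuous_on S (\<lambda>x. W (w x))"
    using assms(1) continuous_on_compose2 by blast
  then show ?thesis unfolding edens_def using assms by (auto intro!: continuous_intros)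
qed

lemma edens_int:
  assumes "\<And>x. x \<in> {p..q} \<Longrightarrow> (w has_real_derivative w' x) (at x within {p..q})"
    "continuous_on {p..q} w'" "\<epsilon> > 0"
  shows "edens \<epsilon> w w' integrable_on {p..q}"
  using edens_cont[of "{p..q}" w w'] assms DERIV_continuous_on integrable_continuous_real by blast

text \<open>The weight spends only the fraction \<open>\<theta>\<^sup>2\<close> of the potential
  term. In the calibration \<open>\<theta>\<close> is the value of \<open>tanh\<close>, and the
  unspent \<open>(1 - \<theta>\<^sup>2) * W / \<epsilon>\<close> pays for the derivative of
  \<open>tanh\<close>; \<open>\<theta> = 1\<close> is the inequality of Modica and Mortola.\<close>

lemma young_sqrt:
  assumes "\<epsilon> > 0"
  shows "\<theta> * sqrt (2 * W z) * \<bar>y\<bar> \<le> \<theta>\<^sup>2 * W z / \<epsilon> + \<epsilon> / 2 * y\<^sup>2"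
proof -
  have "0 \<le> (\<theta> * sqrt (2 * W z) - \<epsilon> * \<bar>y\<bar>)\<^sup>2" by simp
  also have "\<dots> = \<theta>\<^sup>2 * (2 * W z) + \<epsilon>\<^sup>2 * y\<^sup>2 - 2 * \<epsilon> * (\<theta> * sqrt (2 * W z) * \<bar>y\<bar>)"
    using W_nonneg[of z] by (simp add: power2_diff power_mult_distrib)
  finally have "2 * \<epsilon> * (\<theta> * sqrt (2 * W z) * \<bar>y\<bar>) \<le> 2 * \<epsilon> * (\<theta>\<^sup>2 * W z / \<epsilon> + \<epsilon> / 2 * y\<^sup>2)"
    using assms by (simp add: distrib_left power2_eq_square)
  then show ?thesis using assms by (simp del: mult.assoc)
qed

lemma transition_cost:
  assumes "p \<le> q" "\<epsilon> > 0"
    and D: "\<And>x. x \<in> {p..q} \<Longrightarrow> (w has_real_derivative w' x) (at x within {p..q})"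
    and c: "continuous_on {p..q} w'"
  shows "\<bar>\<Psi> (w q) - \<Psi> (w p)\<bar> \<le> integral {p..q} (edens \<epsilon> w w')"
proof (rule ftc_bound[where f = "\<lambda>x. sqrt (2 * W (w x)) * w' x"])
  show "((\<lambda>a. \<Psi> (w a)) has_real_derivative sqrt (2 * W (w x)) * w' x) (at x within {p..q})"
    if "x \<in> {p..q}" for x
    using DERIV_chain2[OF D\<Psi> D[OF that]] .
  show "\<bar>sqrt (2 * W (w x)) * w' x\<bar> \<le> edens \<epsilon> w w' x" for x
    using young_sqrt[OF assms(2), of 1 "w x" "w' x"] W_nonneg[of "w x"]
    by (simp add: edens_def abs_mult)
qed (use assms edens_int in auto)

text \<open>Since \<open>tanh\<close> solves \<open>y' = 1 - y\<^sup>2\<close>, the derivative of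
  \<open>tanh (\<kappa> (x - c) / \<epsilon>) (\<Psi> (w x) - \<Psi> s)\<close> is dominated by the energy density as long as
  \<open>\<kappa> \<bar>\<Psi> (w x) - \<Psi> s\<bar> \<le> W (w x)\<close>.\<close>
lemma calibration:
  assumes "p \<le> q" "\<epsilon> > 0"
    and D: "\<And>x. x \<in> {p..q} \<Longrightarrow> (w has_real_derivative w' x) (at x within {p..q})"
    and c: "continuous_on {p..q} w'"
    and near: "\<And>x. x \<in> {p..q} \<Longrightarrow> \<kappa> * \<bar>\<Psi> (w x) - \<Psi> s\<bar> \<le> W (w x)"
  shows "\<bar>tanh (\<kappa> * (q - z) / \<epsilon>) * (\<Psi> (w q) - \<Psi> s) - tanh (\<kappa> * (p - z) / \<epsilon>) * (\<Psi> (w p) - \<Psi> s)\<bar>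
    \<le> integral {p..q} (edens \<epsilon> w w')"
proof -
  define \<theta> where "\<theta> x = tanh (\<kappa> * (x - z) / \<epsilon>)" for x
  have D\<theta>: "(\<theta> has_real_derivative (1 - (\<theta> x)\<^sup>2) * (\<kappa> / \<epsilon>)) (at x within S)" for x S
    unfolding \<theta>_def using assms(2)
    by (auto intro!: derivative_eq_intros)
  have th1: "\<theta> x < 1" "\<theta> x > -1" for x
    by (auto simp: \<theta>_def tanh_real_lt_1 tanh_real_gt_neg1)
  have th: "(\<theta> x)\<^sup>2 \<le> 1" for x
    using th1[of x] by (simp add: abs_square_le_1 abs_le_iff)
  have "\<bar>\<theta> q * (\<Psi> (w q) - \<Psi> s) - \<theta> p * (\<Psi> (w p) - \<Psi> s)\<bar> \<le> integral {p..q} (edens \<epsilon> w w')"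
  proof (rule ftc_bound[where f = "\<lambda>x. (1 - (\<theta> x)\<^sup>2) * (\<kappa> / \<epsilon>) * (\<Psi> (w x) - \<Psi> s)
              + \<theta> x * (sqrt (2 * W (w x)) * w' x)"])
    fix x assume x: "x \<in> {p..q}"
    show "((\<lambda>a. \<theta> a * (\<Psi> (w a) - \<Psi> s)) has_real_derivative (1 - (\<theta> x)\<^sup>2) * (\<kappa> / \<epsilon>) * (\<Psi> (w x) - \<Psi> s)
              + \<theta> x * (sqrt (2 * W (w x)) * w' x)) (at x within {p..q})"
      by (rule derivative_eq_intros D\<theta> DERIV_chain2[OF D\<Psi> D[OF x]] refl)+ (simp add: algebra_simps)
    have A: "(1 - (\<theta> x)\<^sup>2) * (\<kappa> / \<epsilon>) * \<bar>\<Psi> (w x) - \<Psi> s\<bar> \<le> (1 - (\<theta> x)\<^sup>2) * W (w x) / \<epsilon>"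
      using mult_left_mono[OF near[OF x], of "(1 - (\<theta> x)\<^sup>2) / \<epsilon>"] th[of x] assms(2)
      by (simp add: field_simps)
    have B: "\<bar>\<theta> x\<bar> * sqrt (2 * W (w x)) * \<bar>w' x\<bar> \<le> (\<theta> x)\<^sup>2 * W (w x) / \<epsilon> + \<epsilon> / 2 * (w' x)\<^sup>2"
      using young_sqrt[OF assms(2), of "\<bar>\<theta> x\<bar>" "w x" "w' x"] by simp
    have "\<bar>(1 - (\<theta> x)\<^sup>2) * (\<kappa> / \<epsilon>) * (\<Psi> (w x) - \<Psi> s) + \<theta> x * (sqrt (2 * W (w x)) * w' x)\<bar>
      \<le> (1 - (\<theta> x)\<^sup>2) * (\<kappa> / \<epsilon>) * \<bar>\<Psi> (w x) - \<Psi> s\<bar> + \<bar>\<theta> x\<bar> * sqrt (2 * W (w x)) * \<bar>w' x\<bar>"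
      using th[of x] assms(2) \<kappa>_pos W_nonneg[of "w x"]
      by (intro order_trans[OF abs_triangle_ineq]) (simp add: abs_mult)
    also have "\<dots> \<le> (1 - (\<theta> x)\<^sup>2) * W (w x) / \<epsilon> + ((\<theta> x)\<^sup>2 * W (w x) / \<epsilon> + \<epsilon> / 2 * (w' x)\<^sup>2)"
      using A B by linarith
    also have "\<dots> = edens \<epsilon> w w' x"
      by (simp add: edens_def algebra_simps diff_divide_distrib)
    finally show "\<bar>(1 - (\<theta> x)\<^sup>2) * (\<kappa> / \<epsilon>) * (\<Psi> (w x) - \<Psi> s) + \<theta> x * (sqrt (2 * W (w x)) * w' x)\<bar>
       \<le> edens \<epsilon> w w' x" .
  qed (use assms edens_int in auto)
  then show ?thesis by (simp add: \<theta>_def)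
qed

end

lemma tanh_lower: "1 - 2 * exp (- 2 * y) \<le> tanh y" for y :: real
proof -
  define e where "e = exp (- 2 * y)"
  have e: "e > 0" by (simp add: e_def)
  have "tanh y = (1 - e) / (1 + e)"
    by (simp add: tanh_real_altdef e_def)
  moreover have "(1 - 2 * e) * (1 + e) \<le> 1 - e"
    using e by (simp add: algebra_simps)
  ultimately have "1 - 2 * e \<le> tanh y"
    using e by (simp add: pos_le_divide_eq)
  then show ?thesis unfolding e_def .
qed

section \<open>Point values from closeness of the transforms\<close>

lemma bar_diff:
  assumes "g integrable_on {a..b}" "x \<in> {a..b}" "y \<in> {a..b}" "x \<le> y"
  shows "bar a b g y - bar a b g x = integral {x..y} g"
proof -
  have "integral {a..x} g + integral {x..y} g = integral {a..y} g"
    by (rule hk_integral_combine)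
      (use assms integrable_on_subinterval[OF assms(1), of a y] in auto)
  then show ?thesis by (simp add: bar_def)
qed

lemma bar_continuous:
  assumes "g integrable_on {a..b}"
  shows "continuous_on {a..b} (bar a b g)"
  unfolding bar_def using indefinite_integral_continuous_1[OF assms]
  by (intro continuous_intros)

lemma small_point:
  fixes g :: "real \<Rightarrow> real"
  assumes "c < d" "continuous_on {c..d} g" "integral {c..d} (\<lambda>x. \<bar>g x\<bar>) \<le> \<delta>"
  shows "\<exists>x\<in>{c..d}. \<bar>g x\<bar> \<le> \<delta> / (d - c)"
proof (rule ccontr)
  assume "\<not> ?thesis"
  then have g: "\<And>x. x \<in> {c..d} \<Longrightarrow> \<bar>g x\<bar> > \<delta> / (d - c)" by force
  have cont: "continuous_on {c..d} (\<lambda>x. \<bar>g x\<bar>)" using assms by (intro continuous_intros)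
  obtain z where z: "z \<in> {c..d}" "\<And>x. x \<in> {c..d} \<Longrightarrow> \<bar>g z\<bar> \<le> \<bar>g x\<bar>"
    using continuous_attains_inf[OF compact_Icc _ cont] assms(1) by auto
  have "integral {c..d} (\<lambda>x. \<bar>g z\<bar>) \<le> integral {c..d} (\<lambda>x. \<bar>g x\<bar>)"
    by (rule integral_le) (use z cont integrable_continuous_real in auto)
  then have "\<bar>g z\<bar> * (d - c) \<le> \<delta>" using assms by (simp add: mult.commute)
  then show False using g[OF z(1)] assms(1) by (simp add: field_simps)
qed

text \<open>Closeness in \<open>L1\<close> makes \<open>B\<close> small at one point of the first
  and one of the last third of \<open>{c..d}\<close>. The difference of these two values is the
  integral of \<open>w - s\<close> between the points, because the mean in \<open>bar\<close>
  cancels, and the mean value theorem yields \<open>\<xi>\<close>. With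
  \<open>k = (d - c) / 3\<close> the result is
  \<open>k\<^sup>2 * \<bar>w \<xi> - s\<bar> \<le> 2 * \<delta>\<close>, hence 18 as 2 times
  9.\<close>

lemma bar_close_point:
  assumes o: "a \<le> c" "c < d" "d \<le> b" and w: "continuous_on {a..b} w" and v: "v integrable_on {a..b}"
    and vs: "\<And>x. x \<in> {c<..<d} \<Longrightarrow> v x = s"
    and L: "L1_dist a b (bar a b w) (bar a b v) \<le> \<delta>" and \<delta>: "18 * \<delta> \<le> \<rho> * (d - c)\<^sup>2"
  shows "\<exists>x\<in>{c..d}. \<bar>w x - s\<bar> \<le> \<rho>"
proof -
  define B where "B x = bar a b w x - bar a b v x" for x
  have wi: "w integrable_on {a..b}" using w integrable_continuous_real by blast
  have Bc: "continuous_on {a..b} B"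
    unfolding B_def using bar_continuous wi v by (intro continuous_intros) auto
  define k where "k = (d - c) / 3"
  have k: "k > 0" "d - c = 3 * k" using o by (auto simp: k_def)
  have sub: "integral {x..y} (\<lambda>x. \<bar>B x\<bar>) \<le> \<delta>" if "a \<le> x" "y \<le> b" for x y
  proof -
    have "(\<lambda>x. \<bar>B x\<bar>) integrable_on {a..b}"
      by (intro integrable_continuous_real continuous_intros Bc)
    then have "integral {x..y} (\<lambda>x. \<bar>B x\<bar>) \<le> integral {a..b} (\<lambda>x. \<bar>B x\<bar>)"
      using that integrable_on_subinterval[of _ "{a..b}" x y]
      by (intro integral_subset_le) auto
    then show ?thesis using L by (simp add: L1_dist_def B_def)
  qed
  obtain x where x: "x \<in> {c..c+k}" "\<bar>B x\<bar> \<le> \<delta> / k"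
    using small_point[of c "c+k" B \<delta>] sub[of c "c+k"] k o Bc continuous_on_subset[OF Bc, of "{c..c+k}"] by auto
  obtain y where y: "y \<in> {d-k..d}" "\<bar>B y\<bar> \<le> \<delta> / k"
    using small_point[of "d-k" d B \<delta>] sub[of "d-k" d] k o Bc continuous_on_subset[OF Bc, of "{d-k..d}"] by auto
  have xy: "x < y" "y - x \<ge> k" "{x..y} \<subseteq> {a..b}" "{x..y} \<subseteq> {c..d}"
    using x y k o by auto
  have "B y - B x = integral {x..y} w - integral {x..y} v"
    using bar_diff[OF wi, of x y] bar_diff[OF v, of x y] xy by (simp add: B_def)
  also have "integral {x..y} v = integral {x..y} (\<lambda>x. s)"
    by (rule integral_spike[of "{x, y}"]) (use vs xy in auto)
  also have "\<dots> = s * (y - x)" using xy by simp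
  finally have Bd: "B y - B x = integral {x..y} w - s * (y - x)" .
  have wc: "continuous_on {x..y} w" using w xy continuous_on_subset by blast
  have "\<exists>\<xi>. \<xi> \<in> {x<..<y} \<and> integral {x..y} w - integral {x..x} w = (y - x) * w \<xi>"
  proof -
    have D: "((\<lambda>z. integral {x..z} w) has_real_derivative w z) (at z within {x..y})" if "z \<in> {x..y}" for z
      using integral_has_real_derivative[OF wc that] .
    have "\<exists>\<xi>\<in>{x<..<y}. integral {x..y} w - integral {x..x} w = (\<lambda>h. h * w \<xi>) (y - x)"
      by (rule mvt_simple[OF xy(1)]) (use D in \<open>auto simp: has_field_derivative_def mult_commute_abs\<close>)
    then show ?thesis by auto
  qed
  then obtain \<xi> where \<xi>: "\<xi> \<in> {x<..<y}" "integral {x..y} w = (y - x) * w \<xi>" by auto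
  have "(y - x) * \<bar>w \<xi> - s\<bar> = \<bar>B y - B x\<bar>"
  proof -
    have "B y - B x = (y - x) * (w \<xi> - s)" by (simp add: Bd \<xi>(2) algebra_simps)
    then show ?thesis using xy(1) by (simp add: abs_mult)
  qed
  also have "\<dots> \<le> 2 * \<delta> / k" using x y by (simp add: abs_if split: if_splits)
  finally have "k * \<bar>w \<xi> - s\<bar> \<le> 2 * \<delta> / k"
    using mult_right_mono[OF xy(2), of "\<bar>w \<xi> - s\<bar>"] by simp
  then have "k\<^sup>2 * \<bar>w \<xi> - s\<bar> \<le> 2 * \<delta>" using k by (simp add: field_simps power2_eq_square)
  also have "\<dots> \<le> k\<^sup>2 * \<rho>" using \<delta> by (simp add: k(2) power2_eq_square mult.commute)
  finally have "\<bar>w \<xi> - s\<bar> \<le> \<rho>" using k by simp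
  then show ?thesis using \<xi> xy by (intro bexI[of _ \<xi>]) auto
qed

section \<open>Cost of one transition layer with its tails\<close>

context double_well begin

text \<open>Either \<open>w\<close> stays within \<open>\<rho>0\<close> of the well on the whole
  interval, and the calibration applies, or it leaves this neighbourhood, and then the transition up
  to the exit already costs at least \<open>\<bar>\<Psi> (w z) - \<Psi> s\<bar>\<close>.\<close>

lemma well_end:
  assumes s: "s \<in> {-1, 1}"
  obtains \<rho> C where "\<rho> > 0" "\<And>y. \<bar>y - s\<bar> \<le> \<rho> \<Longrightarrow> \<bar>\<Psi> y - \<Psi> s\<bar> \<le> C"
    "\<And>p q w w' \<epsilon> z. p \<le> q \<Longrightarrow> \<epsilon> > 0 \<Longrightarrow>
        (\<And>x. x \<in> {p..q} \<Longrightarrow> (w has_real_derivative w' x) (at x within {p..q})) \<Longrightarrow>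
        continuous_on {p..q} w' \<Longrightarrow> z \<in> {p, q} \<Longrightarrow> \<bar>w z - s\<bar> \<le> \<rho> \<Longrightarrow>
        (1 - 2 * exp (- 2 * (\<kappa> * (q - p) / \<epsilon>))) * \<bar>\<Psi> (w z) - \<Psi> s\<bar> \<le> integral {p..q} (edens \<epsilon> w w')"
proof -
  obtain \<rho>1 where \<rho>1: "\<rho>1 > 0" "\<And>w. \<bar>w - s\<bar> \<le> \<rho>1 \<Longrightarrow> \<kappa> * \<bar>\<Psi> w - \<Psi> s\<bar> \<le> W w"
    using well_growth[OF s] by blast
  \<comment> \<open>The bound 1 keeps the other well, at distance 2, out of the neighbourhood; hence
    \<open>\<Psi>\<close> increases strictly there and \<open>m\<close> below is positive.\<close>
  define \<rho>0 where "\<rho>0 = min \<rho>1 1"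
  have \<rho>0: "\<rho>0 > 0" "\<rho>0 \<le> 1" "\<rho>0 \<le> \<rho>1"
    using \<rho>1 by (auto simp: \<rho>0_def)
  have inc: "\<Psi> x < \<Psi> y" if "x < y" "\<And>z. x < z \<Longrightarrow> z < y \<Longrightarrow> z \<noteq> 1 \<and> z \<noteq> -1" for x y
  proof (rule DERIV_pos_imp_increasing_open[OF that(1)])
    show "\<exists>d. (\<Psi> has_real_derivative d) (at z) \<and> 0 < d" if "x < z" "z < y" for z
      using D\<Psi>[of z] W_pos[of z] \<open>\<And>z. x < z \<Longrightarrow> z < y \<Longrightarrow> z \<noteq> 1 \<and> z \<noteq> -1\<close>[OF that] by auto
    show "continuous_on {x..y} \<Psi>"
      using \<Psi>_cont continuous_at_imp_continuous_on by blast
  qed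
  define m where "m = min (\<Psi> (s + \<rho>0) - \<Psi> s) (\<Psi> s - \<Psi> (s - \<rho>0))"
  have m: "m > 0"
  proof -
    have "\<Psi> s < \<Psi> (s + \<rho>0)" by (rule inc) (use \<rho>0 s in auto)
    moreover have "\<Psi> (s - \<rho>0) < \<Psi> s" by (rule inc) (use \<rho>0 s in auto)
    ultimately show ?thesis by (simp add: m_def)
  qed
  have far: "m \<le> \<bar>\<Psi> y - \<Psi> s\<bar>" if "\<bar>y - s\<bar> > \<rho>0" for y
    using \<Psi>_mono[of "s + \<rho>0" y] \<Psi>_mono[of y "s - \<rho>0"] that m
    by (auto simp: m_def abs_if split: if_splits)
  \<comment> \<open>Half of \<open>m\<close> makes leaving expensive enough: the way from a value
    within \<open>m / 2\<close> of \<open>\<Psi> s\<close> to one at distance at least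
    \<open>m\<close> costs at least \<open>m / 2\<close>.\<close>
  obtain \<rho>2 where \<rho>2: "\<rho>2 > 0" "\<And>y. \<bar>y - s\<bar> < \<rho>2 \<Longrightarrow> \<bar>\<Psi> y - \<Psi> s\<bar> < m/2"
    using \<Psi>_cont[of s, unfolded continuous_at_eps_delta, rule_format, of "m/2"] m
    unfolding dist_real_def by (metis half_gt_zero)
  define \<rho> where "\<rho> = \<rho>2/2"
  have near: "\<bar>\<Psi> y - \<Psi> s\<bar> \<le> m/2" if "\<bar>y - s\<bar> \<le> \<rho>" for y
    using \<rho>2(1) less_imp_le[OF \<rho>2(2), of y] that by (auto simp: \<rho>_def)
  show ?thesis
  proof (rule that)
    show "\<rho> > 0" using \<rho>2 \<rho>_def by simp
    show "\<bar>\<Psi> y - \<Psi> s\<bar> \<le> m/2" if "\<bar>y - s\<bar> \<le> \<rho>" for y using near that .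
    fix p q w w' \<epsilon> z
    assume pq: "p \<le> (q::real)" and eps: "(\<epsilon>::real) > 0" 
       and D: "\<And>x. x \<in> {p..q} \<Longrightarrow> (w has_real_derivative w' x) (at x within {p..q})"
       and c: "continuous_on {p..q} w'" and z: "z \<in> {p, q}" and wz: "\<bar>w z - s\<bar> \<le> \<rho>"
    show "(1 - 2 * exp (- 2 * (\<kappa> * (q - p) / \<epsilon>))) * \<bar>\<Psi> (w z) - \<Psi> s\<bar> \<le> integral {p..q} (edens \<epsilon> w w')"
    proof (cases "\<forall>x\<in>{p..q}. \<bar>w x - s\<bar> \<le> \<rho>0")
      case True
      then have n: "\<kappa> * \<bar>\<Psi> (w x) - \<Psi> s\<bar> \<le> W (w x)" if "x \<in> {p..q}" for x
        using \<rho>1(2) \<rho>0 that by fastforce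
      have "tanh (\<kappa> * (q - p) / \<epsilon>) * \<bar>\<Psi> (w z) - \<Psi> s\<bar> \<le> integral {p..q} (edens \<epsilon> w w')"
      \<comment> \<open>The \<open>tanh\<close> is centred at the endpoint opposite to
        \<open>z\<close>. It vanishes there, so the value of \<open>w\<close> at that end drops
        out.\<close>
      proof (cases "z = p")
        case True
        have "\<kappa> * (p - q) / \<epsilon> = - (\<kappa> * (q - p) / \<epsilon>)"
          by (metis minus_diff_eq minus_divide_left mult_minus_right)
        then have "tanh (\<kappa> * (p - q) / \<epsilon>) = - tanh (\<kappa> * (q - p) / \<epsilon>)" by (metis tanh_minus)
        moreover have "0 \<le> tanh (\<kappa> * (q - p) / \<epsilon>)" using pq eps \<kappa>_pos by simp
        ultimately show ?thesis
          using calibration[OF pq eps D c n, of q] True by (simp add: abs_mult)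
      next
        case False
        moreover have "0 \<le> tanh (\<kappa> * (q - p) / \<epsilon>)" using pq eps \<kappa>_pos by simp
        ultimately show ?thesis
          using calibration[OF pq eps D c n, of p] z by (auto simp add: abs_mult)
      qed
      moreover have "(1 - 2 * exp (- 2 * (\<kappa> * (q - p) / \<epsilon>))) * \<bar>\<Psi> (w z) - \<Psi> s\<bar>
          \<le> tanh (\<kappa> * (q - p) / \<epsilon>) * \<bar>\<Psi> (w z) - \<Psi> s\<bar>"
        by (intro mult_right_mono tanh_lower) auto
      ultimately show ?thesis by linarith
    next
      case False
      then obtain x where x: "x \<in> {p..q}" "\<bar>w x - s\<bar> > \<rho>0" by force
      define l where "l = min x z" 
      define k where "k = max x z"
      have lk: "l \<le> k" "{l..k} \<subseteq> {p..q}" using x z pq by (auto simp: l_def k_def)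
      have "\<bar>\<Psi> (w k) - \<Psi> (w l)\<bar> \<le> integral {l..k} (edens \<epsilon> w w')"
      proof (rule transition_cost[OF lk(1) eps])
        show "(w has_real_derivative w' x) (at x within {l..k})" if "x \<in> {l..k}" for x
          using D[of x] that lk(2) DERIV_subset by blast
        show "continuous_on {l..k} w'" using c lk(2) continuous_on_subset by blast
      qed
      also have "\<dots> \<le> integral {p..q} (edens \<epsilon> w w')"
      proof (rule integral_subset_le[OF lk(2)])
        show "edens \<epsilon> w w' integrable_on {p..q}" using edens_int[OF D c eps] by simp
        then show "edens \<epsilon> w w' integrable_on {l..k}" 
          using lk(2) integrable_on_subinterval by blast
      qed (use edens_nonneg[OF eps] in auto)
      finally have "\<bar>\<Psi> (w x) - \<Psi> (w z)\<bar> \<le> integral {p..q} (edens \<epsilon> w w')"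
        by (auto simp: l_def k_def min_def max_def abs_minus_commute split: if_splits)
      then have "\<bar>\<Psi> (w z) - \<Psi> s\<bar> \<le> integral {p..q} (edens \<epsilon> w w')"
        using far[OF x(2)] near[OF wz] by linarith
      moreover have "(1 - 2 * exp (- 2 * (\<kappa> * (q - p) / \<epsilon>))) * \<bar>\<Psi> (w z) - \<Psi> s\<bar> \<le> \<bar>\<Psi> (w z) - \<Psi> s\<bar>"
        by (simp add: left_diff_distrib)
      ultimately show ?thesis by linarith
    qed
  qed
qed

text \<open>The transition from \<open>p\<close> to \<open>p'\<close> falls short of
  \<open>\<Psi> 1 - \<Psi> (-1)\<close> by at most the distances of \<open>\<Psi> (w p)\<close> and
  \<open>\<Psi> (w p')\<close> from the values at the wells. The tails \<open>{l..p}\<close> and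
  \<open>{p'..q}\<close> cost almost exactly these distances, each with a loss of at most
  \<open>2 * C * E\<close>, and the triangle inequality joins the three pieces.\<close>

lemma jump_cost:
  obtains \<rho> C where "\<rho> > 0" "C \<ge> 0"
    "\<And>l p p' q w w' \<epsilon> L s s'. l \<le> p \<Longrightarrow> p \<le> p' \<Longrightarrow> p' \<le> q \<Longrightarrow> L \<le> p - l \<Longrightarrow> L \<le> q - p' \<Longrightarrow> \<epsilon> > 0 \<Longrightarrow>
        (\<And>x. x \<in> {l..q} \<Longrightarrow> (w has_real_derivative w' x) (at x within {l..q})) \<Longrightarrow>
        continuous_on {l..q} w' \<Longrightarrow> s \<in> {-1, 1} \<Longrightarrow> s' \<in> {-1, 1} \<Longrightarrow> s \<noteq> s' \<Longrightarrow>
        \<bar>w p - s\<bar> \<le> \<rho> \<Longrightarrow> \<bar>w p' - s'\<bar> \<le> \<rho> \<Longrightarrow>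
        (\<Psi> 1 - \<Psi> (-1)) - C * exp (- 2 * (\<kappa> * L / \<epsilon>)) \<le> integral {l..q} (edens \<epsilon> w w')"
proof -
  let ?P = "\<lambda>s \<rho> C. \<rho> > 0 \<and> (\<forall>y. \<bar>y - s\<bar> \<le> \<rho> \<longrightarrow> \<bar>\<Psi> y - \<Psi> s\<bar> \<le> C) \<and>
     (\<forall>p q w w' \<epsilon> z. p \<le> q \<longrightarrow> \<epsilon> > 0 \<longrightarrow>
        (\<forall>x. x \<in> {p..q} \<longrightarrow> (w has_real_derivative w' x) (at x within {p..q})) \<longrightarrow>
        continuous_on {p..q} w' \<longrightarrow> z \<in> {p, q} \<longrightarrow> \<bar>w z - s\<bar> \<le> \<rho> \<longrightarrow>
        (1 - 2 * exp (- 2 * (\<kappa> * (q - p) / \<epsilon>))) * \<bar>\<Psi> (w z) - \<Psi> s\<bar> \<le> integral {p..q} (edens \<epsilon> w w'))"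
  have ex: "\<exists>\<rho> C. ?P s \<rho> C" if s: "s \<in> {-1, 1}" for s
    using well_end[OF s] by metis
  obtain \<rho>1 C1 where 1: "?P 1 \<rho>1 C1" using ex[of 1] by auto
  obtain \<rho>2 C2 where 2: "?P (-1) \<rho>2 C2" using ex[of "-1"] by auto
  define \<rho> where "\<rho> = min \<rho>1 \<rho>2"
  define C where "C = max 0 (max C1 C2)"
  have \<rho>: "\<rho> > 0" "C \<ge> 0" using 1 2 by (auto simp: \<rho>_def C_def)
  have near: "\<bar>\<Psi> y - \<Psi> s\<bar> \<le> C" if "s \<in> {-1, 1}" "\<bar>y - s\<bar> \<le> \<rho>" for s y
  proof (cases "s = 1")
    case True
    then have "\<bar>y - 1\<bar> \<le> \<rho>1" using that by (simp add: \<rho>_def)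
    then have "\<bar>\<Psi> y - \<Psi> 1\<bar> \<le> C1" using 1 by blast
    then show ?thesis using True by (simp add: C_def)
  next
    case False
    then have "\<bar>y - (-1)\<bar> \<le> \<rho>2" using that by (simp add: \<rho>_def)
    then have "\<bar>\<Psi> y - \<Psi> (-1)\<bar> \<le> C2" using 2 by blast
    then show ?thesis using that False by (simp add: C_def)
  qed
  have tail: "(1 - 2 * exp (- 2 * (\<kappa> * (q - p) / \<epsilon>))) * \<bar>\<Psi> (w z) - \<Psi> s\<bar> \<le> integral {p..q} (edens \<epsilon> w w')"
    if "p \<le> q" "\<epsilon> > 0" "\<And>x. x \<in> {p..q} \<Longrightarrow> (w has_real_derivative w' x) (at x within {p..q})"
        "continuous_on {p..q} w'" "z \<in> {p, q}" "s \<in> {-1, 1}" "\<bar>w z - s\<bar> \<le> \<rho>" for p q w w' \<epsilon> z s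
  proof (cases "s = 1")
    case True
    then have "\<bar>w z - 1\<bar> \<le> \<rho>1" using that by (simp add: \<rho>_def)
    then show ?thesis using True 1 that by blast
  next
    case False
    then have "\<bar>w z - (-1)\<bar> \<le> \<rho>2" "s = -1" using that by (auto simp add: \<rho>_def)
    then show ?thesis using 2 that by blast
  qed
  show ?thesis
  proof (rule that)
    show "\<rho> > 0" by fact
    show "4 * C \<ge> 0" using \<rho> by simp
    fix l p p' q w w' s s' and \<epsilon> L :: real
    assume o: "l \<le> p" "p \<le> p'" "p' \<le> (q::real)" and L: "L \<le> p - l" "L \<le> q - p'" and eps: "\<epsilon> > 0"
      and D: "\<And>x. x \<in> {l..q} \<Longrightarrow> (w has_real_derivative w' x) (at x within {l..q})"
      and c: "continuous_on {l..q} w'" and s: "s \<in> {-1, 1::real}" "s' \<in> {-1, 1}" "s \<noteq> s'"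
      and n: "\<bar>w p - s\<bar> \<le> \<rho>" "\<bar>w p' - s'\<bar> \<le> \<rho>"
    have D': "(w has_real_derivative w' x) (at x within {i..j})" if "x \<in> {i..j}" "{i..j} \<subseteq> {l..q}" for i j x
      using D[of x] that DERIV_subset by blast
    have c': "continuous_on {i..j} w'" if "{i..j} \<subseteq> {l..q}" for i j
      using c continuous_on_subset that by blast
    define E where "E = exp (- 2 * (\<kappa> * L / \<epsilon>))"
    have E: "exp (- 2 * (\<kappa> * L' / \<epsilon>)) \<le> E" if "L \<le> L'" for L'
      using that eps \<kappa>_pos by (simp add: E_def divide_right_mono)
    have est: "\<bar>g\<bar> - 2 * C * E \<le> (1 - 2 * exp (- 2 * (\<kappa> * L' / \<epsilon>))) * \<bar>g\<bar>" if "L \<le> L'" "\<bar>g\<bar> \<le> C" for L' g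
    proof -
      have "exp (- 2 * (\<kappa> * L' / \<epsilon>)) * \<bar>g\<bar> \<le> E * C"
        by (intro mult_mono E that) (auto simp: E_def)
      then show ?thesis by (simp add: algebra_simps)
    qed
    have I1: "\<bar>\<Psi> (w p) - \<Psi> s\<bar> - 2 * C * E \<le> integral {l..p} (edens \<epsilon> w w')"
    proof -
      have "(1 - 2 * exp (- 2 * (\<kappa> * (p - l) / \<epsilon>))) * \<bar>\<Psi> (w p) - \<Psi> s\<bar> \<le> integral {l..p} (edens \<epsilon> w w')"
        by (rule tail) (use o eps s n in \<open>auto intro!: D' c'\<close>)
      then show ?thesis using est[OF L(1) near[OF s(1) n(1)]] by linarith
    qed
    have I3: "\<bar>\<Psi> (w p') - \<Psi> s'\<bar> - 2 * C * E \<le> integral {p'..q} (edens \<epsilon> w w')"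
    proof -
      have "(1 - 2 * exp (- 2 * (\<kappa> * (q - p') / \<epsilon>))) * \<bar>\<Psi> (w p') - \<Psi> s'\<bar> \<le> integral {p'..q} (edens \<epsilon> w w')"
        by (rule tail) (use o eps s n in \<open>auto intro!: D' c'\<close>)
      then show ?thesis using est[OF L(2) near[OF s(2) n(2)]] by linarith
    qed
    have I2: "\<bar>\<Psi> (w p') - \<Psi> (w p)\<bar> \<le> integral {p..p'} (edens \<epsilon> w w')"
      by (rule transition_cost) (use o eps in \<open>auto intro!: D' c'\<close>)
    have int: "edens \<epsilon> w w' integrable_on {l..q}" using edens_int[OF D c eps] by simp
    have "integral {l..p} (edens \<epsilon> w w') + integral {p..q} (edens \<epsilon> w w') = integral {l..q} (edens \<epsilon> w w')"
      by (rule hk_integral_combine) (use o int in auto)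
    moreover have "integral {p..p'} (edens \<epsilon> w w') + integral {p'..q} (edens \<epsilon> w w') = integral {p..q} (edens \<epsilon> w w')"
      by (rule hk_integral_combine)
        (use o integrable_on_subinterval[OF int, of p q] in auto)
    moreover have "\<Psi> 1 - \<Psi> (-1) \<le> \<bar>\<Psi> s' - \<Psi> s\<bar>" using s by auto
    ultimately have "\<Psi> 1 - \<Psi> (-1) - 4 * C * E \<le> integral {l..q} (edens \<epsilon> w w')"
      using I1 I2 I3 by linarith
    then show "(\<Psi> 1 - \<Psi> (-1)) - 4 * C * exp (- 2 * (\<kappa> * L / \<epsilon>)) \<le> integral {l..q} (edens \<epsilon> w w')"
      by (simp add: E_def)
  qed
qed

end

section \<open>Piecewise constant profiles and summation over their jumps\<close>

lemma jump_profileD: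
  assumes "jump_profile a b N h v"
  shows "i \<le> N \<Longrightarrow> hpt a b N h i < hpt a b N h (i + 1)"
    and "x \<in> {a..b} \<Longrightarrow> v x \<in> {-1, 1}"
    and "i \<le> N \<Longrightarrow> x \<in> {hpt a b N h i<..<hpt a b N h (i + 1)} \<Longrightarrow>
      y \<in> {hpt a b N h i<..<hpt a b N h (i + 1)} \<Longrightarrow> v x = v y"
    and "i \<in> {1..N} \<Longrightarrow> x \<in> {hpt a b N h (i - 1)<..<h i} \<Longrightarrow>
      y \<in> {h i<..<hpt a b N h (i + 1)} \<Longrightarrow> v x \<noteq> v y"
  using assms unfolding jump_profile_def by blast+

lemma hpt_mono:
  assumes "jump_profile a b N h v" "i \<le> j" "j \<le> N + 1"
  shows "hpt a b N h i \<le> hpt a b N h j"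
  using assms(2,3)
proof (induction rule: dec_induct)
  case (step n)
  have "hpt a b N h n < hpt a b N h (n + 1)"
    using jump_profileD(1)[OF assms(1)] step by auto
  then show ?case using step by simp
qed simp

lemma profile_integrable:
  assumes J: "jump_profile a b N h v"
  shows "v integrable_on {a..b}"
proof -
  have "v integrable_on {a..hpt a b N h i}" if "i \<le> N + 1" for i
    using that
  proof (induction i)
    case 0
    then show ?case using integrable_on_refl[of v a] by (simp add: hpt_def)
  next
    case (Suc i)
    let ?l = "hpt a b N h i" and ?u = "hpt a b N h (i + 1)"
    have lu: "?l < ?u" "a \<le> ?l"
      using jump_profileD(1)[OF J, of i] Suc hpt_mono[OF J, of 0 i] by (auto simp: hpt_def)
    have "\<exists>c. \<forall>x\<in>{?l<..<?u}. v x = c"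
    proof (intro exI ballI)
      fix x assume "x \<in> {?l<..<?u}"
      moreover have "(?l + ?u)/2 \<in> {?l<..<?u}" using lu by auto
      ultimately show "v x = v ((?l + ?u)/2)"
        using jump_profileD(3)[OF J] Suc.prems by (metis Suc_eq_plus1 Suc_le_mono)
    qed
    then obtain c where c: "\<And>x. x \<in> {?l<..<?u} \<Longrightarrow> v x = c" by blast
    have "v integrable_on {?l..?u}"
      by (rule integrable_spike[of "\<lambda>x. c" _ "{?l, ?u}"]) (use c in auto)
    then show ?case
      using Henstock_Kurzweil_Integration.integrable_combine[of a ?l ?u v] lu Suc by simp
  qed
  from this[of "N + 1"] show ?thesis by (simp add: hpt_def)
qed

text \<open>The spacing by \<open>r\<close> is given separately for consecutive jumps and for the
  two ends of the interval; in terms of \<open>hpt\<close> these become one condition on the two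
  neighbours of \<open>h i\<close>.\<close>

lemma profile_jump:
  assumes J: "jump_profile a b N h v" and r: "r > 0"
    and sp: "\<And>i. 1 \<le> i \<Longrightarrow> i < N \<Longrightarrow> h i + r \<le> h (i + 1) - r"
    and ends: "a \<le> h 1 - r" "h N + r \<le> b"
    and i: "i \<in> {1..N}"
  shows "hpt a b N h (i - 1) \<le> h i - r" "h i + r \<le> hpt a b N h (i + 1)"
    "\<exists>s s'. s \<in> {-1, 1} \<and> s' \<in> {-1, 1} \<and> s \<noteq> s' \<and>
       (\<forall>x\<in>{h i - r<..<h i}. v x = s) \<and> (\<forall>x\<in>{h i<..<h i + r}. v x = s')"
proof -
  show lo: "hpt a b N h (i - 1) \<le> h i - r"
  proof (cases "i = 1")
    case False
    then have "h (i - 1) + r \<le> h (i - 1 + 1) - r" "i - 1 + 1 = i"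
      using sp[of "i - 1"] i by auto
    then show ?thesis using False i r by (auto simp: hpt_def)
  qed (use ends in \<open>simp add: hpt_def\<close>)
  show hi: "h i + r \<le> hpt a b N h (i + 1)"
    using i ends sp[of i] r by (cases "i = N") (auto simp: hpt_def)
  have hi0: "hpt a b N h i = h i" using i by (auto simp: hpt_def)
  have ab: "a \<le> hpt a b N h (i - 1)" "hpt a b N h (i + 1) \<le> b"
    using hpt_mono[OF J, of 0 "i - 1"] hpt_mono[OF J, of "i + 1" "N + 1"] i by (auto simp: hpt_def)
  let ?x = "h i - r/2" and ?y = "h i + r/2"
  have mem: "?x \<in> {a..b}" "?y \<in> {a..b}" using lo hi ab r by auto
  have c1: "v x = v ?x" if "x \<in> {h i - r<..<h i}" for x
  proof -
    have i': "i - 1 + 1 = i" "i - 1 \<le> N" using i by auto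
    show ?thesis
      using jump_profileD(3)[OF J i'(2), of x ?x] that lo r hi0 unfolding i'(1) by auto
  qed
  have c2: "v x = v ?y" if "x \<in> {h i<..<h i + r}" for x
  proof -
    have i': "i \<le> N" using i by auto
    show ?thesis using jump_profileD(3)[OF J i', of x ?y] that hi r hi0 by auto
  qed
  have ne: "v ?x \<noteq> v ?y"
    by (rule jump_profileD(4)[OF J i]) (use lo hi r in auto)
  have "v ?x \<in> {-1, 1}" "v ?y \<in> {-1, 1}"
    using jump_profileD(2)[OF J] mem by blast+
  then show "\<exists>s s'. s \<in> {-1, 1} \<and> s' \<in> {-1, 1} \<and> s \<noteq> s' \<and>
       (\<forall>x\<in>{h i - r<..<h i}. v x = s) \<and> (\<forall>x\<in>{h i<..<h i + r}. v x = s')"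
    using c1 c2 ne by blast
qed

context double_well begin

text \<open>The half-width \<open>r\<close> at each jump is split as \<open>L + r'\<close>: within
  \<open>r'\<close> of the jump a point near each well is located, and \<open>L\<close> remains for
  the tail. The value \<open>L = A / (2 * \<kappa>)\<close> turns the loss into a multiple of
  \<open>exp (- A / \<epsilon>)\<close>, and \<open>A < 2 * \<kappa> * r\<close> is exactly
  \<open>r' > 0\<close>. The intervals of half-width \<open>r\<close> do not overlap, so the costs
  add up.\<close>

lemma energy_lower_bound:
  assumes J: "jump_profile a b N h v" and r: "r > 0"
    and sp: "\<And>i. 1 \<le> i \<Longrightarrow> i < N \<Longrightarrow> h i + r \<le> h (i + 1) - r"
    and ends: "a \<le> h 1 - r" "h N + r \<le> b"
    and A: "0 < A" "A < 2 * \<kappa> * r"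
  obtains \<delta> C where "\<delta> > 0" "C \<ge> 0"
    "\<And>w w' \<epsilon>. \<epsilon> > 0 \<Longrightarrow>
        (\<And>x. x \<in> {a..b} \<Longrightarrow> (w has_real_derivative w' x) (at x within {a..b})) \<Longrightarrow>
        continuous_on {a..b} w' \<Longrightarrow> L1_dist a b (bar a b w) (bar a b v) \<le> \<delta> \<Longrightarrow>
        real N * (\<Psi> 1 - \<Psi> (-1)) - C * exp (- A / \<epsilon>) \<le> integral {a..b} (edens \<epsilon> w w')"
proof -
  obtain \<rho> C where \<rho>: "\<rho> > 0" "C \<ge> 0" and cost:
    "\<And>l p p' q w w' \<epsilon> L s s'. l \<le> p \<Longrightarrow> p \<le> p' \<Longrightarrow> p' \<le> q \<Longrightarrow> L \<le> p - l \<Longrightarrow> L \<le> q - p' \<Longrightarrow> \<epsilon> > 0 \<Longrightarrow>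
        (\<And>x. x \<in> {l..q} \<Longrightarrow> (w has_real_derivative w' x) (at x within {l..q})) \<Longrightarrow>
        continuous_on {l..q} w' \<Longrightarrow> s \<in> {-1, 1} \<Longrightarrow> s' \<in> {-1, 1} \<Longrightarrow> s \<noteq> s' \<Longrightarrow>
        \<bar>w p - s\<bar> \<le> \<rho> \<Longrightarrow> \<bar>w p' - s'\<bar> \<le> \<rho> \<Longrightarrow>
        (\<Psi> 1 - \<Psi> (-1)) - C * exp (- 2 * (\<kappa> * L / \<epsilon>)) \<le> integral {l..q} (edens \<epsilon> w w')"
    using jump_cost by blast
  define L where "L = A / (2 * \<kappa>)"
  define r' where "r' = r - L"
  have r': "r' > 0" "r' < r" using A \<kappa>_pos by (auto simp: r'_def L_def field_simps)
  show ?thesis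
  proof (rule that)
    \<comment> \<open>The threshold that \<open>bar_close_point\<close> requires on intervals of
      length \<open>r'\<close>.\<close>
    show "\<rho> * r'\<^sup>2 / 18 > 0" using \<rho> r' by simp
    show "real N * C \<ge> 0" using \<rho> by simp
    fix w w' and \<epsilon> :: real
    assume eps: "\<epsilon> > 0"
      and D: "\<And>x. x \<in> {a..b} \<Longrightarrow> (w has_real_derivative w' x) (at x within {a..b})"
      and c: "continuous_on {a..b} w'" and L1: "L1_dist a b (bar a b w) (bar a b v) \<le> \<rho> * r'\<^sup>2 / 18"
    let ?e = "edens \<epsilon> w w'"
    define c0 where "c0 = \<Psi> 1 - \<Psi> (-1) - C * exp (- A / \<epsilon>)"
    have wc: "continuous_on {a..b} w" using D DERIV_continuous_on by blast
    have int: "?e integrable_on {x..y}" if "a \<le> x" "y \<le> b" for x y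
      using integrable_on_subinterval[OF edens_int[OF D c eps], of x y] that by auto
    \<comment> \<open>Valid for all \<open>x\<close> and \<open>y\<close>, because the integral of a
      non-integrable function is 0.\<close>
    have nn: "0 \<le> integral {x..y} ?e" for x y
      by (cases "?e integrable_on {x..y}") (auto intro: integral_nonneg edens_nonneg[OF eps] simp: not_integrable_integral)
    have ab: "a \<le> h i - r" "h i + r \<le> b" if i: "i \<in> {1..N}" for i
    proof -
      have "hpt a b N h 0 \<le> hpt a b N h (i - 1)" "hpt a b N h (i + 1) \<le> hpt a b N h (N + 1)"
        using i by (auto intro!: hpt_mono[OF J])
      moreover have "hpt a b N h 0 = a" "hpt a b N h (N + 1) = b" by (auto simp: hpt_def)
      ultimately show "a \<le> h i - r" "h i + r \<le> b"
        using profile_jump(1,2)[OF J r sp ends i] by linarith+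
    qed
    have one: "c0 \<le> integral {h i - r..h i + r} ?e" if i: "i \<in> {1..N}" for i
    proof -
      obtain s s' where s: "s \<in> {-1, 1}" "s' \<in> {-1, 1}" "s \<noteq> s'"
         and v: "\<And>x. x\<in>{h i - r<..<h i} \<Longrightarrow> v x = s" "\<And>x. x\<in>{h i<..<h i + r} \<Longrightarrow> v x = s'"
        using profile_jump(3)[OF J r sp ends i] by blast
      have "\<exists>p\<in>{h i - r'..h i}. \<bar>w p - s\<bar> \<le> \<rho>"
        by (rule bar_close_point[OF _ _ _ wc profile_integrable[OF J] _ L1])
          (use ab[OF i] r' r v(1) in auto)
      then obtain p where p: "p \<in> {h i - r'..h i}" "\<bar>w p - s\<bar> \<le> \<rho>" by blast
      have "\<exists>p\<in>{h i..h i + r'}. \<bar>w p - s'\<bar> \<le> \<rho>"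
        by (rule bar_close_point[OF _ _ _ wc profile_integrable[OF J] _ L1])
          (use ab[OF i] r' r v(2) in auto)
      then obtain p' where p': "p' \<in> {h i..h i + r'}" "\<bar>w p' - s'\<bar> \<le> \<rho>" by blast
      have sub: "{h i - r..h i + r} \<subseteq> {a..b}" using ab[OF i] by auto
      have "(\<Psi> 1 - \<Psi> (-1)) - C * exp (- 2 * (\<kappa> * L / \<epsilon>)) \<le> integral {h i - r..h i + r} ?e"
      proof (rule cost[where p = p and p' = p' and s = s and s' = s'])
        show "(w has_real_derivative w' x) (at x within {h i - r..h i + r})" if "x \<in> {h i - r..h i + r}" for x
          using D[of x] that sub DERIV_subset by blast
        show "continuous_on {h i - r..h i + r} w'" using c sub continuous_on_subset by blast
      qed (use p p' s eps r' r in \<open>auto simp: r'_def\<close>)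
      moreover have "- 2 * (\<kappa> * L / \<epsilon>) = - A / \<epsilon>" using \<kappa>_pos by (simp add: L_def)
      ultimately show ?thesis unfolding c0_def by (simp only:)
    qed
    \<comment> \<open>The right end of the \<open>i\<close>-th interval, with \<open>a\<close> as
      the start of the induction; the gaps between consecutive intervals contribute a non-negative
      energy.\<close>
    define g where "g i = (if i = 0 then a else h i + r)" for i
    have "a \<le> g i \<and> real i * c0 \<le> integral {a..g i} ?e" if "i \<le> N" for i
      using that
    proof (induction i)
      case (Suc i)
      have m: "Suc i \<in> {1..N}" using Suc by auto
      have g: "g i \<le> h (Suc i) - r" using Suc ends sp[of i] by (cases "i = 0") (auto simp: g_def)
      have S: "g (Suc i) = h (Suc i) + r" by (simp add: g_def)
      have "integral {a..g i} ?e + integral {g i..h (Suc i) - r} ?e = integral {a..h (Suc i) - r} ?e"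
        by (rule hk_integral_combine) (use Suc g int ab[OF m] r in auto)
      moreover have "integral {a..h (Suc i) - r} ?e + integral {h (Suc i) - r..h (Suc i) + r} ?e = integral {a..h (Suc i) + r} ?e"
        by (rule hk_integral_combine) (use Suc g int ab[OF m] r in auto)
      ultimately show ?case
        using one[OF m] nn[of "g i" "h (Suc i) - r"] Suc g ab[OF m] r by (auto simp: S algebra_simps)
    qed (use nn in \<open>simp add: g_def\<close>)
    from this[of N] have 1: "a \<le> g N" "real N * c0 \<le> integral {a..g N} ?e" by auto
    have gN: "g N \<le> b" 
      using ends hpt_mono[OF J, of 0 "N+1"] by (auto simp: g_def hpt_def)
    have "integral {a..g N} ?e + integral {g N..b} ?e = integral {a..b} ?e"
      by (rule hk_integral_combine) (use 1 gN int in auto)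
    then have "real N * c0 \<le> integral {a..b} ?e" using 1 nn[of "g N" b] by linarith
    then show "real N * (\<Psi> 1 - \<Psi> (-1)) - real N * C * exp (- A / \<epsilon>) \<le> integral {a..b} ?e"
      by (simp add: c0_def algebra_simps)
  qed
qed

end

section \<open>Smooth test functions and the second du Bois-Reymond lemma\<close>

text \<open>\<open>Ck 0\<close> demands nothing, not even continuity; this is harmless in
  \<open>smooth\<close>, which asks for every order. The derivative is an existential witness, so
  that closure properties follow by induction over the order for all functions at once.\<close>

fun Ck :: "nat \<Rightarrow> (real \<Rightarrow> real) \<Rightarrow> bool" where
  "Ck 0 g = True"
| "Ck (Suc n) g = (\<exists>g'. (\<forall>x. (g has_real_derivative g' x) (at x)) \<and> Ck n g')"

definition smooth :: "(real \<Rightarrow> real) \<Rightarrow> bool" where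
  "smooth g \<longleftrightarrow> (\<forall>n. Ck n g)"

lemma Ck_mono: "Ck (Suc n) g \<Longrightarrow> Ck n g"
  by (induction n arbitrary: g) auto

lemma Ck_const: "Ck n (\<lambda>x. c)"
  by (induction n arbitrary: c) (auto intro!: exI[of _ "\<lambda>x. 0"] derivative_eq_intros)

lemma Ck_add: "Ck n f \<Longrightarrow> Ck n g \<Longrightarrow> Ck n (\<lambda>x. f x + g x)"
proof (induction n arbitrary: f g)
  case (Suc n)
  then obtain f' g' where *: "\<forall>x. (f has_real_derivative f' x) (at x)" "Ck n f'"
    "\<forall>x. (g has_real_derivative g' x) (at x)" "Ck n g'" by auto
  show ?case
    unfolding Ck.simps
    by (rule exI[of _ "\<lambda>x. f' x + g' x"]) (use * Suc.IH in \<open>auto intro!: derivative_intros\<close>)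
qed simp

lemma Ck_mult: "Ck n f \<Longrightarrow> Ck n g \<Longrightarrow> Ck n (\<lambda>x. f x * g x)"
proof (induction n arbitrary: f g)
  case (Suc n)
  then obtain f' g' where *: "\<forall>x. (f has_real_derivative f' x) (at x)" "Ck n f'"
    "\<forall>x. (g has_real_derivative g' x) (at x)" "Ck n g'" by auto
  show ?case
    unfolding Ck.simps
  proof (rule exI[of _ "\<lambda>x. f' x * g x + g' x * f x"], intro conjI allI)
    show "Ck n (\<lambda>x. f' x * g x + g' x * f x)"
      using Suc Ck_mono * by (intro Ck_add) blast+
  qed (use * in \<open>auto intro!: DERIV_mult\<close>)
qed simp

lemma Ck_affine: "Ck n g \<Longrightarrow> Ck n (\<lambda>x. g (c * x + d))"
proof (induction n arbitrary: g)
  case (Suc n)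
  then obtain g' where *: "\<forall>x. (g has_real_derivative g' x) (at x)" "Ck n g'" by auto
  show ?case
    unfolding Ck.simps
  proof (rule exI[of _ "\<lambda>x. g' (c * x + d) * c"], intro conjI allI)
    show "Ck n (\<lambda>x. g' (c * x + d) * c)"
      using Suc.IH[OF *(2)] Ck_mult Ck_const by blast
    show "((\<lambda>x. g (c * x + d)) has_real_derivative g' (c * x + d) * c) (at x)" for x
      by (rule DERIV_chain2) (use * in \<open>auto intro!: derivative_eq_intros\<close>)
  qed
qed simp

lemma smooth_const: "smooth (\<lambda>x. c)"
  and smooth_add: "smooth f \<Longrightarrow> smooth g \<Longrightarrow> smooth (\<lambda>x. f x + g x)"
  and smooth_mult: "smooth f \<Longrightarrow> smooth g \<Longrightarrow> smooth (\<lambda>x. f x * g x)"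
  and smooth_affine: "smooth g \<Longrightarrow> smooth (\<lambda>x. g (c * x + d))"
  by (auto simp: smooth_def Ck_const Ck_add Ck_mult Ck_affine)

lemma smooth_antiderivative:
  assumes "\<And>x. (F has_real_derivative f x) (at x)" "smooth f"
  shows "smooth F"
  unfolding smooth_def
proof
  fix n show "Ck n F" using assms by (cases n) (auto simp: smooth_def)
qed

lemma smooth_deriv:
  assumes "smooth g"
  shows "(g has_real_derivative deriv g x) (at x)" "smooth (deriv g)"
proof -
  have D: "(g has_real_derivative deriv g x) (at x)" for x
  proof -
    obtain g' where "\<forall>x. (g has_real_derivative g' x) (at x)"
      using assms[unfolded smooth_def, rule_format, of 1] by auto
    then show ?thesis using DERIV_imp_deriv by metis
  qed
  then show "(g has_real_derivative deriv g x) (at x)" .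
  show "smooth (deriv g)"
    unfolding smooth_def
  proof
    fix n
    obtain g' where g: "\<forall>x. (g has_real_derivative g' x) (at x)" "Ck n g'"
      using assms[unfolded smooth_def, rule_format, of "Suc n"] by auto
    then have "deriv g = g'" using DERIV_imp_deriv by blast
    then show "Ck n (deriv g)" using g by simp
  qed
qed

lemma smooth_continuous: "smooth g \<Longrightarrow> continuous_on S g"
  by (meson smooth_deriv(1) DERIV_isCont continuous_at_imp_continuous_on)

section \<open>A smooth bump with compact support\<close>

definition flat_exp :: "nat \<Rightarrow> real \<Rightarrow> real" where
  "flat_exp n x = (if x > 0 then (1 / x) ^ n * exp (- 1 / x) else 0)"

lemma flat_exp_tendsto: "(flat_exp n \<longlongrightarrow> 0) (at 0)"
proof (rule filterlim_split_at)
  show "(flat_exp n \<longlongrightarrow> 0) (at_left 0)"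
    by (rule tendsto_eventually)
      (auto simp: eventually_at_filter flat_exp_def intro!: always_eventually)
  have "((\<lambda>x. (inverse x) ^ n / exp (inverse x)) \<longlongrightarrow> 0) (at_right (0::real))"
    using filterlim_compose[OF tendsto_power_div_exp_0 filterlim_inverse_at_top_right] .
  then show "(flat_exp n \<longlongrightarrow> 0) (at_right 0)"
    by (rule Lim_transform_eventually)
      (auto simp: eventually_at_filter flat_exp_def exp_minus divide_simps intro!: always_eventually)
qed

text \<open>The power of \<open>1 / x\<close> makes the family closed under differentiation up to
  linear combinations, so smoothness follows by induction for all \<open>n\<close> together. At 0
  the difference quotient of \<open>flat_exp n\<close> is \<open>flat_exp (n + 1)\<close>, which
  tends to 0.\<close>

lemma flat_exp_deriv:
  "(flat_exp n has_real_derivative flat_exp (n + 2) x + (- real n) * flat_exp (n + 1) x) (at x)"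
proof -
  consider "x > 0" | "x < 0" | "x = 0" by linarith
  then show ?thesis
  proof cases
    case 1
    have "((\<lambda>x. (1 / x) ^ n * exp (- 1 / x)) has_real_derivative
        flat_exp (n + 2) x + (- real n) * flat_exp (n + 1) x) (at x)"
    proof -
      have D: "((\<lambda>x. 1 / x) has_real_derivative - ((1 / x)\<^sup>2)) (at x)"
        using 1 by (auto intro!: derivative_eq_intros simp: power2_eq_square)
      have "((\<lambda>x. (1 / x) ^ n * exp (- (1 / x))) has_real_derivative
          real n * (- ((1 / x)\<^sup>2) * (1 / x) ^ (n - 1)) * exp (- (1 / x))
          + exp (- (1 / x)) * - (- ((1 / x)\<^sup>2)) * (1 / x) ^ n) (at x)"
        by (intro DERIV_mult DERIV_chain2[OF DERIV_exp] DERIV_minus D) (use DERIV_power[OF D, of n] in simp)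
      moreover have "real n * (- y\<^sup>2 * y ^ (n - 1)) * e + e * - (- y\<^sup>2) * y ^ n
          = y ^ (n + 2) * e + (- real n) * (y ^ (n + 1) * e)" for y e :: real
        by (cases n) (simp_all add: power2_eq_square algebra_simps)
      ultimately have "((\<lambda>x. (1 / x) ^ n * exp (- (1 / x))) has_real_derivative
          (1 / x) ^ (n + 2) * exp (- (1 / x)) + (- real n) * ((1 / x) ^ (n + 1) * exp (- (1 / x)))) (at x)"
        by (simp only:)
      then show ?thesis
        using 1 by (simp add: flat_exp_def)
    qed
    then show ?thesis
      by (rule has_field_derivative_transform_within[where d = x]) (use 1 in \<open>auto simp: flat_exp_def dist_real_def\<close>)
  next
    case 2
    have "((\<lambda>x. 0) has_real_derivative flat_exp (n + 2) x + (- real n) * flat_exp (n + 1) x) (at x)"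
      using 2 by (auto simp: flat_exp_def)
    then show ?thesis
      by (rule has_field_derivative_transform_within[where d = "- x"]) (use 2 in \<open>auto simp: flat_exp_def dist_real_def\<close>)
  next
    case 3
    have "((\<lambda>h. (flat_exp n (0 + h) - flat_exp n 0) / h) \<longlongrightarrow> 0) (at 0)"
      by (rule Lim_transform_eventually[OF flat_exp_tendsto[of "n + 1"]])
        (auto simp: eventually_at_filter flat_exp_def intro!: always_eventually)
    then show ?thesis using 3 by (simp add: DERIV_def flat_exp_def)
  qed
qed

lemma smooth_flat_exp: "smooth (flat_exp n)"
proof -
  have "Ck k (flat_exp n)" for k
  proof (induction k arbitrary: n)
    case (Suc k)
    then show ?case
      unfolding Ck.simps
      by (intro exI[of _ "\<lambda>x. flat_exp (n + 2) x + (- real n) * flat_exp (n + 1) x"] conjI allI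
          flat_exp_deriv Ck_add Ck_mult Ck_const)
  qed simp
  then show ?thesis by (simp add: smooth_def)
qed

definition bump :: "real \<Rightarrow> real \<Rightarrow> real" where
  "bump \<eta> x = flat_exp 0 x * flat_exp 0 (\<eta> - x)"

lemma smooth_bump: "smooth (bump \<eta>)"
  unfolding bump_def
  using smooth_mult[OF smooth_flat_exp smooth_affine[OF smooth_flat_exp, of 0 "-1" \<eta>]] by simp

lemma bump_nonneg: "bump \<eta> x \<ge> 0"
  and bump_pos: "0 < x \<Longrightarrow> x < \<eta> \<Longrightarrow> bump \<eta> x > 0"
  and bump_zero: "x \<le> 0 \<or> \<eta> \<le> x \<Longrightarrow> bump \<eta> x = 0"
  by (auto simp: bump_def flat_exp_def)

lemma smooth_antiderivative_exists:
  assumes "smooth f"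
  obtains F where "\<And>x. (F has_real_derivative f x) (at x)" "F 0 = 0" "smooth F"
proof -
  have "isCont f x" for x using smooth_deriv(1)[OF assms] DERIV_isCont by blast
  then obtain F where "\<forall>x. (F has_vector_derivative f x) (at x)"
    using einterval_antiderivative[of "-\<infinity>" "\<infinity>" f] by auto
  then have F: "(F has_real_derivative f x) (at x)" for x
    by (simp add: has_real_derivative_iff_has_vector_derivative)
  then have "((\<lambda>x. F x - F 0) has_real_derivative f x) (at x)" for x
    by (auto intro!: derivative_eq_intros)
  then show ?thesis
    using that[of "\<lambda>x. F x - F 0"] smooth_antiderivative[OF _ assms] by simp
qed

lemma zero_deriv_imp_eq:
  fixes F f :: "real \<Rightarrow> real"
  assumes "p \<le> q" "\<And>x. (F has_real_derivative f x) (at x)" "\<And>x. p < x \<Longrightarrow> x < q \<Longrightarrow> f x = 0"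
  shows "F p = F q"
proof (cases "p = q")
  case False
  then have "p < q" using assms(1) by simp
  from MVT2[OF this assms(2)] obtain z where "p < z" "z < q" "F q - F p = (q - p) * f z" by blast
  then show ?thesis using assms(3) by simp
qed simp

text \<open>Two integrations from the left leave an affine function beyond the support of the bump,
  and a second difference cancels such a function.\<close>

lemma bump_potential:
  obtains K A B where "smooth K" "deriv (deriv K) = bump \<eta>" "\<And>x. x \<le> 0 \<Longrightarrow> K x = 0"
    "\<And>x. \<eta> \<le> x \<Longrightarrow> K x = A * x + B"
proof -
  obtain P where P: "\<And>x. (P has_real_derivative bump \<eta> x) (at x)" "P 0 = 0" "smooth P"
    using smooth_antiderivative_exists[OF smooth_bump] by blast
  obtain K where K: "\<And>x. (K has_real_derivative P x) (at x)" "K 0 = 0" "smooth K"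
    using smooth_antiderivative_exists[OF P(3)] by blast
  have "deriv K = P" using K(1) DERIV_imp_deriv by blast
  moreover have "deriv P = bump \<eta>" using P(1) DERIV_imp_deriv by blast
  ultimately have dd: "deriv (deriv K) = bump \<eta>" by simp
  have P0: "P x = 0" if "x \<le> 0" for x
    using zero_deriv_imp_eq[OF that P(1)] bump_zero P(2) by simp
  have K0: "K x = 0" if "x \<le> 0" for x
    using zero_deriv_imp_eq[OF that K(1)] P0 K(2) by simp
  have P1: "P x = P \<eta>" if "\<eta> \<le> x" for x
    using zero_deriv_imp_eq[OF that P(1)] bump_zero by simp
  have K1: "K x = P \<eta> * x + (K \<eta> - P \<eta> * \<eta>)" if "\<eta> \<le> x" for x
  proof -
    have "((\<lambda>x. K x - P \<eta> * x) has_real_derivative P x - P \<eta>) (at x)" for x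
      using K(1) by (auto intro!: derivative_eq_intros)
    then have "K \<eta> - P \<eta> * \<eta> = K x - P \<eta> * x"
      by (rule zero_deriv_imp_eq[OF that]) (use P1[OF less_imp_le] in \<open>simp only: diff_self\<close>)
    then show ?thesis by simp
  qed
  show ?thesis by (rule that[OF K(3) dd K0 K1])
qed

section \<open>Second differences as test functions\<close>

definition test1 :: "real \<Rightarrow> real \<Rightarrow> (real \<Rightarrow> real) \<Rightarrow> bool" where
  "test1 c d X \<longleftrightarrow> smooth X \<and> (\<exists>c' d'. c < c' \<and> c' \<le> d' \<and> d' < d \<and> (\<forall>x. x \<notin> {c'..d'} \<longrightarrow> X x = 0))"

text \<open>The second derivative of a test function has to annihilate affine functions. The weights
  1, -2, 1 at equidistant points achieve this, and they cancel the affine part of \<open>K\<close>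
  to the right of the last bump, which gives compact support.\<close>

lemma second_difference_test:
  assumes "c < p" "k > 0" "\<eta> > 0" "p + 2 * k + \<eta> < d"
  obtains X where "test1 c d X"
    "deriv (deriv X) = (\<lambda>x. bump \<eta> (x - p) - 2 * bump \<eta> (x - (p + k)) + bump \<eta> (x - (p + 2 * k)))"
proof -
  obtain K A B where K: "smooth K" "deriv (deriv K) = bump \<eta>" "\<And>x. x \<le> 0 \<Longrightarrow> K x = 0"
    "\<And>x. \<eta> \<le> x \<Longrightarrow> K x = A * x + B"
    using bump_potential[of \<eta>] by blast
  define X where "X x = K (x - p) - 2 * K (x - (p + k)) + K (x - (p + 2 * k))" for x
  have sh: "smooth (\<lambda>x. K (x - q))" for q
    using smooth_affine[OF K(1), of 1 "- q"] by simp
  have sX: "smooth X"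
    unfolding X_def using smooth_add[OF smooth_add[OF sh smooth_mult[OF smooth_const[of "-2"] sh]] sh] by simp
  have D1: "((\<lambda>x. g (x - q)) has_real_derivative deriv g (x - q)) (at x)" if "smooth g" for g q x
    by (rule DERIV_chain2[where Db = 1, simplified, OF smooth_deriv(1)[OF that]]) (auto intro!: derivative_eq_intros)
  have dX: "deriv X = (\<lambda>x. deriv K (x - p) - 2 * deriv K (x - (p + k)) + deriv K (x - (p + 2 * k)))"
    unfolding X_def by (rule ext, rule DERIV_imp_deriv) (intro derivative_intros D1 K(1) DERIV_cmult)
  have ddX: "deriv (deriv X) = (\<lambda>x. bump \<eta> (x - p) - 2 * bump \<eta> (x - (p + k)) + bump \<eta> (x - (p + 2 * k)))"
    unfolding dX K(2)[symmetric]
    by (rule ext, rule DERIV_imp_deriv) (intro derivative_intros D1 smooth_deriv(2)[OF K(1)] DERIV_cmult)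
  have "X x = 0" if "x \<notin> {p..p + 2 * k + \<eta>}" for x
    using that K(3,4) assms by (cases "x < p") (auto simp: X_def algebra_simps)
  then have "test1 c d X"
    using sX assms unfolding test1_def by (intro conjI exI[of _ p] exI[of _ "p + 2 * k + \<eta>"]) auto
  then show ?thesis using that ddX by blast
qed

lemma integral_against_bump:
  assumes "c \<le> q" "q + \<eta> \<le> d" "\<eta> > 0" "continuous_on {c..d} D"
  shows "((\<lambda>x. D x * bump \<eta> (x - q)) has_integral integral {0..\<eta>} (\<lambda>x. D (q + x) * bump \<eta> x)) {c..d}"
proof -
  have bc: "continuous_on S (\<lambda>x. bump \<eta> (g x))" if "continuous_on S g" for S and g :: "real \<Rightarrow> real"
    using continuous_on_compose2[OF smooth_continuous[OF smooth_bump, of UNIV] that] by simp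
  let ?g = "\<lambda>x. D x * bump \<eta> (x - q)"
  have c: "continuous_on {q..q + \<eta>} ?g"
    using assms by (intro continuous_intros bc continuous_on_subset[OF assms(4)]) auto
  have "(?g has_integral integral {q..q+\<eta>} ?g) {q..q+\<eta>}"
    using integrable_continuous_real[OF c] by blast
  then have "(?g has_integral integral {q..q+\<eta>} ?g) {c..d}"
    by (rule has_integral_on_superset) (use assms bump_zero in auto)
  moreover have "integral {q..q+\<eta>} ?g = integral {0..\<eta>} (\<lambda>x. D (q + x) * bump \<eta> x)"
    using integral_shift[of 0 q \<eta> ?g] c by (simp add: o_def add.commute)
  ultimately show ?thesis by simp
qed

text \<open>Tested with these functions, the weak condition says that the second difference of
  \<open>D\<close>, averaged against a bump, is 0. A positive second difference would by continuity
  stay positive over a short bump and contradict this. The reverse inequality comes from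
  \<open>- D\<close>.\<close>

lemma second_difference_nonpos:
  assumes D: "continuous_on {c..d} D"
    and weak: "\<And>X. test1 c d X \<Longrightarrow> integral {c..d} (\<lambda>x. D x * deriv (deriv X) x) = 0"
    and p: "c < p" "k > 0" "p + 2 * k < d"
  shows "D p - 2 * D (p + k) + D (p + 2 * k) \<le> 0"
proof (rule ccontr)
  assume neg: "\<not> ?thesis"
  define e where "e = (d - p - 2 * k) / 2"
  have e: "e > 0" "p + 2 * k + e < d" using p by (auto simp: e_def field_simps)
  define T where "T x = D (p + x) - 2 * D ((p + k) + x) + D ((p + 2 * k) + x)" for x
  have Tc: "continuous_on {0..e} T"
    unfolding T_def using p e by (intro continuous_intros continuous_on_compose2[OF D]) auto
  have "T 0 > 0" using neg by (simp add: T_def)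
  then obtain \<delta> where \<delta>: "\<delta> > 0" "\<And>x. x \<in> {0..e} \<Longrightarrow> dist x 0 < \<delta> \<Longrightarrow> dist (T x) (T 0) < T 0"
    using Tc e unfolding continuous_on_iff by (metis atLeastAtMost_iff less_eq_real_def)
  define \<eta> where "\<eta> = min e (\<delta> / 2)"
  have \<eta>: "\<eta> > 0" "\<eta> \<le> e" "\<eta> < \<delta>" using e \<delta> by (auto simp: \<eta>_def)
  have Tp: "T x > 0" if "x \<in> {0..\<eta>}" for x
    using \<delta>(2)[of x] that \<eta> by (auto simp: dist_real_def abs_if split: if_splits)
  have plt: "p + 2 * k + \<eta> < d" using e \<eta> by simp
  obtain X where X: "test1 c d X"
    "deriv (deriv X) = (\<lambda>x. bump \<eta> (x - p) - 2 * bump \<eta> (x - (p + k)) + bump \<eta> (x - (p + 2 * k)))"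
    using second_difference_test[OF p(1,2) \<eta>(1) plt] by blast
  have bi: "continuous_on S (bump \<eta>)" for S using smooth_continuous smooth_bump by blast
  define I where "I q = integral {0..\<eta>} (\<lambda>x. D (q + x) * bump \<eta> x)" for q
  have H: "((\<lambda>x. D x * bump \<eta> (x - q)) has_integral I q) {c..d}" if "q \<in> {p, p + k, p + 2 * k}" for q
    unfolding I_def by (rule integral_against_bump) (use that p \<eta> plt D in auto)
  have "((\<lambda>x. D x * bump \<eta> (x - p) - 2 * (D x * bump \<eta> (x - (p + k))) + D x * bump \<eta> (x - (p + 2 * k)))
      has_integral I p - 2 * I (p + k) + I (p + 2 * k)) {c..d}"
    by (intro has_integral_add has_integral_diff has_integral_mult_right H) auto
  then have "integral {c..d} (\<lambda>x. D x * deriv (deriv X) x) = I p - 2 * I (p + k) + I (p + 2 * k)"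
    by (intro integral_unique) (simp add: X(2) algebra_simps)
  then have "I p - 2 * I (p + k) + I (p + 2 * k) = 0" using weak[OF X(1)] by simp
  moreover have "((\<lambda>x. D (p + x) * bump \<eta> x - 2 * (D ((p + k) + x) * bump \<eta> x) + D ((p + 2 * k) + x) * bump \<eta> x)
      has_integral I p - 2 * I (p + k) + I (p + 2 * k)) {0..\<eta>}"
    unfolding I_def
    by (intro has_integral_add has_integral_diff has_integral_mult_right integrable_integral
        integrable_continuous_real continuous_intros bi continuous_on_compose2[OF D]) (use p \<eta> plt in auto)
  ultimately have "((\<lambda>x. T x * bump \<eta> x) has_integral 0) (cbox 0 \<eta>)"
    by (simp add: T_def algebra_simps)
  moreover have "continuous_on (cbox 0 \<eta>) (\<lambda>x. T x * bump \<eta> x)"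
    using \<eta> by (intro continuous_intros bi continuous_on_subset[OF Tc]) auto
  moreover have "\<And>x. x \<in> cbox 0 \<eta> \<Longrightarrow> 0 \<le> T x * bump \<eta> x"
    using Tp bump_nonneg by (simp add: less_imp_le)
  moreover have "box 0 \<eta> \<noteq> {}" using \<eta> by auto
  ultimately have "\<forall>x\<in>cbox 0 \<eta>. T x * bump \<eta> x = 0"
    using integral_cbox_eq_0_iff[of 0 \<eta> "\<lambda>x. T x * bump \<eta> x"] by (auto simp: integral_unique)
  then have "T (\<eta>/2) * bump \<eta> (\<eta>/2) = 0" using \<eta> by auto
  moreover have "T (\<eta>/2) > 0" "bump \<eta> (\<eta>/2) > 0" using Tp bump_pos \<eta> by auto
  ultimately show False by simp
qed

text \<open>A discrete maximum principle: at a positive maximum \<open>z\<close> the midpoint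
  identity forces the maximal value at \<open>z - k\<close> and \<open>z + k\<close> as well, while
  one of these points can be brought so close to an end that \<open>g\<close> is smaller
  there.\<close>

lemma midpoint_affine_nonpos:
  fixes g :: "real \<Rightarrow> real"
  assumes cd: "c < d" and g: "continuous_on {c..d} g" and ends: "g c = 0" "g d = 0"
    and mid: "\<And>p k. c < p \<Longrightarrow> k > 0 \<Longrightarrow> p + 2 * k < d \<Longrightarrow> g p - 2 * g (p + k) + g (p + 2 * k) = 0"
    and x: "x \<in> {c..d}"
  shows "g x \<le> 0"
proof (rule ccontr)
  assume "\<not> ?thesis"
  obtain z where z: "z \<in> {c..d}" "\<And>y. y \<in> {c..d} \<Longrightarrow> g y \<le> g z"
    using continuous_attains_sup[OF compact_Icc _ g] cd by auto
  have M: "g z > 0" using z(2)[OF x] \<open>\<not> g x \<le> 0\<close> by simp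
  have zi: "c < z" "z < d" using z M ends by (auto simp: less_le)
  have near: "\<exists>\<delta>>0. \<forall>x\<in>{c..d}. \<bar>x - e\<bar> < \<delta> \<longrightarrow> g x < g z" if "e \<in> {c, d}" for e
  proof -
    have "e \<in> {c..d}" "g e = 0" using that cd ends by auto
    then obtain \<delta> where "\<delta> > 0" "\<forall>x\<in>{c..d}. dist x e < \<delta> \<longrightarrow> dist (g x) (g e) < g z"
      using g M unfolding continuous_on_iff by metis
    then show ?thesis using \<open>g e = 0\<close> by (intro exI[of _ \<delta>]) (auto simp: dist_real_def)
  qed
  obtain \<delta>1 where \<delta>1: "\<delta>1 > 0" "\<And>x. x \<in> {c..d} \<Longrightarrow> \<bar>x - c\<bar> < \<delta>1 \<Longrightarrow> g x < g z"
    using near[of c] by auto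
  obtain \<delta>2 where \<delta>2: "\<delta>2 > 0" "\<And>x. x \<in> {c..d} \<Longrightarrow> \<bar>x - d\<bar> < \<delta>2 \<Longrightarrow> g x < g z"
    using near[of d] by auto
  define k0 where "k0 = min (z - c) (d - z)"
  \<comment> \<open>The midpoint identity is available only strictly inside the interval, so
    \<open>k\<close> has to stay below the distance \<open>k0\<close> to the nearer end; it does so
    by less than \<open>\<delta>1\<close> and \<open>\<delta>2\<close>.\<close>
  define k where "k = k0 - min (min \<delta>1 \<delta>2) k0 / 2"
  define \<delta> where "\<delta> = min (min \<delta>1 \<delta>2) k0"
  have \<delta>: "0 < \<delta>" "\<delta> \<le> \<delta>1" "\<delta> \<le> \<delta>2" "\<delta> \<le> k0"
    using zi \<delta>1 \<delta>2 by (auto simp: \<delta>_def k0_def)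
  have k: "0 < k" "k < k0" "k0 - k < \<delta>1" "k0 - k < \<delta>2"
    using \<delta> by (auto simp: k_def simp flip: \<delta>_def)
  have k0: "k0 \<le> z - c" "k0 \<le> d - z" by (auto simp: k0_def)
  have in1: "z - k \<in> {c..d}" "z + k \<in> {c..d}" using k k0 by auto
  have "g (z - k) - 2 * g (z - k + k) + g (z - k + 2 * k) = 0"
    by (rule mid) (use k k0 in auto)
  then have e: "g (z - k) + g (z + k) = 2 * g z" by (simp add: algebra_simps)
  show False
  proof (cases "z - c \<le> d - z")
    case True
    then have "g (z - k) < g z" using k by (intro \<delta>1(2) in1) (auto simp: k0_def)
    then show ?thesis using z(2)[OF in1(2)] e by linarith
  next
    case False
    then have "g (z + k) < g z" using k by (intro \<delta>2(2) in1) (auto simp: k0_def)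
    then show ?thesis using z(2)[OF in1(1)] e by linarith
  qed
qed

text \<open>The chord of \<open>D\<close> is subtracted; the maximum principle, applied to the rest
  and to its negative, leaves 0.\<close>

lemma du_Bois_Reymond_second:
  assumes cd: "c < d" and D: "continuous_on {c..d} D"
    and weak: "\<And>X. test1 c d X \<Longrightarrow> integral {c..d} (\<lambda>x. D x * deriv (deriv X) x) = 0"
  obtains m q where "\<And>x. x \<in> {c..d} \<Longrightarrow> D x = m * x + q"
proof -
  define m where "m = (D d - D c) / (d - c)"
  define g where "g x = D x - D c - m * (x - c)" for x
  have gc: "continuous_on {c..d} g" unfolding g_def using D by (intro continuous_intros)
  have ends: "g c = 0" "g d = 0" using cd by (auto simp: g_def m_def)
  have mid: "g p - 2 * g (p + k) + g (p + 2 * k) = 0" if p: "c < p" "k > 0" "p + 2 * k < d" for p k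
  proof -
    have "D p - 2 * D (p + k) + D (p + 2 * k) \<le> 0"
      by (rule second_difference_nonpos[OF D weak p])
    moreover have "(- D p) - 2 * (- D (p + k)) + (- D (p + 2 * k)) \<le> 0"
      by (rule second_difference_nonpos[where D = "\<lambda>x. - D x" and c = c and d = d])
        (use D weak p in \<open>auto intro!: continuous_intros\<close>)
    ultimately show ?thesis by (simp add: g_def algebra_simps)
  qed
  have "g x = 0" if x: "x \<in> {c..d}" for x
  proof -
    have "g x \<le> 0" by (rule midpoint_affine_nonpos[OF cd gc ends mid x])
    moreover have "- g x \<le> 0"
      by (rule midpoint_affine_nonpos[OF cd, where g = "\<lambda>x. - g x"])
        (use gc ends mid x in \<open>auto intro!: continuous_intros simp: algebra_simps\<close>)
    ultimately show ?thesis by simp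
  qed
  then show ?thesis
    using that[of m "D c - m * c"] by (auto simp: g_def algebra_simps)
qed

section \<open>Product test functions\<close>

lemma smooth_deriv_pow: "smooth g \<Longrightarrow> smooth ((deriv ^^ n) g)"
  by (induction n) (auto intro: smooth_deriv(2))

text \<open>\<open>test_fun\<close> asks for differentiability of all iterated partial derivatives;
  for products this reduces to smoothness of each factor.\<close>

lemma pd_product:
  assumes "smooth X" "smooth \<Theta>"
  shows "\<exists>i j. pd ds (\<lambda>x t. X x * \<Theta> t) = (\<lambda>x t. (deriv ^^ i) X x * (deriv ^^ j) \<Theta> t)"
proof (induction ds)
  case Nil
  show ?case by (intro exI[of _ 0]) simp
next
  case (Cons z ds)
  then obtain i j where ij: "pd ds (\<lambda>x t. X x * \<Theta> t) = (\<lambda>x t. (deriv ^^ i) X x * (deriv ^^ j) \<Theta> t)" by blast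
  show ?case
  proof (cases z)
    case True
    have "deriv (\<lambda>y. (deriv ^^ i) X y * c) x = (deriv ^^ Suc i) X x * c" for c x
      using DERIV_cmult_right[OF smooth_deriv(1)[OF smooth_deriv_pow[OF assms(1)]]] by (intro DERIV_imp_deriv) simp
    then show ?thesis using True ij by (intro exI[of _ "Suc i"] exI[of _ j]) simp
  next
    case False
    have "deriv (\<lambda>y. c * (deriv ^^ j) \<Theta> y) x = c * (deriv ^^ Suc j) \<Theta> x" for c x
      using DERIV_cmult[OF smooth_deriv(1)[OF smooth_deriv_pow[OF assms(2)]]] by (intro DERIV_imp_deriv) simp
    then show ?thesis using False ij by (intro exI[of _ i] exI[of _ "Suc j"]) simp
  qed
qed

lemma pd_product_second:
  assumes "smooth X" "smooth \<Theta>"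
  shows "pd [False] (\<lambda>x t. X x * \<Theta> t) = (\<lambda>x t. X x * deriv \<Theta> t)"
    "pd [False, False] (\<lambda>x t. X x * \<Theta> t) = (\<lambda>x t. X x * deriv (deriv \<Theta>) t)"
    "pd [True, True] (\<lambda>x t. X x * \<Theta> t) = (\<lambda>x t. deriv (deriv X) x * \<Theta> t)"
proof -
  have 1: "deriv (\<lambda>y. g y * c) = (\<lambda>x. deriv g x * c)" if "smooth g" for g c
    using DERIV_cmult_right[OF smooth_deriv(1)[OF that]] by (intro ext DERIV_imp_deriv) simp
  have 2: "deriv (\<lambda>y. c * g y) = (\<lambda>x. c * deriv g x)" if "smooth g" for g c
    using DERIV_cmult[OF smooth_deriv(1)[OF that]] by (intro ext DERIV_imp_deriv) simp
  show "pd [False] (\<lambda>x t. X x * \<Theta> t) = (\<lambda>x t. X x * deriv \<Theta> t)"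
    "pd [False, False] (\<lambda>x t. X x * \<Theta> t) = (\<lambda>x t. X x * deriv (deriv \<Theta>) t)"
    "pd [True, True] (\<lambda>x t. X x * \<Theta> t) = (\<lambda>x t. deriv (deriv X) x * \<Theta> t)"
    by (auto simp: 1 2 assms smooth_deriv)
qed

lemma test_fun_product:
  assumes X: "test1 a b X" and \<Theta>: "test1 0 T \<Theta>"
  shows "test_fun a b (\<lambda>x t. X x * \<Theta> t)"
proof -
  have s: "smooth X" "smooth \<Theta>" using X \<Theta> by (auto simp: test1_def)
  obtain c d where c: "a < c" "d < b" "\<And>x. x \<notin> {c..d} \<Longrightarrow> X x = 0" using X unfolding test1_def by blast
  obtain c' d' where c': "0 < c'" "d' < T" "\<And>x. x \<notin> {c'..d'} \<Longrightarrow> \<Theta> x = 0" using \<Theta> unfolding test1_def by blast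
  let ?S = "{(x, t). X x * \<Theta> t \<noteq> 0}"
  have sub: "?S \<subseteq> {c..d} \<times> {c'..d'}" using c(3) c'(3) by fastforce
  have cl: "closure ?S \<subseteq> {c..d} \<times> {c'..d'}"
    by (rule closure_minimal[OF sub]) (auto intro!: closed_Times)
  have "compact ({c..d} \<times> {c'..d'})" by (intro compact_Times) auto
  then have "compact (closure ?S)"
    using cl compact_Int_closed[of "{c..d} \<times> {c'..d'}" "closure ?S"] by (simp add: Int_absorb1)
  moreover have "closure ?S \<subseteq> {a<..<b} \<times> {0<..}"
    using cl c c' by fastforce
  moreover have "(\<lambda>(x, t). pd ds (\<lambda>x t. X x * \<Theta> t) x t) differentiable (at z)" for ds z
  proof -
    obtain i j where ij: "pd ds (\<lambda>x t. X x * \<Theta> t) = (\<lambda>x t. (deriv ^^ i) X x * (deriv ^^ j) \<Theta> t)"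
      using pd_product[OF s] by blast
    have D: "\<exists>D. ((\<lambda>z. g (h z)) has_derivative D) (at z)"
      if "smooth g" "(h has_derivative h') (at z)" for g and h h' :: "real \<times> real \<Rightarrow> real"
      using DERIV_compose_FDERIV[OF smooth_deriv(1)[OF that(1)] that(2)] by blast
    obtain D1 where D1: "((\<lambda>z. (deriv ^^ i) X (fst z)) has_derivative D1) (at z)"
      using D[OF smooth_deriv_pow[OF s(1)] has_derivative_fst[OF has_derivative_ident]] by blast
    obtain D2 where D2: "((\<lambda>z. (deriv ^^ j) \<Theta> (snd z)) has_derivative D2) (at z)"
      using D[OF smooth_deriv_pow[OF s(2)] has_derivative_snd[OF has_derivative_ident]] by blast
    show ?thesis
      unfolding ij using has_derivative_mult[OF D1 D2] by (auto simp: differentiable_def case_prod_unfold)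
  qed
  ultimately show ?thesis unfolding test_fun_def by blast
qed

section \<open>Uniform limits on the time half-line\<close>

lemma integration_by_parts_real:
  fixes F G f g :: "real \<Rightarrow> real"
  assumes "a \<le> b"
    and F: "\<And>x. x \<in> {a..b} \<Longrightarrow> (F has_real_derivative f x) (at x within {a..b})"
    and G: "\<And>x. x \<in> {a..b} \<Longrightarrow> (G has_real_derivative g x) (at x within {a..b})"
    and f: "continuous_on {a..b} f" and g: "continuous_on {a..b} g"
  shows "integral {a..b} (\<lambda>x. F x * g x) = F b * G b - F a * G a - integral {a..b} (\<lambda>x. f x * G x)"
proof -
  have Fc: "continuous_on {a..b} F" and Gc: "continuous_on {a..b} G"
    using F G DERIV_continuous_on by blast+
  have "((\<lambda>x. f x * G x + g x * F x) has_integral (F b * G b - F a * G a)) {a..b}"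
    by (rule has_integral_ftc[OF assms(1)]) (use F G in \<open>auto intro!: DERIV_mult\<close>)
  then have "integral {a..b} (\<lambda>x. f x * G x + g x * F x) = F b * G b - F a * G a"
    by (rule integral_unique)
  moreover have "integral {a..b} (\<lambda>x. f x * G x + g x * F x)
      = integral {a..b} (\<lambda>x. f x * G x) + integral {a..b} (\<lambda>x. g x * F x)"
    by (intro hk_integral_add integrable_continuous_real continuous_intros Fc Gc f g)
  ultimately show ?thesis by (simp add: mult.commute)
qed

lemmas linear_integral_intros = has_integral_add has_integral_diff has_integral_mult_right integrable_integral
  integrable_continuous_real continuous_intros

lemma integral_Cauchy_Schwarz:
  fixes f g :: "real \<Rightarrow> real"
  assumes f: "continuous_on {a..b} f" and g: "continuous_on {a..b} g"
  shows "(integral {a..b} (\<lambda>x. f x * g x))\<^sup>2 \<le> integral {a..b} (\<lambda>x. (f x)\<^sup>2) * integral {a..b} (\<lambda>x. (g x)\<^sup>2)"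
proof -
  define F where "F = integral {a..b} (\<lambda>x. (f x)\<^sup>2)"
  define G where "G = integral {a..b} (\<lambda>x. (g x)\<^sup>2)"
  define H where "H = integral {a..b} (\<lambda>x. f x * g x)"
  have q: "0 \<le> F - 2 * l * H + l\<^sup>2 * G" for l
  proof -
    have "((\<lambda>x. (f x)\<^sup>2 - 2 * l * (f x * g x) + l\<^sup>2 * (g x)\<^sup>2) has_integral (F - 2 * l * H + l\<^sup>2 * G)) {a..b}"
      unfolding F_def G_def H_def
      by (intro linear_integral_intros f g)
    moreover have "(f x)\<^sup>2 - 2 * l * (f x * g x) + l\<^sup>2 * (g x)\<^sup>2 = (f x - l * g x)\<^sup>2" for x
      by (simp add: power2_eq_square algebra_simps)
    ultimately show ?thesis by (simp add: has_integral_nonneg)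
  qed
  have "G \<ge> 0" unfolding G_def
    by (intro integral_nonneg integrable_continuous_real continuous_intros g) simp
  then consider "G > 0" | "G = 0" by linarith
  then have "H\<^sup>2 \<le> F * G"
  proof cases
    case 1
    have "0 \<le> G * (F - 2 * (H / G) * H + (H / G)\<^sup>2 * G)" using q[of "H / G"] 1 by (intro mult_nonneg_nonneg) auto
    also have "\<dots> = F * G - H\<^sup>2" using 1 by (simp add: power2_eq_square field_simps)
    finally show ?thesis by simp
  next
    case 2
    have "H = 0"
    proof (rule ccontr)
      assume "H \<noteq> 0"
      \<comment> \<open>For \<open>G = 0\<close> the quadratic in \<open>l\<close> degenerates to an
        affine function, and this \<open>l\<close> gives it the value -1.\<close>
      then show False using q[of "(F + 1) / (2 * H)"] 2 by (simp add: field_simps)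
    qed
    then show ?thesis using 2 by simp
  qed
  then show ?thesis by (simp add: F_def G_def H_def)
qed

lemma integral_abs_square_le:
  fixes f :: "real \<Rightarrow> real"
  assumes "a \<le> b" and f: "continuous_on {a..b} f"
  shows "(integral {a..b} (\<lambda>x. \<bar>f x\<bar>))\<^sup>2 \<le> (b - a) * integral {a..b} (\<lambda>x. (f x)\<^sup>2)"
proof -
  have "continuous_on {a..b} (\<lambda>x. \<bar>f x\<bar>)" using f by (intro continuous_intros)
  from integral_Cauchy_Schwarz[OF this continuous_on_const[of _ "1::real"]]
  show ?thesis using assms(1) by (simp add: mult.commute)
qed

lemma integral_uniform_limit:
  fixes f :: "'i \<Rightarrow> real \<Rightarrow> real"
  assumes u: "uniform_limit {a..b} f g F" and c: "\<forall>\<^sub>F n in F. continuous_on {a..b} (f n)" and F: "F \<noteq> bot"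
    and "a \<le> b"
  shows "((\<lambda>n. integral {a..b} (f n)) \<longlongrightarrow> integral {a..b} g) F"
proof (rule tendstoI)
  fix e :: real assume e: "e > 0"
  have gc: "continuous_on {a..b} g" by (rule uniform_limit_theorem[OF c u F])
  define d where "d = e / (2 * (b - a + 1))"
  have d: "d > 0" using e assms(4) by (auto simp: d_def)
  have "\<forall>\<^sub>F n in F. \<forall>x\<in>{a..b}. dist (f n x) (g x) < d" using u d by (simp add: uniform_limit_iff)
  then show "\<forall>\<^sub>F n in F. dist (integral {a..b} (f n)) (integral {a..b} g) < e"
    using c
  proof eventually_elim
    case (elim n)
    have "integral {a..b} (f n) - integral {a..b} g = integral {a..b} (\<lambda>x. f n x - g x)"
      by (intro hk_integral_diff[symmetric] integrable_continuous_real elim gc)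
    moreover have "norm (integral {a..b} (\<lambda>x. f n x - g x)) \<le> d * (b - a)"
      by (rule integral_bound) (use elim gc assms in \<open>auto intro!: continuous_intros less_imp_le simp: dist_real_def\<close>)
    moreover have "d * (b - a) < e"
    proof -
      have "d * (b - a) < d * (2 * (b - a + 1))" using d assms(4) by (intro mult_strict_left_mono) auto
      then show ?thesis using assms(4) by (simp add: d_def)
    qed
    ultimately show ?case by (simp add: dist_real_def)
  qed
qed

section \<open>The antiderivative with mean zero\<close>

lemma bar_deriv:
  assumes g: "continuous_on {a..b} g" and x: "x \<in> {a..b}"
  shows "(bar a b g has_real_derivative g x) (at x within {a..b})"
  unfolding bar_def using DERIV_diff[OF integral_has_real_derivative[OF g x] DERIV_const] by simp

lemma bar_cont: "continuous_on {a..b} g \<Longrightarrow> continuous_on {a..b} (bar a b g)"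
  using bar_continuous integrable_continuous_real by blast

lemma integral_bar:
  assumes "a < b" "continuous_on {a..b} g"
  shows "integral {a..b} (bar a b g) = 0"
proof -
  have c: "continuous_on {a..b} (\<lambda>x. integral {a..x} g)"
    by (rule indefinite_integral_continuous_1) (use assms integrable_continuous_real in blast)
  show ?thesis
    unfolding bar_def
    by (subst hk_integral_diff) (use c assms integrable_continuous_real in auto)
qed

lemma bar_minus:
  assumes "f integrable_on {a..b}" "g integrable_on {a..b}" "x \<in> {a..b}"
  shows "bar a b (\<lambda>x. f x - g x) x = bar a b f x - bar a b g x"
proof -
  have 1: "integral {a..y} (\<lambda>x. f x - g x) = integral {a..y} f - integral {a..y} g" if "y \<in> {a..b}" for y
    using assms that integrable_on_subinterval[of _ "{a..b}" a y]
    by (intro hk_integral_diff) auto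
  have "integral {a..b} (\<lambda>y. integral {a..y} (\<lambda>x. f x - g x)) = integral {a..b} (\<lambda>y. integral {a..y} f - integral {a..y} g)"
    by (rule hk_integral_cong) (use 1 in auto)
  also have "\<dots> = integral {a..b} (\<lambda>y. integral {a..y} f) - integral {a..b} (\<lambda>y. integral {a..y} g)"
    by (rule hk_integral_diff)
      (use assms(1,2)[THEN indefinite_integral_continuous_1, THEN integrable_continuous_real] in auto)
  finally show ?thesis using 1[OF assms(3)] by (simp add: bar_def right_diff_distrib)
qed

lemma bar_cmult: "bar a b (\<lambda>x. c * f x) x = c * bar a b f x"
  by (simp add: bar_def right_diff_distrib)

lemma bar_bound:
  assumes "a < b" "continuous_on {a..b} g" "\<And>x. x \<in> {a..b} \<Longrightarrow> \<bar>g x\<bar> \<le> e" "x \<in> {a..b}"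
  shows "\<bar>bar a b g x\<bar> \<le> 2 * (b - a) * e"
proof -
  have e: "e \<ge> 0" using assms(3)[OF assms(4)] by linarith
  have I: "\<bar>integral {a..y} g\<bar> \<le> (b - a) * e" if "y \<in> {a..b}" for y
  proof -
    have "norm (integral {a..y} g) \<le> e * (y - a)"
      by (rule integral_bound) (use assms that continuous_on_subset[OF assms(2), of "{a..y}"] in auto)
    also have "\<dots> \<le> (b - a) * e" using that e by (simp add: mult.commute mult_left_mono)
    finally show ?thesis by simp
  qed
  have c: "continuous_on {a..b} (\<lambda>x. integral {a..x} g)"
    by (rule indefinite_integral_continuous_1) (use assms integrable_continuous_real in blast)
  have "norm (integral {a..b} (\<lambda>y. integral {a..y} g)) \<le> ((b - a) * e) * (b - a)"
    by (rule integral_bound) (use assms c I in auto)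
  then have "\<bar>1 / (b - a) * integral {a..b} (\<lambda>y. integral {a..y} g)\<bar> \<le> (b - a) * e"
    using assms(1) by (simp add: abs_mult field_simps)
  then show ?thesis using I[OF assms(4)] unfolding bar_def by linarith
qed

lemma bar_uniform_limit:
  assumes ab: "a < b" and u: "uniform_limit {a..b} f g F" and c: "\<forall>\<^sub>F n in F. continuous_on {a..b} (f n)" and F: "F \<noteq> bot"
  shows "uniform_limit {a..b} (\<lambda>n. bar a b (f n)) (bar a b g) F"
proof (rule uniform_limitI)
  fix e :: real assume e: "e > 0"
  have gc: "continuous_on {a..b} g" by (rule uniform_limit_theorem[OF c u F])
  define d where "d = e / (3 * (b - a))"
  have d: "d > 0" using e ab by (auto simp: d_def)
  have "e = 3 * (c * (e / (3 * c)))" if "c > 0" for c :: real using that by simp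
  from this[of "b - a"] have de: "e = 3 * ((b - a) * d)" using ab by (simp only: d_def)
  have "\<forall>\<^sub>F n in F. \<forall>x\<in>{a..b}. dist (f n x) (g x) < d" using u d by (simp add: uniform_limit_iff)
  then show "\<forall>\<^sub>F n in F. \<forall>x\<in>{a..b}. dist (bar a b (f n) x) (bar a b g x) < e"
    using c
  proof eventually_elim
    case (elim n)
    show ?case
    proof
      fix x assume x: "x \<in> {a..b}"
      have "bar a b (f n) x - bar a b g x = bar a b (\<lambda>x. f n x - g x) x"
        using bar_minus[OF integrable_continuous_real[OF elim(2)] integrable_continuous_real[OF gc] x] by simp
      also have "\<bar>\<dots>\<bar> \<le> 2 * (b - a) * d"
        by (rule bar_bound[OF ab _ _ x]) (use elim gc in \<open>auto intro!: continuous_intros less_imp_le simp: dist_real_def\<close>)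
      also have "\<dots> < e" using de e by linarith
      finally show "dist (bar a b (f n) x) (bar a b g x) < e" by (simp add: dist_real_def)
    qed
  qed
qed

text \<open>Joint continuity on \<open>[0, \<infinity>) \<times> [a, b]\<close>, for functions whose first argument is the space variable.\<close>
abbreviation jcont :: "real \<Rightarrow> real \<Rightarrow> (real \<Rightarrow> real \<Rightarrow> real) \<Rightarrow> bool" where
  "jcont a b g \<equiv> continuous_on ({0..} \<times> {a..b}) (\<lambda>(t, x). g x t)"

lemma jcont_x: "jcont a b g \<Longrightarrow> t \<ge> 0 \<Longrightarrow> continuous_on {a..b} (\<lambda>x. g x t)"
  by (drule continuous_on_compose2[of _ _ "{a..b}" "\<lambda>x. (t, x)"]) (auto intro!: continuous_intros)

lemma jcont_t: "jcont a b g \<Longrightarrow> x \<in> {a..b} \<Longrightarrow> continuous_on {0..} (\<lambda>t. g x t)"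
  by (drule continuous_on_compose2[of _ _ "{0..}" "\<lambda>t. (t, x)"]) (auto intro!: continuous_intros)

lemma at_within_atLeast_neq_bot: "t \<ge> 0 \<Longrightarrow> at t within {0::real..} \<noteq> bot"
  using trivial_limit_at_right_real[of t] at_le[of "{t<..}" "{0..}" t]
  by (metis atLeast_iff bot.extremum_uniqueI greaterThan_iff less_imp_le order_trans subsetI)

lemma eventually_at_atLeast: "\<forall>\<^sub>F s in at t within {0::real..}. s \<ge> 0 \<and> s \<noteq> t"
  by (auto simp: eventually_at_filter)

lemma jcont_eventually:
  assumes "jcont a b g" shows "\<forall>\<^sub>F s in at t within {0..}. continuous_on {a..b} (\<lambda>x. g x s)"
  using eventually_at_atLeast by eventually_elim (use assms jcont_x in auto)

lemma jcont_uniform_limit: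
  assumes g: "jcont a b g" and t: "t \<ge> 0"
  shows "uniform_limit {a..b} (\<lambda>s x. g x s) (\<lambda>x. g x t) (at t within {0..})"
proof (rule uniform_limitI)
  fix e :: real assume e: "e > 0"
  obtain X0 where X0: "t \<in> X0" "open X0"
    "\<forall>x\<in>X0 \<inter> {0..}. \<forall>y\<in>{a..b}. dist ((\<lambda>(t, x). g x t) (x, y)) ((\<lambda>(t, x). g x t) (t, y)) \<le> e / 2"
    using continuous_on_prod_compactE[OF g compact_Icc, of t "e / 2"] t e by auto
  have "\<forall>\<^sub>F s in at t within {0..}. s \<in> X0 \<and> s \<ge> 0"
    using X0 by (auto simp: eventually_at_topological)
  then show "\<forall>\<^sub>F s in at t within {0..}. \<forall>x\<in>{a..b}. dist (g x s) (g x t) < e"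
  proof eventually_elim
    case (elim s)
    show ?case
    proof
      fix x assume "x \<in> {a..b}"
      then have "dist (g x s) (g x t) \<le> e / 2" using X0(3) elim by auto
      then show "dist (g x s) (g x t) < e" using e by linarith
    qed
  qed
qed

text \<open>For each \<open>x\<close> the mean value theorem turns the quotient into
  \<open>g' x z\<close> with \<open>z\<close> between \<open>s\<close> and \<open>t\<close>. The
  point \<open>z\<close> depends on \<open>x\<close>, but the continuity of \<open>g'\<close> in
  time is uniform in \<open>x\<close>.\<close>

lemma difference_quotient_uniform_limit:
  assumes g': "jcont a b g'" and t: "t \<ge> 0"
    and D: "\<And>x t. x \<in> {a..b} \<Longrightarrow> t \<ge> 0 \<Longrightarrow> ((\<lambda>s. g x s) has_real_derivative g' x t) (at t within {0..})"
  shows "uniform_limit {a..b} (\<lambda>s x. (g x s - g x t) / (s - t)) (\<lambda>x. g' x t) (at t within {0..})"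
proof (rule uniform_limitI)
  fix e :: real assume e: "e > 0"
  have "\<forall>\<^sub>F s in at t within {0..}. \<forall>x\<in>{a..b}. dist (g' x s) (g' x t) < e"
    using jcont_uniform_limit[OF g' t] e by (simp add: uniform_limit_iff)
  then obtain d where d: "d > 0" "\<And>s. s \<ge> 0 \<Longrightarrow> s \<noteq> t \<Longrightarrow> dist s t < d \<Longrightarrow> \<forall>x\<in>{a..b}. dist (g' x s) (g' x t) < e"
    unfolding eventually_at by auto
  show "\<forall>\<^sub>F s in at t within {0..}. \<forall>x\<in>{a..b}. dist ((g x s - g x t) / (s - t)) (g' x t) < e"
    unfolding eventually_at
  proof (intro exI[of _ d] conjI ballI impI)
    fix s x assume s: "s \<in> {0..}" "s \<noteq> t \<and> dist s t < d" and x: "x \<in> {a..b}"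
    define l where "l = min s t" 
    define k where "k = max s t"
    have lk: "l < k" "l \<ge> 0" using s t by (auto simp: l_def k_def)
    have D': "((\<lambda>s. g x s) has_derivative (\<lambda>h. g' x z * h)) (at z within {l..k})" if "z \<in> {l..k}" for z
      using D[OF x, of z] that lk DERIV_subset[of _ _ z "{0..}" "{l..k}"]
      by (force simp: has_field_derivative_def)
    obtain z where z: "z \<in> {l<..<k}" "g x k - g x l = g' x z * (k - l)"
      using mvt_simple[OF lk(1), of "\<lambda>s. g x s" "\<lambda>z h. g' x z * h"] D' by auto
    have "(g x s - g x t) / (s - t) = (g x k - g x l) / (k - l)"
      using s(2) by (auto simp: l_def k_def min_def max_def divide_simps) (simp_all add: algebra_simps)
    also have "\<dots> = g' x z" using z lk by simp
    finally have q: "(g x s - g x t) / (s - t) = g' x z" .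
    have "z \<ge> 0" "z \<noteq> t" "dist z t < d"
      using z s lk by (auto simp: l_def k_def dist_real_def min_def max_def split: if_splits)
    then show "dist ((g x s - g x t) / (s - t)) (g' x t) < e" using d(2) x q by auto
  qed (use d in auto)
qed

lemma uniform_limit_mult_cont:
  fixes f g :: "'i \<Rightarrow> real \<Rightarrow> real"
  assumes "uniform_limit {a..b} f l F" "uniform_limit {a..b} g m F" "continuous_on {a..b} l" "continuous_on {a..b} m"
  shows "uniform_limit {a..b} (\<lambda>n x. f n x * g n x) (\<lambda>x. l x * m x) F"
  using assms compact_imp_bounded compact_continuous_image compact_Icc by (intro uniform_lim_mult) blast+

lemma integral_continuous_t:
  assumes "jcont a b g"
  shows "continuous_on {0..} (\<lambda>t. integral {a..b} (\<lambda>x. g x t))"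
  using integral_continuous_on_param[of "{0..}" a b "\<lambda>t x. g x t"] assms by simp

lemma integral_deriv_t:
  assumes g': "jcont a b g'" and t: "t \<ge> 0" and g: "\<And>t. t \<ge> 0 \<Longrightarrow> continuous_on {a..b} (\<lambda>x. g x t)"
    and D: "\<And>x t. x \<in> {a..b} \<Longrightarrow> t \<ge> 0 \<Longrightarrow> ((\<lambda>s. g x s) has_real_derivative g' x t) (at t within {0..})"
  shows "((\<lambda>t. integral {a..b} (\<lambda>x. g x t)) has_real_derivative integral {a..b} (\<lambda>x. g' x t)) (at t within {0..})"
  using leibniz_rule_field_derivative[of "{0..}" a b "\<lambda>t x. g x t" "\<lambda>t x. g' x t" t] g' t D
    integrable_continuous_real[OF g] by auto

lemma integral_from_0_deriv:
  assumes g: "continuous_on {0..} g" and t: "t \<ge> 0"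
  shows "((\<lambda>t. integral {0..t} g) has_real_derivative g t) (at t within {0..})"
proof -
  have "((\<lambda>t. integral {0..t} g) has_real_derivative g t) (at t within {0..t+1})"
    by (rule integral_has_real_derivative) (use g t in \<open>auto intro: continuous_on_subset\<close>)
  \<comment> \<open>Both sets coincide near \<open>t\<close>; the additional 1 keeps
    \<open>t\<close> away from the right end.\<close>
  moreover have "at t within {0..t+1} = at t within {0..}"
    by (rule at_within_nhd[of _ "{..<t+1}"]) auto
  ultimately show ?thesis by simp
qed

section \<open>The integrated equation\<close>

lemma test1_deriv:
  assumes "test1 c d X" shows "test1 c d (deriv X)"
proof -
  obtain c' d' where s: "smooth X" and o: "c < c'" "c' \<le> d'" "d' < d" and z: "\<And>x. x \<notin> {c'..d'} \<Longrightarrow> X x = 0"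
    using assms unfolding test1_def by blast
  have "deriv X x = 0" if "x \<notin> {c'..d'}" for x
  proof -
    have "((\<lambda>x. 0) has_real_derivative 0) (at x)" by simp
    then have "(X has_real_derivative 0) (at x)"
      by (rule has_field_derivative_transform_within_open[where S = "- {c'..d'}"]) (use that z in auto)
    then show ?thesis by (rule DERIV_imp_deriv)
  qed
  then show ?thesis using s o smooth_deriv(2) unfolding test1_def by blast
qed

lemma test1_zero: "test1 c d X \<Longrightarrow> x \<notin> {c<..<d} \<Longrightarrow> X x = 0"
  unfolding test1_def by force

lemma test1_D: "test1 c d X \<Longrightarrow> (X has_real_derivative deriv X x) (at x within S)"
  unfolding test1_def using smooth_deriv(1) DERIV_subset by blast

lemma test1_cont: "test1 c d X \<Longrightarrow> continuous_on S X"
  unfolding test1_def using smooth_continuous by blast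

lemma jcont_swap:
  assumes "jcont a b g"
  shows "continuous_on ({a..b} \<times> {0..T}) (\<lambda>(x, t). g x t)"
proof -
  have "continuous_on ({a..b} \<times> {0..T}) (\<lambda>z. (\<lambda>(t, x). g x t) (snd z, fst z))"
    by (rule continuous_on_compose2[OF assms]) (auto intro!: continuous_intros)
  then show ?thesis by (simp add: case_prod_unfold)
qed

lemma integral_box:
  fixes g :: "real \<Rightarrow> real \<Rightarrow> real"
  assumes c: "continuous_on ({a..b} \<times> {0..T}) (\<lambda>(x, t). g x t)"
    and z: "\<And>x t. x \<notin> {a..b} \<or> t \<notin> {0..T} \<Longrightarrow> g x t = 0"
  shows "integral UNIV (\<lambda>(x, t). g x t) = integral {0..T} (\<lambda>t. integral {a..b} (\<lambda>x. g x t))"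
proof -
  have cb: "cbox (a, 0) (b, T) = {a..b} \<times> {0..T}" by (simp add: cbox_Pair_eq)
  have "integral UNIV (\<lambda>(x, t). g x t) = integral UNIV (\<lambda>z. if z \<in> cbox (a, 0) (b, T) then (\<lambda>(x, t). g x t) z else 0)"
  proof (rule hk_integral_cong)
    fix p :: "real \<times> real"
    show "(\<lambda>(x, t). g x t) p = (if p \<in> cbox (a, 0) (b, T) then (\<lambda>(x, t). g x t) p else 0)"
      using z[of "fst p" "snd p"] by (cases p) (auto simp: cb)
  qed
  also have "\<dots> = integral (cbox (a, 0) (b, T)) (\<lambda>(x, t). g x t)"
    by (rule integral_restrict_UNIV)
  also have "\<dots> = integral (cbox a b) (\<lambda>x. integral (cbox 0 T) (\<lambda>t. g x t))"
    using integral_prod_continuous[of a 0 b T "\<lambda>(x, t). g x t"] c by (simp add: cb)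
  also have "\<dots> = integral (cbox 0 T) (\<lambda>t. integral (cbox a b) (\<lambda>x. g x t))"
    by (rule integral_swap_continuous) (use c in \<open>simp add: cb\<close>)
  finally show ?thesis by simp
qed

text \<open>The equation is kept in the form tested with products \<open>X x * \<Theta> t\<close>,
  which suits the two successive applications of the du Bois-Reymond lemma, in time and then in
  space. The conditions on \<open>W1\<close> at \<open>\<alpha>\<close> and \<open>\<beta>\<close>
  express that the boundary values are wells; with \<open>uxx = 0\<close> they make
  \<open>\<mu>\<close> vanish at both ends.\<close>

locale flow =
  fixes a b \<tau> \<epsilon> \<alpha> \<beta> :: real and W W1 :: "real \<Rightarrow> real" and u ut ux uxx :: "real \<Rightarrow> real \<Rightarrow> real"
  assumes ab: "a < b" and \<tau>: "\<tau> > 0" and \<epsilon>: "\<epsilon> > 0"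
    and DW: "\<And>w. (W has_real_derivative W1 w) (at w)" and W1_cont: "\<And>w. isCont W1 w"
    and W_nonneg: "\<And>w. W w \<ge> 0" and W1_bc: "W1 \<alpha> = 0" "W1 \<beta> = 0"
    and u_jc: "jcont a b u" and ut_jc: "jcont a b ut" and uxx_jc: "jcont a b uxx"
    and Dx: "\<And>x t. t \<ge> 0 \<Longrightarrow> x \<in> {a..b} \<Longrightarrow> ((\<lambda>x. u x t) has_real_derivative ux x t) (at x within {a..b})"
    and Dxx: "\<And>x t. t \<ge> 0 \<Longrightarrow> x \<in> {a..b} \<Longrightarrow> ((\<lambda>x. ux x t) has_real_derivative uxx x t) (at x within {a..b})"
    and Dt: "\<And>x t. x \<in> {a..b} \<Longrightarrow> t \<ge> 0 \<Longrightarrow> ((\<lambda>s. u x s) has_real_derivative ut x t) (at t within {0..})"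
    and bc: "\<And>t. t \<ge> 0 \<Longrightarrow> u a t = \<alpha>" "\<And>t. t \<ge> 0 \<Longrightarrow> u b t = \<beta>"
      "\<And>t. t \<ge> 0 \<Longrightarrow> uxx a t = 0" "\<And>t. t \<ge> 0 \<Longrightarrow> uxx b t = 0"
    and weak: "\<And>X T \<Theta>. test1 a b X \<Longrightarrow> test1 0 T \<Theta> \<Longrightarrow>
      integral UNIV (\<lambda>(x, t). \<tau> * u x t * (X x * deriv (deriv \<Theta>) t) - u x t * (X x * deriv \<Theta> t))
      = integral UNIV (\<lambda>(x, t). (- (\<epsilon>\<^sup>2) * uxx x t + W1 (u x t)) * (deriv (deriv X) x * \<Theta> t))"
begin

definition \<mu> :: "real \<Rightarrow> real \<Rightarrow> real" where
  "\<mu> x t = - (\<epsilon>\<^sup>2) * uxx x t + W1 (u x t)"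

text \<open>The time integral of \<open>\<mu>\<close> stands in for a time derivative of
  \<open>ut\<close>: the equation becomes a relation between \<open>u\<close>, \<open>ut\<close> and
  \<open>M\<close> at two times.\<close>

definition M :: "real \<Rightarrow> real \<Rightarrow> real" where
  "M x t = integral {0..t} (\<lambda>s. \<mu> x s)"

lemma compose_jc:
  assumes "\<And>w. isCont g w" shows "jcont a b (\<lambda>x t. g (u x t))"
  using continuous_on_compose2[OF _ u_jc, of UNIV g] assms
  by (simp add: case_prod_unfold continuous_at_imp_continuous_on)

lemmas W1u_jc = compose_jc[OF W1_cont] and Wu_jc = compose_jc[OF DERIV_isCont[OF DW]]

lemma \<mu>_jc: "jcont a b \<mu>"
  using W1u_jc uxx_jc unfolding \<mu>_def case_prod_unfold by (intro continuous_intros)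

lemma M_cont: "t \<ge> 0 \<Longrightarrow> continuous_on {a..b} (\<lambda>x. M x t)"
  unfolding M_def
  using integral_continuous_on_param[of "{a..b}" 0 t "\<lambda>x s. \<mu> x s"] jcont_swap[OF \<mu>_jc, of t] by simp

lemma M_Dt: "x \<in> {a..b} \<Longrightarrow> t \<ge> 0 \<Longrightarrow> ((\<lambda>s. M x s) has_real_derivative \<mu> x t) (at t within {0..})"
  unfolding M_def by (rule integral_from_0_deriv) (use jcont_t[OF \<mu>_jc] in auto)

lemma M_bc: "t \<ge> 0 \<Longrightarrow> M a t = 0" "t \<ge> 0 \<Longrightarrow> M b t = 0"
  unfolding M_def
  by (subst hk_integral_cong[where g = "\<lambda>s. 0"]; simp add: \<mu>_def bc W1_bc)+

lemma weak_iterated: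
  assumes X: "test1 a b X" and \<Theta>: "test1 0 T \<Theta>"
  shows "integral {0..T} (\<lambda>t. integral {a..b} (\<lambda>x. u x t * X x) * (\<tau> * deriv (deriv \<Theta>) t - deriv \<Theta> t))
    = integral {0..T} (\<lambda>t. integral {a..b} (\<lambda>x. \<mu> x t * deriv (deriv X) x) * \<Theta> t)"
proof -
  let ?L = "\<lambda>x t. \<tau> * u x t * (X x * deriv (deriv \<Theta>) t) - u x t * (X x * deriv \<Theta> t)" and ?R = "\<lambda>x t. \<mu> x t * (deriv (deriv X) x * \<Theta> t)"
  note X' = test1_deriv[OF X] and \<Theta>' = test1_deriv[OF \<Theta>]
  note X'' = test1_deriv[OF X'] and \<Theta>'' = test1_deriv[OF \<Theta>']
  have cfst: "continuous_on S (\<lambda>z. g (fst z))" and csnd: "continuous_on S (\<lambda>z. g (snd z))"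
    if "continuous_on UNIV g" for S and g :: "real \<Rightarrow> real"
    using that by (auto intro!: continuous_on_compose2[OF that] continuous_intros)
  have "integral UNIV (\<lambda>(x, t). ?L x t)
      = integral {0..T} (\<lambda>t. integral {a..b} (\<lambda>x. ?L x t))"
  proof (rule integral_box)
    show "continuous_on ({a..b} \<times> {0..T}) (\<lambda>(x, t). ?L x t)"
      using jcont_swap[OF u_jc, of T] unfolding case_prod_unfold
      by (intro continuous_intros cfst csnd test1_cont[OF X] test1_cont[OF \<Theta>'] test1_cont[OF \<Theta>''])
    show "?L x t = 0"
      if "x \<notin> {a..b} \<or> t \<notin> {0..T}" for x t
      using that test1_zero[OF X, of x] test1_zero[OF \<Theta>', of t] test1_zero[OF \<Theta>'', of t] by auto
  qed
  also have "\<dots> = integral {0..T} (\<lambda>t. integral {a..b} (\<lambda>x. u x t * X x) * (\<tau> * deriv (deriv \<Theta>) t - deriv \<Theta> t))"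
  proof (rule hk_integral_cong)
    fix t
    have "integral {a..b} (\<lambda>x. ?L x t)
       = integral {a..b} (\<lambda>x. (u x t * X x) * (\<tau> * deriv (deriv \<Theta>) t - deriv \<Theta> t))"
      by (rule hk_integral_cong) (simp add: algebra_simps)
    then show "integral {a..b} (\<lambda>x. ?L x t)
       = integral {a..b} (\<lambda>x. u x t * X x) * (\<tau> * deriv (deriv \<Theta>) t - deriv \<Theta> t)" by simp
  qed
  finally have 1: "integral UNIV (\<lambda>(x, t). ?L x t) = \<dots>" .
  have "integral UNIV (\<lambda>(x, t). ?R x t)
      = integral {0..T} (\<lambda>t. integral {a..b} (\<lambda>x. ?R x t))"
  proof (rule integral_box)
    show "continuous_on ({a..b} \<times> {0..T}) (\<lambda>(x, t). ?R x t)"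
      using jcont_swap[OF \<mu>_jc, of T] unfolding case_prod_unfold
      by (intro continuous_intros cfst csnd test1_cont[OF X''] test1_cont[OF \<Theta>])
    show "?R x t = 0" if "x \<notin> {a..b} \<or> t \<notin> {0..T}" for x t
      using that test1_zero[OF X'', of x] test1_zero[OF \<Theta>, of t] by auto
  qed
  also have "\<dots> = integral {0..T} (\<lambda>t. integral {a..b} (\<lambda>x. \<mu> x t * deriv (deriv X) x) * \<Theta> t)"
  proof (rule hk_integral_cong)
    fix t
    show "integral {a..b} (\<lambda>x. ?R x t) = integral {a..b} (\<lambda>x. \<mu> x t * deriv (deriv X) x) * \<Theta> t"
      using integral_mult_left[of "{a..b}" "\<lambda>x. \<mu> x t * deriv (deriv X) x" "\<Theta> t"] by (simp add: mult.assoc)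
  qed
  finally show ?thesis using 1 weak[OF X \<Theta>] by (simp add: \<mu>_def)
qed

text \<open>For fixed \<open>X\<close> the moments satisfy \<open>\<tau> m'' + m' = F\<close> weakly
  in time. As \<open>n\<close> is the derivative of \<open>m\<close>, the du Bois-Reymond lemma
  yields this equation integrated once, with \<open>G\<close> as the antiderivative of
  \<open>F\<close> that vanishes at time 0.\<close>

lemma weak_in_time:
  assumes X: "test1 a b X" and t: "t \<ge> 0"
  shows "\<tau> * (integral {a..b} (\<lambda>x. ut x t * X x) - integral {a..b} (\<lambda>x. ut x 0 * X x))
    + (integral {a..b} (\<lambda>x. u x t * X x) - integral {a..b} (\<lambda>x. u x 0 * X x))
    = integral {a..b} (\<lambda>x. M x t * deriv (deriv X) x)"
proof -
  note X'' = test1_deriv[OF test1_deriv[OF X]]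
  have csnd: "continuous_on S (\<lambda>z. g (snd z))" if "continuous_on UNIV g" for S and g :: "real \<Rightarrow> real"
    using that by (auto intro!: continuous_on_compose2[OF that] continuous_intros)
  have jX: "jcont a b (\<lambda>x t. g x t * Y x)" if "jcont a b g" "continuous_on UNIV Y" for g Y
    using that csnd[OF that(2)] unfolding case_prod_unfold by (intro continuous_intros)
  define m where "m t = integral {a..b} (\<lambda>x. u x t * X x)" for t
  define n where "n t = integral {a..b} (\<lambda>x. ut x t * X x)" for t
  define F where "F t = integral {a..b} (\<lambda>x. \<mu> x t * deriv (deriv X) x)" for t
  define G where "G t = integral {a..b} (\<lambda>x. M x t * deriv (deriv X) x)" for t
  have jut: "jcont a b (\<lambda>x t. ut x t * X x)" and j\<mu>: "jcont a b (\<lambda>x t. \<mu> x t * deriv (deriv X) x)"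
    using jX ut_jc \<mu>_jc test1_cont X X'' by blast+
  have ju: "jcont a b (\<lambda>x t. u x t * X x)" using jX u_jc test1_cont X by blast
  have Dm: "(m has_real_derivative n t) (at t within {0..})" if "t \<ge> 0" for t
    unfolding m_def n_def
    by (rule integral_deriv_t[OF jut that]) (use jcont_x[OF ju] Dt in \<open>auto intro!: DERIV_cmult_right\<close>)
  have DG: "(G has_real_derivative F t) (at t within {0..})" if "t \<ge> 0" for t
    unfolding G_def F_def
    by (rule integral_deriv_t[OF j\<mu> that])
      (use M_cont M_Dt test1_cont[OF X''] in \<open>auto intro!: DERIV_cmult_right continuous_intros\<close>)
  have mc: "continuous_on {0..} m" by (rule DERIV_continuous_on, rule Dm) simp
  have Gc: "continuous_on {0..} G" by (rule DERIV_continuous_on, rule DG) simp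
  have Fc: "continuous_on {0..} F" unfolding F_def by (rule integral_continuous_t[OF j\<mu>])
  \<comment> \<open>With this antiderivative of \<open>m - G\<close>, all terms are tested against
    the second derivative of \<open>\<Theta>\<close>, and the weak equation says that
    \<open>\<tau> * m + P\<close> is affine.\<close>
  define P where "P t = integral {0..t} (\<lambda>t. m t - G t)" for t
  have DP: "(P has_real_derivative m t - G t) (at t within {0..})" if "t \<ge> 0" for t
    unfolding P_def by (rule integral_from_0_deriv[OF _ that]) (intro continuous_intros mc Gc)
  have Pc: "continuous_on {0..} P" by (rule DERIV_continuous_on, rule DP) simp
  define T where "T = t + 1"
  have T: "T > 0" "t \<in> {0..T}" using t by (auto simp: T_def)
  have sub: "{0..T} \<subseteq> {0..}" by auto
  note cT = continuous_on_subset[OF _ sub]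
  have DT: "(g has_real_derivative g') (at s within {0..T})" if "(g has_real_derivative g') (at s within {0..})" for g g' s
    using that DERIV_subset sub by blast
  define D where "D t = \<tau> * m t + P t" for t
  have "integral {0..T} (\<lambda>t. D t * deriv (deriv \<Theta>) t) = 0" if \<Theta>: "test1 0 T \<Theta>" for \<Theta>
  proof -
    note \<Theta>' = test1_deriv[OF \<Theta>]
    note \<Theta>'' = test1_deriv[OF \<Theta>']
    have z: "\<Theta> 0 = 0" "\<Theta> T = 0" "deriv \<Theta> 0 = 0" "deriv \<Theta> T = 0"
      using test1_zero[OF \<Theta>] test1_zero[OF \<Theta>'] by auto
    have i1: "integral {0..T} (\<lambda>t. P t * deriv (deriv \<Theta>) t) = - integral {0..T} (\<lambda>t. (m t - G t) * deriv \<Theta> t)"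
      by (subst integration_by_parts_real[where f = "\<lambda>t. m t - G t" and G = "deriv \<Theta>"])
        (use T z DP mc Gc in \<open>auto intro!: DT test1_D[OF \<Theta>'] cT test1_cont[OF \<Theta>''] continuous_intros\<close>)
    have i2: "integral {0..T} (\<lambda>t. G t * deriv \<Theta> t) = - integral {0..T} (\<lambda>t. F t * \<Theta> t)"
      by (subst integration_by_parts_real[where f = F and G = \<Theta>])
        (use T z DG Fc in \<open>auto intro!: DT test1_D[OF \<Theta>] cT test1_cont[OF \<Theta>'] continuous_intros\<close>)
    note ints = integrable_integral integrable_continuous_real continuous_intros cT[OF mc] cT[OF Gc] cT[OF Pc]
      cT[OF Fc] test1_cont[OF \<Theta>'] test1_cont[OF \<Theta>''] test1_cont[OF \<Theta>]
    have "((\<lambda>t. \<tau> * (m t * deriv (deriv \<Theta>) t) + P t * deriv (deriv \<Theta>) t) has_integral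
       \<tau> * integral {0..T} (\<lambda>t. m t * deriv (deriv \<Theta>) t) + integral {0..T} (\<lambda>t. P t * deriv (deriv \<Theta>) t)) {0..T}"
      by (intro has_integral_add has_integral_mult_right ints)
    then have e1: "integral {0..T} (\<lambda>t. D t * deriv (deriv \<Theta>) t) =
       \<tau> * integral {0..T} (\<lambda>t. m t * deriv (deriv \<Theta>) t) + integral {0..T} (\<lambda>t. P t * deriv (deriv \<Theta>) t)"
      by (intro integral_unique) (simp add: D_def algebra_simps)
    have "((\<lambda>t. m t * deriv \<Theta> t - G t * deriv \<Theta> t) has_integral
       integral {0..T} (\<lambda>t. m t * deriv \<Theta> t) - integral {0..T} (\<lambda>t. G t * deriv \<Theta> t)) {0..T}"
      by (intro has_integral_diff ints)
    then have e2: "integral {0..T} (\<lambda>t. (m t - G t) * deriv \<Theta> t) =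
       integral {0..T} (\<lambda>t. m t * deriv \<Theta> t) - integral {0..T} (\<lambda>t. G t * deriv \<Theta> t)"
      by (intro integral_unique) (simp add: algebra_simps)
    have "((\<lambda>t. \<tau> * (m t * deriv (deriv \<Theta>) t) - m t * deriv \<Theta> t) has_integral
       \<tau> * integral {0..T} (\<lambda>t. m t * deriv (deriv \<Theta>) t) - integral {0..T} (\<lambda>t. m t * deriv \<Theta> t)) {0..T}"
      by (intro has_integral_diff has_integral_mult_right ints)
    then have e3: "integral {0..T} (\<lambda>t. m t * (\<tau> * deriv (deriv \<Theta>) t - deriv \<Theta> t)) =
       \<tau> * integral {0..T} (\<lambda>t. m t * deriv (deriv \<Theta>) t) - integral {0..T} (\<lambda>t. m t * deriv \<Theta> t)"
      by (intro integral_unique) (simp add: algebra_simps)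
    show ?thesis using weak_iterated[OF X \<Theta>] e1 e2 e3 i1 i2 unfolding m_def[symmetric] F_def[symmetric] by linarith
  qed
  moreover have "continuous_on {0..T} D" unfolding D_def by (intro continuous_intros cT[OF mc] cT[OF Pc])
  ultimately obtain k q where kq: "\<And>s. s \<in> {0..T} \<Longrightarrow> D s = k * s + q"
    using du_Bois_Reymond_second[OF T(1)] by blast
  \<comment> \<open>The slope \<open>k\<close> is the constant of integration in time; comparing the
    times \<open>t\<close> and 0 eliminates it.\<close>
  have const: "\<tau> * n s + (m s - G s) = k" if s: "s \<in> {0..T}" for s
  proof -
    have 1: "(D has_real_derivative \<tau> * n s + (m s - G s)) (at s within {0..T})"
      unfolding D_def by (intro DERIV_add DERIV_cmult DT Dm DP) (use s in auto)
    have "((\<lambda>s. k * s + q) has_real_derivative k) (at s within {0..T})"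
      by (auto intro!: derivative_eq_intros)
    then have 2: "(D has_real_derivative k) (at s within {0..T})"
      by (rule has_field_derivative_transform_within[where d = 1]) (use s kq in auto)
    \<comment> \<open>Derivatives within a closed interval are unique also at its ends, and the end
      0 is needed.\<close>
    have "(D has_vector_derivative \<tau> * n s + (m s - G s)) (at s within cbox 0 T)" "(D has_vector_derivative k) (at s within cbox 0 T)"
      using 1 2 by (simp_all only: has_real_derivative_iff_has_vector_derivative box_real)
    then show ?thesis 
      by (rule vector_derivative_unique_within_closed_interval[rotated 2]) (use T s in auto)
  qed
  have "G 0 = 0" by (simp add: G_def M_def)
  then show ?thesis using const[of t] const[of 0] T
    unfolding m_def[symmetric] n_def[symmetric] G_def[symmetric] by (simp add: algebra_simps)
qed

text \<open>Weakly, \<open>Q\<close> is the second space derivative of \<open>R\<close>. Hence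
  \<open>R\<close> differs from the double antiderivative \<open>Q2\<close> by an affine function,
  and the derivative of \<open>R\<close> is \<open>bar a b Q\<close> plus a constant. As
  \<open>R\<close> vanishes at both ends, it can be integrated by parts against
  \<open>bar a b g\<close>, an antiderivative of \<open>g\<close>; the constant disappears because
  \<open>bar a b g\<close> has mean zero.\<close>

lemma bar_identity:
  assumes t: "t \<ge> 0" and s: "s \<ge> 0" and g: "continuous_on {a..b} g"
  shows "integral {a..b} (\<lambda>x. bar a b (\<lambda>x. \<tau> * (ut x t - ut x s) + (u x t - u x s)) x * bar a b g x)
    = - integral {a..b} (\<lambda>x. (M x t - M x s) * g x)"
proof -
  define Q where "Q x = \<tau> * (ut x t - ut x s) + (u x t - u x s)" for x
  define R where "R x = M x t - M x s" for x
  have c: "continuous_on {a..b} (\<lambda>x. u x t)" "continuous_on {a..b} (\<lambda>x. u x s)"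
    "continuous_on {a..b} (\<lambda>x. ut x t)" "continuous_on {a..b} (\<lambda>x. ut x s)"
    using jcont_x[OF u_jc] jcont_x[OF ut_jc] s t by auto
  have Qc: "continuous_on {a..b} Q" unfolding Q_def by (intro continuous_intros c)
  have Rc: "continuous_on {a..b} R" unfolding R_def by (intro continuous_intros M_cont s t)
  define Q1 where "Q1 x = integral {a..x} Q" for x
  have DQ1: "(Q1 has_real_derivative Q x) (at x within {a..b})" if "x \<in> {a..b}" for x
    unfolding Q1_def by (rule integral_has_real_derivative[OF Qc that])
  have Q1c: "continuous_on {a..b} Q1" by (rule DERIV_continuous_on[OF DQ1])
  define Q2 where "Q2 x = integral {a..x} Q1" for x
  have DQ2: "(Q2 has_real_derivative Q1 x) (at x within {a..b})" if "x \<in> {a..b}" for x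
    unfolding Q2_def by (rule integral_has_real_derivative[OF Q1c that])
  have Q2c: "continuous_on {a..b} Q2" by (rule DERIV_continuous_on[OF DQ2])
  have "integral {a..b} (\<lambda>x. (R x - Q2 x) * deriv (deriv X) x) = 0" if X: "test1 a b X" for X
  proof -
    note X' = test1_deriv[OF X]
    note X'' = test1_deriv[OF X']
    have z: "X a = 0" "X b = 0" "deriv X a = 0" "deriv X b = 0"
      using test1_zero[OF X] test1_zero[OF X'] by auto
    have i1: "integral {a..b} (\<lambda>t. Q2 t * deriv (deriv X) t) = - integral {a..b} (\<lambda>t. Q1 t * deriv X t)"
      by (subst integration_by_parts_real[where f = Q1 and G = "deriv X"])
        (use ab z DQ2 Q1c in \<open>auto intro!: test1_D[OF X'] test1_cont[OF X'']\<close>)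
    have i2: "integral {a..b} (\<lambda>t. Q1 t * deriv X t) = - integral {a..b} (\<lambda>t. Q t * X t)"
      by (subst integration_by_parts_real[where f = Q and G = X])
        (use ab z DQ1 Qc in \<open>auto intro!: test1_D[OF X] test1_cont[OF X']\<close>)
    note ints = integrable_integral integrable_continuous_real continuous_intros c M_cont[OF t] M_cont[OF s]
      test1_cont[OF X] test1_cont[OF X''] Q2c
    have "((\<lambda>x. \<tau> * (ut x t * X x - ut x s * X x) + (u x t * X x - u x s * X x)) has_integral
       \<tau> * (integral {a..b} (\<lambda>x. ut x t * X x) - integral {a..b} (\<lambda>x. ut x s * X x))
       + (integral {a..b} (\<lambda>x. u x t * X x) - integral {a..b} (\<lambda>x. u x s * X x))) {a..b}"
      by (intro has_integral_add has_integral_diff has_integral_mult_right ints)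
    then have e1: "integral {a..b} (\<lambda>x. Q x * X x) =
       \<tau> * (integral {a..b} (\<lambda>x. ut x t * X x) - integral {a..b} (\<lambda>x. ut x s * X x))
       + (integral {a..b} (\<lambda>x. u x t * X x) - integral {a..b} (\<lambda>x. u x s * X x))"
      by (intro integral_unique) (simp add: Q_def algebra_simps)
    have "((\<lambda>x. M x t * deriv (deriv X) x - M x s * deriv (deriv X) x - Q2 x * deriv (deriv X) x) has_integral
       integral {a..b} (\<lambda>x. M x t * deriv (deriv X) x) - integral {a..b} (\<lambda>x. M x s * deriv (deriv X) x)
       - integral {a..b} (\<lambda>x. Q2 x * deriv (deriv X) x)) {a..b}"
      by (intro has_integral_diff ints)
    then have "integral {a..b} (\<lambda>x. (R x - Q2 x) * deriv (deriv X) x) =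
       integral {a..b} (\<lambda>x. M x t * deriv (deriv X) x) - integral {a..b} (\<lambda>x. M x s * deriv (deriv X) x)
       - integral {a..b} (\<lambda>x. Q2 x * deriv (deriv X) x)"
      by (intro integral_unique) (simp add: R_def algebra_simps)
    then show ?thesis
      using weak_in_time[OF X t] weak_in_time[OF X s] e1 i1 i2 by (simp add: algebra_simps)
  qed
  moreover have "continuous_on {a..b} (\<lambda>x. R x - Q2 x)" by (intro continuous_intros Rc Q2c)
  ultimately obtain k q where kq: "\<And>x. x \<in> {a..b} \<Longrightarrow> R x - Q2 x = k * x + q"
    using du_Bois_Reymond_second[OF ab, of "\<lambda>x. R x - Q2 x"] by blast
  have DR: "(R has_real_derivative Q1 x + k) (at x within {a..b})" if x: "x \<in> {a..b}" for x
  proof -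
    have "((\<lambda>x. Q2 x + (k * x + q)) has_real_derivative Q1 x + k) (at x within {a..b})"
      using DQ2[OF x] by (auto intro!: derivative_eq_intros)
    then show ?thesis
      by (rule has_field_derivative_transform_within[where d = 1]) (use x kq in \<open>auto simp: algebra_simps\<close>)
  qed
  have bg: "continuous_on {a..b} (bar a b g)" by (rule bar_cont[OF g])
  have "integral {a..b} (\<lambda>x. R x * g x) = - integral {a..b} (\<lambda>x. (Q1 x + k) * bar a b g x)"
    by (subst integration_by_parts_real[where f = "\<lambda>x. Q1 x + k" and G = "bar a b g"])
      (use ab g Q1c DR bar_deriv[OF g] M_bc s t in \<open>auto intro!: continuous_intros simp: R_def\<close>)
  moreover define C where "C = k + 1 / (b - a) * integral {a..b} (\<lambda>y. integral {a..y} Q)"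
  have "(\<lambda>x. (Q1 x + k) * bar a b g x) = (\<lambda>x. bar a b Q x * bar a b g x + C * bar a b g x)"
    unfolding C_def bar_def[of a b Q] Q1_def[symmetric] by (simp add: algebra_simps)
  moreover have "integral {a..b} (\<lambda>x. bar a b Q x * bar a b g x + C * bar a b g x)
     = integral {a..b} (\<lambda>x. bar a b Q x * bar a b g x) + integral {a..b} (\<lambda>x. C * bar a b g x)"
    by (intro hk_integral_add integrable_continuous_real continuous_intros bg bar_cont[OF Qc])
  moreover have "integral {a..b} (\<lambda>x. C * bar a b g x) = 0"
    using integral_bar[OF ab g] by simp
  ultimately show ?thesis unfolding Q_def R_def by simp
qed

end

section \<open>Energy dissipation\<close>

context flow begin

definition Y :: "real \<Rightarrow> real" where
  "Y t = integral {a..b} (\<lambda>x. (bar a b (\<lambda>x. ut x t) x)\<^sup>2)"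

definition pot :: "real \<Rightarrow> real" where
  "pot t = integral {a..b} (\<lambda>x. \<epsilon> / 2 * (ux x t)\<^sup>2 + W (u x t) / \<epsilon>)"

definition En :: "real \<Rightarrow> real" where
  "En t = \<tau> / (2 * \<epsilon>) * Y t + pot t"

lemma ux_cont: "t \<ge> 0 \<Longrightarrow> continuous_on {a..b} (\<lambda>x. ux x t)"
  using Dxx by (intro DERIV_continuous_on) auto

lemmas slices = jcont_x[OF u_jc] jcont_x[OF ut_jc] jcont_x[OF uxx_jc] jcont_x[OF \<mu>_jc] ux_cont
  jcont_x[OF Wu_jc] jcont_x[OF W1u_jc]

lemma bar_slices:
  "t \<ge> 0 \<Longrightarrow> continuous_on {a..b} (bar a b (\<lambda>x. u x t))"
  "t \<ge> 0 \<Longrightarrow> continuous_on {a..b} (bar a b (\<lambda>x. ut x t))"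
  by (intro bar_cont slices; assumption)+

lemma bar_quotient:
  assumes "t \<ge> 0" "s \<ge> 0" "x \<in> {a..b}"
  shows "bar a b (\<lambda>x. (u x s - u x t) / (s - t)) x = (bar a b (\<lambda>x. u x s) x - bar a b (\<lambda>x. u x t) x) / (s - t)"
proof -
  have "bar a b (\<lambda>x. (1 / (s - t)) * (u x s - u x t)) x = (1 / (s - t)) * bar a b (\<lambda>x. u x s - u x t) x"
    by (rule bar_cmult)
  also have "bar a b (\<lambda>x. u x s - u x t) x = bar a b (\<lambda>x. u x s) x - bar a b (\<lambda>x. u x t) x"
    by (rule bar_minus) (use assms in \<open>auto intro!: integrable_continuous_real slices\<close>)
  finally show ?thesis by simp
qed

lemma u_quotient_limit:
  "t \<ge> 0 \<Longrightarrow> uniform_limit {a..b} (\<lambda>s x. (u x s - u x t) / (s - t)) (\<lambda>x. ut x t) (at t within {0..})"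
  by (rule difference_quotient_uniform_limit[OF ut_jc _ Dt]) auto

lemma quotient_cont:
  fixes g :: "real \<Rightarrow> real \<Rightarrow> real"
  assumes "t \<ge> 0" "\<And>s. s \<ge> 0 \<Longrightarrow> continuous_on {a..b} (\<lambda>x. g x s)"
  shows "\<forall>\<^sub>F s in at t within {0..}. continuous_on {a..b} (\<lambda>x. (g x s - g x t) / (s - t))"
  by (rule eventually_mono[OF eventually_at_atLeast]) (use assms in \<open>auto intro!: continuous_intros\<close>)

lemma bar_quotient_limit:
  assumes t: "t \<ge> 0"
  shows "uniform_limit {a..b} (\<lambda>s x. (bar a b (\<lambda>x. u x s) x - bar a b (\<lambda>x. u x t) x) / (s - t))
    (bar a b (\<lambda>x. ut x t)) (at t within {0..})"
proof -
  have "uniform_limit {a..b} (\<lambda>s. bar a b (\<lambda>x. (u x s - u x t) / (s - t))) (bar a b (\<lambda>x. ut x t)) (at t within {0..})"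
    by (rule bar_uniform_limit[OF ab u_quotient_limit[OF t] quotient_cont[OF t] at_within_atLeast_neq_bot[OF t]])
      (use slices in auto)
  moreover have "\<forall>\<^sub>F s in at t within {0..}. \<forall>x\<in>{a..b}. bar a b (\<lambda>x. (u x s - u x t) / (s - t)) x
      = (bar a b (\<lambda>x. u x s) x - bar a b (\<lambda>x. u x t) x) / (s - t)"
    using eventually_at_atLeast by eventually_elim (use bar_quotient t in auto)
  ultimately show ?thesis
    by (subst (asm) uniform_limit_cong) auto
qed

lemma bar_limit:
  assumes t: "t \<ge> 0" and g: "jcont a b g"
  shows "uniform_limit {a..b} (\<lambda>s. bar a b (\<lambda>x. g x s)) (bar a b (\<lambda>x. g x t)) (at t within {0..})"
  by (rule bar_uniform_limit[OF ab jcont_uniform_limit[OF g t] jcont_eventually[OF g] at_within_atLeast_neq_bot[OF t]])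

lemma integral_product_limit:
  fixes q p :: "real \<Rightarrow> real \<Rightarrow> real"
  assumes t: "t \<ge> 0"
    and q: "uniform_limit {a..b} (\<lambda>s x. q s x) l (at t within {0..})"
    and p: "uniform_limit {a..b} (\<lambda>s x. p s x) p0 (at t within {0..})"
    and qc: "\<forall>\<^sub>F s in at t within {0..}. continuous_on {a..b} (q s)"
    and pc: "\<forall>\<^sub>F s in at t within {0..}. continuous_on {a..b} (p s)"
  shows "((\<lambda>s. integral {a..b} (\<lambda>x. q s x * p s x)) \<longlongrightarrow> integral {a..b} (\<lambda>x. l x * p0 x)) (at t within {0..})"
proof (rule integral_uniform_limit[where f = "\<lambda>s x. q s x * p s x"])
  note nb = at_within_atLeast_neq_bot[OF t]
  show "uniform_limit {a..b} (\<lambda>s x. q s x * p s x) (\<lambda>x. l x * p0 x) (at t within {0..})"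
    by (rule uniform_limit_mult_cont[OF q p uniform_limit_theorem[OF qc q nb] uniform_limit_theorem[OF pc p nb]])
  show "\<forall>\<^sub>F s in at t within {0..}. continuous_on {a..b} (\<lambda>x. q s x * p s x)"
    using qc pc by eventually_elim (intro continuous_intros)
qed (use ab at_within_atLeast_neq_bot[OF t] in auto)

text \<open>\<open>u\<^sub>t\<close> need not be differentiable in time; the difference quotient of \<open>Y\<close> is rewritten by
  \<open>bar_identity\<close> so that only \<open>u\<close> and \<open>M\<close> are differentiated.\<close>
lemma Y_deriv:
  assumes t: "t \<ge> 0"
  shows "(Y has_real_derivative - (2 / \<tau>) * (integral {a..b} (\<lambda>x. \<mu> x t * ut x t) + Y t)) (at t within {0..})"
proof -
  let ?F = "at t within {0..}"
  let ?y = "\<lambda>s. bar a b (\<lambda>x. ut x s)" and ?U = "\<lambda>s. bar a b (\<lambda>x. u x s)"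
  let ?I = "\<lambda>s. integral {a..b} (\<lambda>x. (M x s - M x t) / (s - t) * (ut x s + ut x t))"
  let ?J = "\<lambda>s. integral {a..b} (\<lambda>x. (?U s x - ?U t x) / (s - t) * (?y s x + ?y t x))"
  have evut: "\<forall>\<^sub>F s in ?F. continuous_on {a..b} (\<lambda>x. ut x s + ut x t)"
    and evy: "\<forall>\<^sub>F s in ?F. continuous_on {a..b} (\<lambda>x. ?y s x + ?y t x)"
    and evU: "\<forall>\<^sub>F s in ?F. continuous_on {a..b} (\<lambda>x. (?U s x - ?U t x) / (s - t))"
    using eventually_at_atLeast by (eventually_elim, use t in \<open>auto intro!: continuous_intros slices bar_slices\<close>)+
  have 1: "(?I \<longlongrightarrow> integral {a..b} (\<lambda>x. \<mu> x t * (ut x t + ut x t))) ?F"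
    by (rule integral_product_limit[OF t difference_quotient_uniform_limit[OF \<mu>_jc t M_Dt]
        uniform_limit_add[OF jcont_uniform_limit[OF ut_jc t] uniform_limit_const] quotient_cont[OF t M_cont] evut]) auto
  have 2: "(?J \<longlongrightarrow> integral {a..b} (\<lambda>x. ?y t x * (?y t x + ?y t x))) ?F"
    by (rule integral_product_limit[OF t bar_quotient_limit[OF t]
        uniform_limit_add[OF bar_limit[OF t ut_jc] uniform_limit_const] evU evy])
  have "((\<lambda>s. - (1 / \<tau>) * (?I s + ?J s)) \<longlongrightarrow>
      - (1 / \<tau>) * (integral {a..b} (\<lambda>x. \<mu> x t * (ut x t + ut x t)) + integral {a..b} (\<lambda>x. ?y t x * (?y t x + ?y t x)))) ?F"
    by (intro tendsto_intros 1 2)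
  also have "integral {a..b} (\<lambda>x. \<mu> x t * (ut x t + ut x t)) = 2 * integral {a..b} (\<lambda>x. \<mu> x t * ut x t)"
    by (subst integral_mult_right[symmetric]) (simp add: algebra_simps)
  also have "integral {a..b} (\<lambda>x. ?y t x * (?y t x + ?y t x)) = 2 * Y t"
    unfolding Y_def by (subst integral_mult_right[symmetric]) (simp add: algebra_simps power2_eq_square)
  finally have lim: "((\<lambda>s. - (1 / \<tau>) * (?I s + ?J s)) \<longlongrightarrow>
      - (2 / \<tau>) * (integral {a..b} (\<lambda>x. \<mu> x t * ut x t) + Y t)) ?F"
    by (simp add: algebra_simps)
  have "\<forall>\<^sub>F s in ?F. - (1 / \<tau>) * (?I s + ?J s) = (Y s - Y t) / (s - t)"
    using eventually_at_atLeast
  proof eventually_elim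
    case (elim s)
    then have s: "s \<ge> 0" "s \<noteq> t" by auto
    \<comment> \<open>The sum over the two times is the test function that turns the
      \<open>\<tau>\<close> part of the product into the difference of squares in
      \<open>Y s - Y t\<close>.\<close>
    define g where "g x = ut x s + ut x t" for x
    have gc: "continuous_on {a..b} g" unfolding g_def by (intro continuous_intros slices s t)
    have bg: "bar a b g x = ?y s x + ?y t x" if "x \<in> {a..b}" for x
    proof -
      have "bar a b (\<lambda>x. ut x s - (- 1) * ut x t) x = ?y s x - bar a b (\<lambda>x. (-1) * ut x t) x"
        by (rule bar_minus) (use that s t in \<open>auto intro!: integrable_continuous_real continuous_intros slices\<close>)
      also have "bar a b (\<lambda>x. (-1) * ut x t) x = (-1) * ?y t x" by (rule bar_cmult)
      finally show ?thesis unfolding g_def by simp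
    qed
    have bQ: "bar a b (\<lambda>x. \<tau> * (ut x s - ut x t) + (u x s - u x t)) x = \<tau> * (?y s x - ?y t x) + (?U s x - ?U t x)"
      if x: "x \<in> {a..b}" for x
    proof -
      have "bar a b (\<lambda>x. \<tau> * (ut x s - ut x t) - (u x t - u x s)) x = bar a b (\<lambda>x. \<tau> * (ut x s - ut x t)) x - bar a b (\<lambda>x. u x t - u x s) x"
        by (rule bar_minus) (use x s t in \<open>auto intro!: integrable_continuous_real continuous_intros slices\<close>)
      also have "bar a b (\<lambda>x. \<tau> * (ut x s - ut x t)) x = \<tau> * bar a b (\<lambda>x. ut x s - ut x t) x" by (rule bar_cmult)
      also have "bar a b (\<lambda>x. ut x s - ut x t) x = ?y s x - ?y t x"
        by (rule bar_minus) (use x s t in \<open>auto intro!: integrable_continuous_real slices\<close>)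
      also have "bar a b (\<lambda>x. u x t - u x s) x = ?U t x - ?U s x"
        by (rule bar_minus) (use x s t in \<open>auto intro!: integrable_continuous_real slices\<close>)
      finally show ?thesis by (simp add: algebra_simps)
    qed
    note ints = integrable_integral integrable_continuous_real continuous_intros bar_slices slices M_cont s t
    have "((\<lambda>x. \<tau> * ((?y s x)\<^sup>2 - (?y t x)\<^sup>2) + (?U s x - ?U t x) * (?y s x + ?y t x)) has_integral
       \<tau> * (Y s - Y t) + integral {a..b} (\<lambda>x. (?U s x - ?U t x) * (?y s x + ?y t x))) {a..b}"
      unfolding Y_def by (intro has_integral_add has_integral_mult_right has_integral_diff ints)
    then have "\<tau> * (Y s - Y t) + integral {a..b} (\<lambda>x. (?U s x - ?U t x) * (?y s x + ?y t x))
      = integral {a..b} (\<lambda>x. \<tau> * ((?y s x)\<^sup>2 - (?y t x)\<^sup>2) + (?U s x - ?U t x) * (?y s x + ?y t x))"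
      by (rule integral_unique[symmetric])
    also have "\<dots> = integral {a..b} (\<lambda>x. bar a b (\<lambda>x. \<tau> * (ut x s - ut x t) + (u x s - u x t)) x * bar a b g x)"
    proof (rule hk_integral_cong)
      fix x assume x: "x \<in> {a..b}"
      show "\<tau> * ((?y s x)\<^sup>2 - (?y t x)\<^sup>2) + (?U s x - ?U t x) * (?y s x + ?y t x)
        = bar a b (\<lambda>x. \<tau> * (ut x s - ut x t) + (u x s - u x t)) x * bar a b g x"
        unfolding bQ[OF x] bg[OF x] by (simp add: power2_eq_square algebra_simps)
    qed
    also have "\<dots> = - integral {a..b} (\<lambda>x. (M x s - M x t) * g x)"
      by (rule bar_identity[OF s(1) t gc])
    finally have *: "\<tau> * (Y s - Y t) = - integral {a..b} (\<lambda>x. (M x s - M x t) * g x)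
       - integral {a..b} (\<lambda>x. (?U s x - ?U t x) * (?y s x + ?y t x))" by simp
    have 3: "?I s = integral {a..b} (\<lambda>x. (M x s - M x t) * g x) / (s - t)"
      by (subst integral_divide[symmetric]) (simp add: g_def)
    have 4: "?J s = integral {a..b} (\<lambda>x. (?U s x - ?U t x) * (?y s x + ?y t x)) / (s - t)"
      by (subst integral_divide[symmetric]) simp
    have "(Y s - Y t) / (s - t) = (1 / \<tau>) * (\<tau> * (Y s - Y t)) / (s - t)" using \<tau> by simp
    then show ?case unfolding 3 4 * by (simp add: diff_divide_distrib add_divide_distrib algebra_simps)
  qed
  with lim show ?thesis
    unfolding has_field_derivative_iff by (rule Lim_transform_eventually)
qed

text \<open>Time differentiability of \<open>ux\<close> is bypassed: the difference of squares
  factors into \<open>ux x s - ux x t\<close> and \<open>ux x s + ux x t\<close>, and an integration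
  by parts moves the space derivative from the first factor to the second. The boundary terms vanish
  because the boundary values of \<open>u\<close> are constant in time.\<close>

lemma gradient_deriv:
  assumes t: "t \<ge> 0"
  shows "((\<lambda>t. integral {a..b} (\<lambda>x. (ux x t)\<^sup>2)) has_real_derivative - 2 * integral {a..b} (\<lambda>x. ut x t * uxx x t)) (at t within {0..})"
proof -
  let ?F = "at t within {0..}"
  have ev: "\<forall>\<^sub>F s in ?F. continuous_on {a..b} (\<lambda>x. uxx x s + uxx x t)"
    using eventually_at_atLeast by (eventually_elim) (use t in \<open>auto intro!: continuous_intros slices\<close>)
  have "((\<lambda>s. integral {a..b} (\<lambda>x. (u x s - u x t) / (s - t) * (uxx x s + uxx x t))) \<longlongrightarrow>
     integral {a..b} (\<lambda>x. ut x t * (uxx x t + uxx x t))) ?F"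
    by (rule integral_product_limit[OF t u_quotient_limit[OF t]
        uniform_limit_add[OF jcont_uniform_limit[OF uxx_jc t] uniform_limit_const] quotient_cont[OF t] ev])
      (use slices in auto)
  also have "integral {a..b} (\<lambda>x. ut x t * (uxx x t + uxx x t)) = 2 * integral {a..b} (\<lambda>x. ut x t * uxx x t)"
    by (subst integral_mult_right[symmetric]) (simp add: algebra_simps)
  finally have lim: "((\<lambda>s. - integral {a..b} (\<lambda>x. (u x s - u x t) / (s - t) * (uxx x s + uxx x t))) \<longlongrightarrow>
     - (2 * integral {a..b} (\<lambda>x. ut x t * uxx x t))) ?F" by (intro tendsto_intros)
  have "\<forall>\<^sub>F s in ?F. - integral {a..b} (\<lambda>x. (u x s - u x t) / (s - t) * (uxx x s + uxx x t))
      = (integral {a..b} (\<lambda>x. (ux x s)\<^sup>2) - integral {a..b} (\<lambda>x. (ux x t)\<^sup>2)) / (s - t)"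
    using eventually_at_atLeast
  proof eventually_elim
    case (elim s)
    then have s: "s \<ge> 0" "s \<noteq> t" by auto
    have "integral {a..b} (\<lambda>x. (u x s - u x t) * (uxx x s + uxx x t)) =
      - integral {a..b} (\<lambda>x. (ux x s - ux x t) * (ux x s + ux x t))"
      by (subst integration_by_parts_real[where f = "\<lambda>x. ux x s - ux x t" and G = "\<lambda>x. ux x s + ux x t"])
        (use ab s t bc in \<open>auto intro!: DERIV_add DERIV_diff Dx Dxx continuous_intros slices\<close>)
    also have "integral {a..b} (\<lambda>x. (ux x s - ux x t) * (ux x s + ux x t)) = integral {a..b} (\<lambda>x. (ux x s)\<^sup>2 - (ux x t)\<^sup>2)"
      by (rule hk_integral_cong) (simp add: power2_eq_square algebra_simps)
    also have "\<dots> = integral {a..b} (\<lambda>x. (ux x s)\<^sup>2) - integral {a..b} (\<lambda>x. (ux x t)\<^sup>2)"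
      by (intro hk_integral_diff integrable_continuous_real continuous_intros slices s t)
    finally have "integral {a..b} (\<lambda>x. (u x s - u x t) * (uxx x s + uxx x t)) =
      - (integral {a..b} (\<lambda>x. (ux x s)\<^sup>2) - integral {a..b} (\<lambda>x. (ux x t)\<^sup>2))" .
    moreover have "integral {a..b} (\<lambda>x. (u x s - u x t) / (s - t) * (uxx x s + uxx x t)) = integral {a..b} (\<lambda>x. (u x s - u x t) * (uxx x s + uxx x t)) / (s - t)"
      by (subst integral_divide[symmetric]) simp
    ultimately show ?case by (simp only: minus_divide_left minus_minus)
  qed
  with lim have "((\<lambda>s. (integral {a..b} (\<lambda>x. (ux x s)\<^sup>2) - integral {a..b} (\<lambda>x. (ux x t)\<^sup>2)) / (s - t)) \<longlongrightarrow>
     - (2 * integral {a..b} (\<lambda>x. ut x t * uxx x t))) ?F" by (rule Lim_transform_eventually)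
  then show ?thesis unfolding has_field_derivative_iff by simp
qed

lemma pot_split:
  assumes "t \<ge> 0"
  shows "pot t = \<epsilon> / 2 * integral {a..b} (\<lambda>x. (ux x t)\<^sup>2) + (1 / \<epsilon>) * integral {a..b} (\<lambda>x. W (u x t))"
proof -
  have "((\<lambda>x. \<epsilon> / 2 * (ux x t)\<^sup>2 + (1 / \<epsilon>) * W (u x t)) has_integral
     \<epsilon> / 2 * integral {a..b} (\<lambda>x. (ux x t)\<^sup>2) + (1 / \<epsilon>) * integral {a..b} (\<lambda>x. W (u x t))) {a..b}"
    by (intro linear_integral_intros slices assms)
  then show ?thesis unfolding pot_def by (simp add: integral_unique)
qed

lemma En_deriv:
  assumes t: "t \<ge> 0"
  shows "(En has_real_derivative - Y t / \<epsilon>) (at t within {0..})"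
proof -
  define I1 where "I1 = integral {a..b} (\<lambda>x. ut x t * uxx x t)"
  define I2 where "I2 = integral {a..b} (\<lambda>x. W1 (u x t) * ut x t)"
  have "integral {a..b} (\<lambda>x. \<mu> x t * ut x t) = integral {a..b} (\<lambda>x. (- (\<epsilon>\<^sup>2)) * (ut x t * uxx x t) + W1 (u x t) * ut x t)"
    by (rule hk_integral_cong) (simp add: \<mu>_def algebra_simps)
  also have "\<dots> = - (\<epsilon>\<^sup>2) * I1 + I2"
    unfolding I1_def I2_def
    by (rule integral_unique) (intro linear_integral_intros slices t)
  finally have I: "integral {a..b} (\<lambda>x. \<mu> x t * ut x t) = - (\<epsilon>\<^sup>2) * I1 + I2" .
  have "((\<lambda>t. integral {a..b} (\<lambda>x. W (u x t))) has_real_derivative I2) (at t within {0..})"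
    unfolding I2_def
  proof (rule integral_deriv_t[OF _ t])
    show "jcont a b (\<lambda>x t. W1 (u x t) * ut x t)"
      using W1u_jc ut_jc unfolding case_prod_unfold by (intro continuous_intros)
    show "((\<lambda>s. W (u x s)) has_real_derivative W1 (u x t) * ut x t) (at t within {0..})"
      if "x \<in> {a..b}" "t \<ge> 0" for x t
      by (rule DERIV_chain2[OF DW Dt[OF that]])
  qed (rule slices)
  then have "((\<lambda>t. \<tau> / (2 * \<epsilon>) * Y t + (\<epsilon> / 2 * integral {a..b} (\<lambda>x. (ux x t)\<^sup>2) + (1 / \<epsilon>) * integral {a..b} (\<lambda>x. W (u x t))))
     has_real_derivative \<tau> / (2 * \<epsilon>) * (- (2 / \<tau>) * (- (\<epsilon>\<^sup>2) * I1 + I2 + Y t)) + (\<epsilon> / 2 * (- 2 * I1) + (1 / \<epsilon>) * I2))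
     (at t within {0..})"
    using Y_deriv[OF t] gradient_deriv[OF t] unfolding I I1_def[symmetric] by (intro DERIV_add DERIV_cmult)
  \<comment> \<open>The contribution of \<open>\<mu>\<close> to the kinetic part cancels the
    derivative of the gradient term and of the potential term; only the damping \<open>Y\<close>
    survives.\<close>
  moreover have "\<tau> / (2 * \<epsilon>) * (- (2 / \<tau>) * (- (\<epsilon>\<^sup>2) * I1 + I2 + Y t)) + (\<epsilon> / 2 * (- 2 * I1) + (1 / \<epsilon>) * I2) = - Y t / \<epsilon>"
    using \<tau> \<epsilon> by (simp add: field_simps power2_eq_square)
  ultimately have "((\<lambda>t. \<tau> / (2 * \<epsilon>) * Y t + (\<epsilon> / 2 * integral {a..b} (\<lambda>x. (ux x t)\<^sup>2) + (1 / \<epsilon>) * integral {a..b} (\<lambda>x. W (u x t))))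
     has_real_derivative - Y t / \<epsilon>) (at t within {0..})" by simp
  then show ?thesis
    by (rule has_field_derivative_transform_within[where d = 1]) (use t pot_split in \<open>auto simp: En_def\<close>)
qed

lemma pot_nonneg: "t \<ge> 0 \<Longrightarrow> \<epsilon> / 2 * integral {a..b} (\<lambda>x. (ux x t)\<^sup>2) \<le> pot t"
proof -
  assume t: "t \<ge> 0"
  have "0 \<le> integral {a..b} (\<lambda>x. W (u x t))"
    by (intro integral_nonneg integrable_continuous_real slices t W_nonneg)
  then show ?thesis using pot_split[OF t] \<epsilon> by simp
qed

lemma Y_nonneg: "t \<ge> 0 \<Longrightarrow> Y t \<ge> 0"
  unfolding Y_def by (intro integral_nonneg integrable_continuous_real continuous_intros bar_slices) auto

lemma gradient_nonneg: "t \<ge> 0 \<Longrightarrow> integral {a..b} (\<lambda>x. (ux x t)\<^sup>2) \<ge> 0"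
  by (intro integral_nonneg integrable_continuous_real continuous_intros slices) auto

lemma En_bounds:
  assumes t: "t \<ge> 0"
  shows "Y t \<le> 2 * \<epsilon> / \<tau> * En t" "integral {a..b} (\<lambda>x. (ux x t)\<^sup>2) \<le> 2 / \<epsilon> * En t" "pot t \<le> En t"
proof -
  have "0 \<le> \<tau> / (2 * \<epsilon>) * Y t" using Y_nonneg[OF t] \<tau> \<epsilon> by simp
  then show "pot t \<le> En t" by (simp add: En_def)
  have "0 \<le> \<epsilon> / 2 * integral {a..b} (\<lambda>x. (ux x t)\<^sup>2)" using gradient_nonneg[OF t] \<epsilon> by simp
  then have 1: "\<tau> / (2 * \<epsilon>) * Y t \<le> En t" using pot_nonneg[OF t] by (simp add: En_def)
  have "Y t = 2 * \<epsilon> / \<tau> * (\<tau> / (2 * \<epsilon>) * Y t)" using \<tau> \<epsilon> by simp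
  also have "\<dots> \<le> 2 * \<epsilon> / \<tau> * En t" using 1 \<tau> \<epsilon> by (intro mult_left_mono) auto
  finally show "Y t \<le> 2 * \<epsilon> / \<tau> * En t" .
  have "\<epsilon> / 2 * integral {a..b} (\<lambda>x. (ux x t)\<^sup>2) \<le> En t"
    using pot_nonneg[OF t] \<open>pot t \<le> En t\<close> by simp
  then have "2 / \<epsilon> * (\<epsilon> / 2 * integral {a..b} (\<lambda>x. (ux x t)\<^sup>2)) \<le> 2 / \<epsilon> * En t"
    using \<epsilon> by (intro mult_left_mono) auto
  then show "integral {a..b} (\<lambda>x. (ux x t)\<^sup>2) \<le> 2 / \<epsilon> * En t" using \<epsilon> by simp
qed

lemma deriv_at_interior:
  "t > 0 \<Longrightarrow> (g has_real_derivative g') (at t within {0..}) \<Longrightarrow> (g has_real_derivative g') (at t)"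
  using at_within_interior[of t "{0..}"] by simp

lemma En_cont: "continuous_on {0..} En"
  by (rule DERIV_continuous_on, rule En_deriv) simp

lemma En_antimono:
  assumes "0 \<le> s" "s \<le> t" shows "En t \<le> En s"
proof (rule DERIV_nonpos_imp_decreasing_open[OF assms(2)])
  fix x assume "s < x" "x < t"
  then have x: "x > 0" using assms by simp
  then have "(En has_real_derivative - Y x / \<epsilon>) (at x)" using En_deriv deriv_at_interior by simp
  moreover have "- Y x / \<epsilon> \<le> 0" using Y_nonneg[of x] x \<epsilon> by simp
  ultimately show "\<exists>y. (En has_real_derivative y) (at x) \<and> y \<le> 0" by blast
qed (use assms in \<open>auto intro!: continuous_on_subset[OF En_cont]\<close>)

section \<open>Displacement of the transform and energy loss\<close>

definition disp :: "real \<Rightarrow> real" where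
  "disp t = integral {a..b} (\<lambda>x. (bar a b (\<lambda>x. u x t) x - bar a b (\<lambda>x. u x 0) x)\<^sup>2)"

lemma disp_deriv:
  assumes t: "t \<ge> 0"
  shows "(disp has_real_derivative
     2 * integral {a..b} (\<lambda>x. bar a b (\<lambda>x. ut x t) x * (bar a b (\<lambda>x. u x t) x - bar a b (\<lambda>x. u x 0) x)))
     (at t within {0..})"
proof -
  let ?F = "at t within {0..}"
  let ?y = "\<lambda>s. bar a b (\<lambda>x. ut x s)" and ?U = "\<lambda>s. bar a b (\<lambda>x. u x s)"
  define d where "d s x = ?U s x - ?U 0 x" for s x
  have dc: "s \<ge> 0 \<Longrightarrow> continuous_on {a..b} (d s)" for s
    unfolding d_def by (intro continuous_intros bar_slices) auto
  have evU: "\<forall>\<^sub>F s in ?F. continuous_on {a..b} (\<lambda>x. (?U s x - ?U t x) / (s - t))"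
    and evd: "\<forall>\<^sub>F s in ?F. continuous_on {a..b} (\<lambda>x. d s x + d t x)"
    using eventually_at_atLeast by (eventually_elim, use t in \<open>auto intro!: continuous_intros dc bar_slices\<close>)+
  have "uniform_limit {a..b} (\<lambda>s x. d s x + d t x) (\<lambda>x. d t x + d t x) ?F"
    unfolding d_def by (intro uniform_limit_add uniform_limit_minus bar_limit[OF t u_jc] uniform_limit_const)
  from integral_product_limit[OF t bar_quotient_limit[OF t] this evU evd]
  have lim: "((\<lambda>s. integral {a..b} (\<lambda>x. (?U s x - ?U t x) / (s - t) * (d s x + d t x)))
     \<longlongrightarrow> integral {a..b} (\<lambda>x. ?y t x * (d t x + d t x))) ?F" .
  also have "integral {a..b} (\<lambda>x. ?y t x * (d t x + d t x)) = 2 * integral {a..b} (\<lambda>x. ?y t x * d t x)"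
    by (subst integral_mult_right[symmetric]) (simp add: algebra_simps)
  finally have lim: "((\<lambda>s. integral {a..b} (\<lambda>x. (?U s x - ?U t x) / (s - t) * (d s x + d t x)))
     \<longlongrightarrow> 2 * integral {a..b} (\<lambda>x. ?y t x * d t x)) ?F" .
  have "\<forall>\<^sub>F s in ?F. integral {a..b} (\<lambda>x. (?U s x - ?U t x) / (s - t) * (d s x + d t x)) = (disp s - disp t) / (s - t)"
    using eventually_at_atLeast
  proof eventually_elim
    case (elim s)
    then have s: "s \<ge> 0" "s \<noteq> t" by auto
    have "disp s - disp t = integral {a..b} (\<lambda>x. (d s x)\<^sup>2 - (d t x)\<^sup>2)"
      unfolding disp_def d_def[symmetric]
      by (intro hk_integral_diff[symmetric] integrable_continuous_real continuous_intros dc s t)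
    also have "\<dots> = integral {a..b} (\<lambda>x. (?U s x - ?U t x) * (d s x + d t x))"
      by (rule hk_integral_cong) (simp add: d_def power2_eq_square algebra_simps)
    finally have "disp s - disp t = integral {a..b} (\<lambda>x. (?U s x - ?U t x) * (d s x + d t x))" .
    moreover have "integral {a..b} (\<lambda>x. (?U s x - ?U t x) / (s - t) * (d s x + d t x))
        = integral {a..b} (\<lambda>x. (?U s x - ?U t x) * (d s x + d t x)) / (s - t)"
      by (subst integral_divide[symmetric]) simp
    ultimately show ?case by (simp only:)
  qed
  with lim show ?thesis
    unfolding has_field_derivative_iff d_def[symmetric] by (rule Lim_transform_eventually)
qed

lemma disp_0: "disp 0 = 0"
  by (simp add: disp_def)

text \<open>This is the Cauchy-Schwarz inequality in time, in differential form. Since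
  \<open>\<epsilon>\<close> times the energy loss has derivative \<open>Y\<close>, the function
  \<open>\<phi>\<close> compares \<open>disp s / s\<close> with the time integral of
  \<open>Y\<close>. By the inequality \<open>I\<close>, with weights \<open>1 / s\<close> and
  \<open>s\<close>, it does not increase, and its limit at 0 is 0.\<close>

lemma disp_bound:
  assumes t: "t > 0"
  shows "disp t \<le> t * (\<epsilon> * (En 0 - En t))"
proof -
  let ?y = "\<lambda>s. bar a b (\<lambda>x. ut x s)" and ?U = "\<lambda>s. bar a b (\<lambda>x. u x s)"
  define I where "I s = integral {a..b} (\<lambda>x. ?y s x * (?U s x - ?U 0 x))" for s
  define \<phi> where "\<phi> s = disp s / s - \<epsilon> * (En 0 - En s)" for s
  have I: "2 * I s \<le> disp s / s + s * Y s" if s: "s > 0" for s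
  proof -
    have "((\<lambda>x. (1 / s) * (?U s x - ?U 0 x)\<^sup>2 + s * (?y s x)\<^sup>2 - 2 * (?y s x * (?U s x - ?U 0 x))) has_integral
        (1 / s) * disp s + s * Y s - 2 * I s) {a..b}"
      unfolding disp_def Y_def I_def using s
      by (intro linear_integral_intros bar_slices) auto
    moreover have "0 \<le> (1 / s) * (?U s x - ?U 0 x)\<^sup>2 + s * (?y s x)\<^sup>2 - 2 * (?y s x * (?U s x - ?U 0 x))" for x
    proof -
      have "(1 / s) * (?U s x - ?U 0 x)\<^sup>2 + s * (?y s x)\<^sup>2 - 2 * (?y s x * (?U s x - ?U 0 x))
        = (1 / s) * ((?U s x - ?U 0 x) - s * ?y s x)\<^sup>2"
        using s by (simp add: field_simps power2_eq_square)
      then show ?thesis using s by simp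
    qed
    ultimately have "0 \<le> (1 / s) * disp s + s * Y s - 2 * I s" by (rule has_integral_nonneg)
    then show ?thesis by simp
  qed
  have D\<phi>: "(\<phi> has_real_derivative (2 * I s * s - disp s * 1) / (s * s) - \<epsilon> * (0 - - Y s / \<epsilon>)) (at s)" if s: "s > 0" for s
    unfolding \<phi>_def
    by (intro DERIV_diff DERIV_cmult DERIV_divide DERIV_ident DERIV_const)
      (use s deriv_at_interior[OF s disp_deriv] deriv_at_interior[OF s En_deriv] in \<open>auto simp: I_def\<close>)
  have neg: "(2 * I s * s - disp s * 1) / (s * s) - \<epsilon> * (0 - - Y s / \<epsilon>) \<le> 0" if s: "s > 0" for s
  proof -
    have "(disp s / s + s * Y s) * s = disp s + Y s * (s * s)" using s by (simp add: distrib_right)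
    then have "2 * I s * s - disp s \<le> Y s * (s * s)"
      using mult_right_mono[OF I[OF s], of s] s by linarith
    then have "(2 * I s * s - disp s) / (s * s) \<le> Y s" using s by (simp add: pos_divide_le_eq)
    then show ?thesis using \<epsilon> by simp
  qed
  have mono: "\<phi> t \<le> \<phi> s" if s: "0 < s" "s \<le> t" for s
  proof (rule DERIV_nonpos_imp_nonincreasing[OF s(2)])
    fix x assume "s \<le> x" "x \<le> t"
    then have "x > 0" using s by simp
    then show "\<exists>y. (\<phi> has_real_derivative y) (at x) \<and> y \<le> 0" using D\<phi> neg by blast
  qed
  have sub: "at_right 0 \<le> at (0::real) within {0..}" by (rule at_le) auto
  \<comment> \<open>The derivative of \<open>disp\<close> at time 0 contains the factor
    \<open>?U 0 x - ?U 0 x\<close>, so the quotient \<open>disp s / s\<close> tends to 0.\<close>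
  have "((\<lambda>s. (disp s - disp 0) / (s - 0)) \<longlongrightarrow> 2 * I 0) (at 0 within {0..})"
    using disp_deriv[of 0] unfolding has_field_derivative_iff I_def by simp
  then have "((\<lambda>s. disp s / s) \<longlongrightarrow> 0) (at_right 0)"
    using tendsto_mono[OF sub] by (simp add: disp_0 I_def)
  moreover have "(En \<longlongrightarrow> En 0) (at_right 0)"
    using En_cont tendsto_mono[OF sub] by (auto simp: continuous_on_def)
  ultimately have "(\<phi> \<longlongrightarrow> 0 - \<epsilon> * (En 0 - En 0)) (at_right 0)"
    unfolding \<phi>_def by (intro tendsto_intros)
  moreover have "\<forall>\<^sub>F s in at_right 0. \<phi> t \<le> \<phi> s"
    unfolding eventually_at_right_field using t mono by (intro exI[of _ t]) auto
  ultimately have "\<phi> t \<le> 0"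
    by (intro tendsto_lowerbound[of \<phi> _ "at_right 0"]) auto
  then show ?thesis using t by (simp add: \<phi>_def field_simps)
qed

text \<open>The dissipation rate \<open>Y\<close> is itself controlled by the kinetic part of the
  energy, so the energy loss is bounded through the initial energy alone. The resulting bound on the
  displacement is quadratic in time and serves the regime \<open>F < 1\<close>.\<close>

lemma dissipation_bound:
  assumes t: "t > 0"
  shows "\<epsilon> * (En 0 - En t) \<le> t * (2 * \<epsilon> / \<tau> * En 0)"
proof -
  have "continuous_on {0..t} En" using En_cont by (rule continuous_on_subset) auto
  then obtain z where z: "0 < z" "z < t" "En t - En 0 = (- Y z / \<epsilon>) * (t - 0)"
  proof -
    have "(En has_derivative (*) (- Y z / \<epsilon>)) (at z)" if "0 < z" "z < t" for z
      using deriv_at_interior[OF that(1) En_deriv[OF less_imp_le[OF that(1)]]]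
      unfolding has_field_derivative_def .
    from mvt[OF t \<open>continuous_on {0..t} En\<close> this] show ?thesis using that by auto
  qed
  have "\<epsilon> * (En 0 - En t) = t * Y z" using z \<epsilon> by (simp add: field_simps)
  moreover have "t * Y z \<le> t * (2 * \<epsilon> / \<tau> * En 0)"
  proof -
    have "Y z \<le> 2 * \<epsilon> / \<tau> * En z" using En_bounds(1) z by simp
    also have "\<dots> \<le> 2 * \<epsilon> / \<tau> * En 0" using En_antimono[of 0 z] z \<tau> \<epsilon> by (intro mult_left_mono) auto
    finally show ?thesis using t by (intro mult_left_mono) auto
  qed
  ultimately show ?thesis by (simp only:)
qed

lemma disp_nonneg: "t \<ge> 0 \<Longrightarrow> disp t \<ge> 0"
  unfolding disp_def by (intro integral_nonneg integrable_continuous_real continuous_intros bar_slices) auto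

text \<open>The difference \<open>u x t - u x 0\<close> vanishes at both ends and is the derivative
  of its transform, so its square integral pairs its space derivative with the transform. The 8 is
  twice the sum of two gradient bounds \<open>2 / \<epsilon> * En 0\<close>.\<close>

lemma L2_interpolation:
  assumes t: "t \<ge> 0"
  shows "(integral {a..b} (\<lambda>x. (u x t - u x 0)\<^sup>2))\<^sup>2 \<le> 8 / \<epsilon> * En 0 * disp t"
proof -
  define d where "d x = u x t - u x 0" for x
  define d' where "d' x = ux x t - ux x 0" for x
  have dc: "continuous_on {a..b} d" "continuous_on {a..b} d'"
    unfolding d_def d'_def by (intro continuous_intros slices t order_refl)+
  have "integral {a..b} (\<lambda>x. d x * d x) = - integral {a..b} (\<lambda>x. d' x * bar a b d x)"
    by (subst integration_by_parts_real[where f = d' and G = "bar a b d"])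
      (use ab t bc dc in \<open>auto intro!: bar_deriv DERIV_diff Dx simp: d_def[abs_def] d'_def\<close>)
  then have "(integral {a..b} (\<lambda>x. (d x)\<^sup>2))\<^sup>2 = (integral {a..b} (\<lambda>x. d' x * bar a b d x))\<^sup>2"
    by (simp add: power2_eq_square)
  also have "\<dots> \<le> integral {a..b} (\<lambda>x. (d' x)\<^sup>2) * integral {a..b} (\<lambda>x. (bar a b d x)\<^sup>2)"
    by (intro integral_Cauchy_Schwarz dc bar_cont)
  also have "integral {a..b} (\<lambda>x. (bar a b d x)\<^sup>2) = disp t"
    unfolding disp_def
  proof (rule hk_integral_cong)
    fix x assume "x \<in> {a..b}"
    then have "bar a b d x = bar a b (\<lambda>x. u x t) x - bar a b (\<lambda>x. u x 0) x"
      unfolding d_def by (intro bar_minus integrable_continuous_real slices t order_refl)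
    then show "(bar a b d x)\<^sup>2 = (bar a b (\<lambda>x. u x t) x - bar a b (\<lambda>x. u x 0) x)\<^sup>2" by simp
  qed
  also have "integral {a..b} (\<lambda>x. (d' x)\<^sup>2) * disp t \<le> 8 / \<epsilon> * En 0 * disp t"
  proof (rule mult_right_mono)
    have "integral {a..b} (\<lambda>x. (d' x)\<^sup>2) \<le> integral {a..b} (\<lambda>x. 2 * (ux x t)\<^sup>2 + 2 * (ux x 0)\<^sup>2)"
    proof (rule integral_le)
      fix x
      have "0 \<le> (ux x t + ux x 0)\<^sup>2" by simp
      then show "(d' x)\<^sup>2 \<le> 2 * (ux x t)\<^sup>2 + 2 * (ux x 0)\<^sup>2"
        by (simp add: d'_def power2_eq_square algebra_simps)
    qed (use dc t in \<open>auto intro!: integrable_continuous_real continuous_intros slices\<close>)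
    also have "\<dots> = 2 * integral {a..b} (\<lambda>x. (ux x t)\<^sup>2) + 2 * integral {a..b} (\<lambda>x. (ux x 0)\<^sup>2)"
      by (rule integral_unique) (intro linear_integral_intros slices t order_refl)
    also have "\<dots> \<le> 2 * (2 / \<epsilon> * En 0) + 2 * (2 / \<epsilon> * En 0)"
    proof -
      have "2 / \<epsilon> * En t \<le> 2 / \<epsilon> * En 0" using En_antimono[of 0 t] t \<epsilon> by (intro mult_left_mono) auto
      then show ?thesis using En_bounds(2)[OF t] En_bounds(2)[of 0] by linarith
    qed
    finally show "integral {a..b} (\<lambda>x. (d' x)\<^sup>2) \<le> 8 / \<epsilon> * En 0" by simp
  qed (rule disp_nonneg[OF t])
  finally show ?thesis by (simp add: d_def)
qed

section \<open>Slow motion by continuation in time\<close>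

lemma disp_cont: "continuous_on {0..} disp"
  by (rule DERIV_continuous_on, rule disp_deriv) simp

text \<open>The lower bound for the energy at time \<open>s\<close> needs closeness to
  \<open>bar v\<close> at this time only, and it then forces
  \<open>disp s \<le> \<epsilon> * (1 + C)\<close>. So the displacement takes no value between this
  bound and the larger one allowed by \<open>\<delta>\<close>; \<open>small\<close> says that this
  gap is not empty. Being continuous and 0 at the start, the displacement cannot cross it.\<close>

lemma slow_motion:
  assumes v: "v integrable_on {a..b}" and \<delta>: "\<delta> > 0" and C: "C \<ge> 0" and F: "F > 0" and e: "e \<ge> 0"
    and lower: "\<And>t. t \<ge> 0 \<Longrightarrow> L1_dist a b (bar a b (\<lambda>x. u x t)) (bar a b v) \<le> \<delta> \<Longrightarrow> K - C * e \<le> pot t"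
    and init: "L1_dist a b (bar a b (\<lambda>x. u x 0)) (bar a b v) \<le> \<delta> / 2"
    and E0: "En 0 \<le> K + 1 / F"
    and small: "(b - a) * (\<epsilon> * (1 + C)) < (\<delta> / 2)\<^sup>2"
    and T: "T \<le> F" "T * e \<le> 1" and t: "t \<in> {0..T}"
  shows "disp t \<le> t * (\<epsilon> * (1 / F + C * e))" "disp t \<le> \<epsilon> * (1 + C)"
    "L1_dist a b (bar a b (\<lambda>x. u x t)) (bar a b v) \<le> L1_dist a b (bar a b (\<lambda>x. u x 0)) (bar a b v) + sqrt ((b - a) * disp t)"
proof -
  let ?U = "\<lambda>s. bar a b (\<lambda>x. u x s)"
  have Uc: "continuous_on {a..b} (?U s)" if "s \<ge> 0" for s by (rule bar_slices(1)[OF that])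
  have vc: "continuous_on {a..b} (bar a b v)" by (rule bar_continuous[OF v])
  have dist: "L1_dist a b (?U s) (bar a b v) \<le> L1_dist a b (?U 0) (bar a b v) + sqrt ((b - a) * disp s)" if s: "s \<ge> 0" for s
  proof -
    have "(integral {a..b} (\<lambda>x. \<bar>?U s x - ?U 0 x\<bar>))\<^sup>2 \<le> (b - a) * disp s"
      unfolding disp_def using ab s by (intro integral_abs_square_le continuous_intros Uc) auto
    then have 1: "integral {a..b} (\<lambda>x. \<bar>?U s x - ?U 0 x\<bar>) \<le> sqrt ((b - a) * disp s)" by (rule real_le_rsqrt)
    have "L1_dist a b (?U s) (bar a b v) \<le> integral {a..b} (\<lambda>x. \<bar>?U 0 x - bar a b v x\<bar> + \<bar>?U s x - ?U 0 x\<bar>)"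
      unfolding L1_dist_def
      by (rule integral_le) (use s Uc vc in \<open>auto intro!: integrable_continuous_real continuous_intros\<close>)
    also have "\<dots> = L1_dist a b (?U 0) (bar a b v) + integral {a..b} (\<lambda>x. \<bar>?U s x - ?U 0 x\<bar>)"
      unfolding L1_dist_def
      by (intro hk_integral_add integrable_continuous_real continuous_intros Uc vc s order_refl)
    finally show ?thesis using 1 by simp
  qed
  have near: "disp s \<le> s * (\<epsilon> * (1 / F + C * e))" if s: "0 \<le> s" and d: "(b - a) * disp s \<le> (\<delta> / 2)\<^sup>2" for s
  proof (cases "s = 0")
    case False
    then have sp: "s > 0" using s by simp
    have "sqrt ((b - a) * disp s) \<le> \<delta> / 2" using real_sqrt_le_mono[OF d] \<delta> by simp
    then have "K - C * e \<le> pot s" using dist[OF s] init by (intro lower s) linarith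
    then have "En 0 - En s \<le> 1 / F + C * e" using En_bounds(3)[OF s] E0 by linarith
    then have "s * (\<epsilon> * (En 0 - En s)) \<le> s * (\<epsilon> * (1 / F + C * e))"
      using sp \<epsilon> by (intro mult_left_mono) auto
    then show ?thesis using disp_bound[OF sp] by linarith
  qed (simp add: disp_0)
  have upper: "s * (\<epsilon> * (1 / F + C * e)) \<le> \<epsilon> * (1 + C)" if "s \<in> {0..T}" for s
  proof -
    have "s / F \<le> 1" using that T F by simp
    moreover have "s * e \<le> 1" using that T e mult_right_mono[of s T e] by simp
    then have "C * (s * e) \<le> C" using C mult_left_le by blast
    ultimately have "s / F + C * (s * e) \<le> 1 + C" by simp
    then have "\<epsilon> * (s / F + C * (s * e)) \<le> \<epsilon> * (1 + C)" using \<epsilon> by simp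
    then show ?thesis by (simp add: algebra_simps)
  qed
  have t0: "0 \<le> t" using t by simp
  have main: "disp t \<le> \<epsilon> * (1 + C)"
  proof (rule ccontr)
    assume "\<not> ?thesis"
    then have gt: "disp t > \<epsilon> * (1 + C)" by simp
    \<comment> \<open>A value inside the forbidden gap that the displacement attains before or at
      time \<open>t\<close>.\<close>
    define D where "D = min (disp t) ((\<delta> / 2)\<^sup>2 / (b - a))"
    have D: "D > \<epsilon> * (1 + C)" "D \<le> disp t" "(b - a) * D \<le> (\<delta> / 2)\<^sup>2"
    proof -
      have "\<epsilon> * (1 + C) < (\<delta> / 2)\<^sup>2 / (b - a)" using small ab by (simp add: pos_less_divide_eq mult.commute)
      then show "D > \<epsilon> * (1 + C)" using gt by (simp add: D_def)
      show "D \<le> disp t" by (simp add: D_def)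
      have "(b - a) * D \<le> (b - a) * ((\<delta> / 2)\<^sup>2 / (b - a))" using ab by (intro mult_left_mono) (auto simp: D_def)
      then show "(b - a) * D \<le> (\<delta> / 2)\<^sup>2" using ab by simp
    qed
    have "0 \<le> \<epsilon> * (1 + C)" using \<epsilon> C by simp
    then have "disp 0 \<le> D" using D disp_0 by simp
    then obtain s where s: "0 \<le> s" "s \<le> t" "disp s = D"
      using IVT'[of disp 0 D t] D t0 continuous_on_subset[OF disp_cont, of "{0..t}"] by auto
    have "disp s \<le> \<epsilon> * (1 + C)" using near[of s] upper[of s] s D t by force
    then show False using s D by simp
  qed
  then show "disp t \<le> \<epsilon> * (1 + C)" .
  have "(b - a) * disp t \<le> (b - a) * (\<epsilon> * (1 + C))" using main ab by (intro mult_left_mono) auto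
  then show "disp t \<le> t * (\<epsilon> * (1 / F + C * e))" using near[OF t0] small by linarith
  show "L1_dist a b (?U t) (bar a b v) \<le> L1_dist a b (?U 0) (bar a b v) + sqrt ((b - a) * disp t)"
    by (rule dist[OF t0])
qed

text \<open>The two regimes \<open>F \<ge> 1\<close> and \<open>F < 1\<close> are needed because the initial energy, of order \<open>1 / F\<close>, is not
  assumed to be bounded.\<close>
lemma energy_times_displacement:
  assumes C: "C \<ge> 0" and F: "F > 0" and e: "e \<ge> 0" and K: "K \<ge> 0" and E0: "En 0 \<le> K + 1 / F"
    and T: "T \<le> F" "T * e \<le> 1" and p: "0 \<le> p" and t: "0 \<le> t" "t \<le> p * T"
    and disp: "disp t \<le> t * (\<epsilon> * (1 / F + C * e))"
  shows "8 / \<epsilon> * En 0 * disp t \<le> 8 * (K + 1) * (1 + C) * p + 16 / \<tau> * (K + 1)\<^sup>2 * p\<^sup>2"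
proof -
  have En0: "En 0 \<ge> 0"
    using En_bounds(3)[of 0] pot_nonneg[of 0] gradient_nonneg[of 0] \<epsilon> by (smt (verit) divide_nonneg_pos mult_nonneg_nonneg)
  have nn: "0 \<le> 8 * (K + 1) * (1 + C) * p" "0 \<le> 16 / \<tau> * (K + 1)\<^sup>2 * p\<^sup>2"
    using C K p \<tau> by auto
  show ?thesis
  proof (cases "F \<ge> 1")
    case True
    have "En 0 \<le> K + 1" using E0 True F by (smt (verit) divide_le_eq_1)
    have Tp: "t * (1 / F + C * e) \<le> p * (1 + C)"
    proof -
      have "t * (1 / F + C * e) \<le> p * T * (1 / F + C * e)" using t F C e by (intro mult_right_mono) auto
      also have "\<dots> = p * (T / F + C * (T * e))" by (simp add: algebra_simps)
      also have "\<dots> \<le> p * (1 + C)"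
      proof (rule mult_left_mono[OF _ p])
        have "T / F \<le> 1" using T F by simp
        moreover have "C * (T * e) \<le> C" using T C mult_left_le by blast
        ultimately show "T / F + C * (T * e) \<le> 1 + C" by simp
      qed
      finally show ?thesis .
    qed
    have "disp t \<le> \<epsilon> * (t * (1 / F + C * e))" using disp by (simp add: algebra_simps)
    also have "\<dots> \<le> \<epsilon> * (p * (1 + C))" using Tp \<epsilon> by simp
    finally have "8 / \<epsilon> * En 0 * disp t \<le> 8 / \<epsilon> * (K + 1) * (\<epsilon> * (p * (1 + C)))"
      using \<open>En 0 \<le> K + 1\<close> En0 \<epsilon> K disp_nonneg[OF t(1)]
      by (intro mult_mono mult_left_mono) auto
    also have "\<dots> = 8 * (K + 1) * (1 + C) * p" using \<epsilon> by (simp add: field_simps)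
    finally show ?thesis using nn by linarith
  next
    case False
    have E: "En 0 * F \<le> K + 1"
    proof -
      have "En 0 * F \<le> (K + 1 / F) * F" using E0 F by (intro mult_right_mono) auto
      also have "\<dots> = K * F + 1" using F by (simp add: distrib_right)
      also have "\<dots> \<le> K * 1 + 1" using K False by (intro add_right_mono mult_left_mono) auto
      finally show ?thesis by simp
    qed
    have tE: "t * En 0 \<le> p * (K + 1)"
    proof -
      have "t * En 0 \<le> p * T * En 0" using t En0 by (intro mult_right_mono) auto
      also have "\<dots> \<le> p * F * En 0" using T p En0 by (intro mult_right_mono mult_left_mono) auto
      also have "\<dots> = p * (En 0 * F)" by simp
      also have "\<dots> \<le> p * (K + 1)" using E p by (rule mult_left_mono)
      finally show ?thesis .
    qed
    \<comment> \<open>The bound quadratic in \<open>t\<close> combines with the factor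
      \<open>En 0\<close> in front into \<open>(t * En 0)\<^sup>2\<close>, and \<open>tE\<close>
      controls \<open>t * En 0\<close> even when \<open>En 0\<close> is large.\<close>
    have "disp t \<le> t * (t * (2 * \<epsilon> / \<tau> * En 0))"
    proof (cases "t = 0")
      case False
      then have tp: "t > 0" using t by simp
      have "t * (\<epsilon> * (En 0 - En t)) \<le> t * (t * (2 * \<epsilon> / \<tau> * En 0))"
        using dissipation_bound[OF tp] tp by (intro mult_left_mono) auto
      then show ?thesis using disp_bound[OF tp] by linarith
    qed (simp add: disp_0)
    then have "8 / \<epsilon> * En 0 * disp t \<le> 8 / \<epsilon> * En 0 * (t * (t * (2 * \<epsilon> / \<tau> * En 0)))"
      using En0 \<epsilon> by (intro mult_left_mono) auto
    also have "\<dots> = 16 / \<tau> * (t * En 0)\<^sup>2" using \<epsilon> by (simp add: power2_eq_square)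
    also have "\<dots> \<le> 16 / \<tau> * (p * (K + 1))\<^sup>2"
      using tE t En0 \<tau> by (intro mult_left_mono power_mono) auto
    also have "\<dots> = 16 / \<tau> * (K + 1)\<^sup>2 * p\<^sup>2" by (simp add: power_mult_distrib)
    finally show ?thesis using nn by linarith
  qed
qed

lemma L1_displacement:
  assumes t: "t \<ge> 0"
  shows "integral {a..b} (\<lambda>x. \<bar>u x t - u x 0\<bar>) \<le> sqrt ((b - a) * sqrt (8 / \<epsilon> * En 0 * disp t))"
proof -
  have "(integral {a..b} (\<lambda>x. \<bar>u x t - u x 0\<bar>))\<^sup>2 \<le> (b - a) * integral {a..b} (\<lambda>x. (u x t - u x 0)\<^sup>2)"
    using ab t by (intro integral_abs_square_le continuous_intros slices) auto
  also have "\<dots> \<le> (b - a) * sqrt (8 / \<epsilon> * En 0 * disp t)"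
    using ab L2_interpolation[OF t] by (intro mult_left_mono real_le_rsqrt) auto
  finally show ?thesis by (rule real_le_rsqrt)
qed

end

section \<open>From weak solutions to regular flows\<close>

lemma weak_derivD:
  "weak_deriv_on a b g g' \<Longrightarrow> x \<in> {a..b} \<Longrightarrow> g a + integral {a..x} g' = g x"
  unfolding weak_deriv_on_def by (metis (no_types, lifting))

lemma weak_deriv_cont:
  assumes g: "weak_deriv_on a b g g'"
  shows "continuous_on {a..b} g"
proof -
  have "g' integrable_on {a..b}" using g by (simp only: weak_deriv_on_def)
  from indefinite_integral_continuous_1[OF this]
  have "continuous_on {a..b} (\<lambda>x. g a + integral {a..x} g')"
    by (intro continuous_on_add continuous_on_const)
  then show ?thesis
    by (rule continuous_on_eq) (rule weak_derivD[OF g])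
qed

lemma weak_deriv_DERIV:
  assumes g: "weak_deriv_on a b g g'" and g': "continuous_on {a..b} g'" and x: "x \<in> {a..b}"
  shows "(g has_real_derivative g' x) (at x within {a..b})"
proof -
  have "((\<lambda>x. g a + integral {a..x} g') has_real_derivative g' x) (at x within {a..b})"
    using DERIV_add[OF DERIV_const integral_has_real_derivative[OF g' x]] by simp
  then show ?thesis
    by (rule has_field_derivative_transform_within[where d = 1])
      (use x weak_derivD[OF g] in auto)
qed

lemma L2_diff_square_integrable:
  assumes "L2_on a b f" "L2_on a b g"
  shows "(\<lambda>x. (f x - g x)\<^sup>2) integrable_on {a..b}"
proof (rule measurable_bounded_by_integrable_imp_integrable)
  have S: "{a..b} \<in> sets lebesgue" by simp
  have "f \<in> borel_measurable (lebesgue_on {a..b})" "g \<in> borel_measurable (lebesgue_on {a..b})"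
    using assms measurable_on_iff_borel_measurable[OF S] unfolding L2_on_def by auto
  then show "(\<lambda>x. (f x - g x)\<^sup>2) \<in> borel_measurable (lebesgue_on {a..b})" by measurable
  show "(\<lambda>x. 2 * (f x)\<^sup>2 + 2 * (g x)\<^sup>2) integrable_on {a..b}"
    using assms unfolding L2_on_def by (intro integrable_add integrable_on_mult_right) auto
  fix x
  have "0 \<le> (f x + g x)\<^sup>2" by simp
  then have "(f x - g x)\<^sup>2 \<le> 2 * (f x)\<^sup>2 + 2 * (g x)\<^sup>2"
    by (simp add: power2_eq_square algebra_simps)
  then show "norm ((f x - g x)\<^sup>2) \<le> 2 * (f x)\<^sup>2 + 2 * (g x)\<^sup>2" by simp
qed simp

text \<open>The one-dimensional Sobolev embedding: as the value at \<open>a\<close> is constant in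
  time, \<open>g y s - g y t\<close> is the integral of the difference of the derivatives. The
  pointwise bound \<open>\<bar>z\<bar> \<le> \<eta> + z\<^sup>2 / \<eta>\<close> takes the place of
  Cauchy-Schwarz; \<open>\<eta>\<close> is chosen so that its own contribution is
  \<open>e / 4\<close>, and then \<open>s\<close> is taken close to \<open>t\<close>.\<close>

lemma jcont_from_L2:
  fixes g g' :: "real \<Rightarrow> real \<Rightarrow> real"
  assumes ab: "a < b" and w: "\<And>t. t \<ge> 0 \<Longrightarrow> weak_deriv_on a b (\<lambda>x. g x t) (\<lambda>x. g' x t)"
    and bc: "\<And>t. t \<ge> 0 \<Longrightarrow> g a t = c"
    and int: "\<And>s t. s \<ge> 0 \<Longrightarrow> t \<ge> 0 \<Longrightarrow> (\<lambda>x. (g' x s - g' x t)\<^sup>2) integrable_on {a..b}"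
    and lim: "\<And>t. t \<ge> 0 \<Longrightarrow> ((\<lambda>s. integral {a..b} (\<lambda>x. (g' x s - g' x t)\<^sup>2)) \<longlongrightarrow> 0) (at t within {0..})"
  shows "jcont a b g"
  unfolding continuous_on_iff
proof (intro ballI allI impI)
  fix p :: "real \<times> real" and e :: real assume p: "p \<in> {0..} \<times> {a..b}" and e: "0 < e"
  obtain t x where tx: "p = (t, x)" "t \<ge> 0" "x \<in> {a..b}" using p by auto
  define \<eta> where "\<eta> = e / (4 * (b - a))"
  have \<eta>: "\<eta> > 0" using e ab by (simp add: \<eta>_def)
  have "e / (4 * c) * c = e / 4" if "c > 0" for c :: real using that by simp
  from this[of "b - a"] have \<eta>': "\<eta> * (b - a) = e / 4" using ab unfolding \<eta>_def by linarith
  have est: "\<bar>g y s - g y t\<bar> \<le> \<eta> * (b - a) + (1 / \<eta>) * integral {a..b} (\<lambda>x. (g' x s - g' x t)\<^sup>2)"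
    if s: "s \<ge> 0" and y: "y \<in> {a..b}" for s y
  proof -
    let ?z = "\<lambda>x. g' x s - g' x t"
    have "(\<lambda>x. g' x s) integrable_on {a..b}" "(\<lambda>x. g' x t) integrable_on {a..b}"
      using w[OF s] w[OF tx(2)] by (simp_all only: weak_deriv_on_def)
    then have gi: "(\<lambda>x. g' x s) integrable_on {a..y}" "(\<lambda>x. g' x t) integrable_on {a..y}"
      using y by (auto elim!: integrable_on_subinterval)
    have zi: "(\<lambda>x. (?z x)\<^sup>2) integrable_on {a..y}"
      using integrable_on_subinterval[OF int[OF s tx(2)], of a y] y by auto
    have "g y s - g y t = integral {a..y} (\<lambda>x. g' x s) - integral {a..y} (\<lambda>x. g' x t)"
      using weak_derivD[OF w[OF s] y] weak_derivD[OF w[OF tx(2)] y] bc[OF s] bc[OF tx(2)] by linarith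
    also have "\<dots> = integral {a..y} ?z"
      using gi by (rule hk_integral_diff[symmetric])
    finally have "\<bar>g y s - g y t\<bar> = norm (integral {a..y} ?z)" by simp
    also have "\<dots> \<le> integral {a..y} (\<lambda>x. \<eta> + (1 / \<eta>) * (?z x)\<^sup>2)"
    proof (rule integral_norm_bound_integral)
      show "?z integrable_on {a..y}" using gi by (rule integrable_diff)
      show "(\<lambda>x. \<eta> + (1 / \<eta>) * (?z x)\<^sup>2) integrable_on {a..y}"
        by (intro integrable_add integrable_on_mult_right zi) auto
      fix x
      have "(\<eta> - \<bar>z\<bar>)\<^sup>2 = \<eta> * (\<eta> + (1 / \<eta>) * z\<^sup>2) - 2 * (\<eta> * \<bar>z\<bar>)" for z :: real
        using \<eta> by (simp add: power2_diff distrib_left power2_eq_square[of \<eta>])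
      from this[of "?z x"] have "2 * (\<eta> * \<bar>?z x\<bar>) \<le> \<eta> * (\<eta> + (1 / \<eta>) * (?z x)\<^sup>2)"
        using zero_le_power2[of "\<eta> - \<bar>?z x\<bar>"] by linarith
      moreover have "0 \<le> \<eta> * \<bar>?z x\<bar>" using \<eta> by simp
      ultimately have "\<eta> * \<bar>?z x\<bar> \<le> \<eta> * (\<eta> + (1 / \<eta>) * (?z x)\<^sup>2)" by linarith
      then show "norm (?z x) \<le> \<eta> + (1 / \<eta>) * (?z x)\<^sup>2" using \<eta> by simp
    qed
    also have "\<dots> = \<eta> * (y - a) + (1 / \<eta>) * integral {a..y} (\<lambda>x. (?z x)\<^sup>2)"
      using y has_integral_add[OF has_integral_const_real[of \<eta> a y] has_integral_mult_right[OF integrable_integral[OF zi], of "1 / \<eta>"]]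
      by (intro integral_unique) (simp add: mult.commute)
    also have "\<dots> \<le> \<eta> * (b - a) + (1 / \<eta>) * integral {a..b} (\<lambda>x. (?z x)\<^sup>2)"
      using y \<eta> zi int[OF s tx(2)]
      by (intro add_mono mult_left_mono integral_subset_le) auto
    finally show ?thesis .
  qed
  have "\<forall>\<^sub>F s in at t within {0..}. integral {a..b} (\<lambda>x. (g' x s - g' x t)\<^sup>2) < \<eta> * (e / 4)"
    by (rule order_tendstoD(2)[OF lim[OF tx(2)]]) (use \<eta> e in auto)
  then obtain d1 where d1: "d1 > 0" "\<And>s. s \<ge> 0 \<Longrightarrow> s \<noteq> t \<Longrightarrow> dist s t < d1 \<Longrightarrow>
      integral {a..b} (\<lambda>x. (g' x s - g' x t)\<^sup>2) < \<eta> * (e / 4)"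
    unfolding eventually_at by auto
  have near: "\<bar>g y s - g y t\<bar> < e / 2" if s: "s \<ge> 0" "dist s t < d1" and y: "y \<in> {a..b}" for s y
  proof (cases "s = t")
    case False
    then have "(1 / \<eta>) * integral {a..b} (\<lambda>x. (g' x s - g' x t)\<^sup>2) < (1 / \<eta>) * (\<eta> * (e / 4))"
      using d1(2) s \<eta> by (intro mult_strict_left_mono) auto
    moreover have "(1 / \<eta>) * (\<eta> * (e / 4)) = e / 4" using \<eta> by simp
    ultimately show ?thesis using est[OF s(1) y] \<eta>' e by linarith
  qed (use e in simp)
  obtain d2 where d2: "d2 > 0" "\<And>y. y \<in> {a..b} \<Longrightarrow> dist y x < d2 \<Longrightarrow> dist (g y t) (g x t) < e / 2"
    using weak_deriv_cont[OF w[OF tx(2)]] tx(3) e unfolding continuous_on_iff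
    by (metis half_gt_zero)
  show "\<exists>d>0. \<forall>q\<in>{0..} \<times> {a..b}. dist q p < d \<longrightarrow>
      dist (case q of (t, x) \<Rightarrow> g x t) (case p of (t, x) \<Rightarrow> g x t) < e"
  proof (intro exI[of _ "min d1 d2"] conjI ballI impI)
    fix q assume q: "q \<in> {0..} \<times> {a..b}" "dist q p < min d1 d2"
    obtain s y where sy: "q = (s, y)" "s \<ge> 0" "y \<in> {a..b}" using q by auto
    have "dist s t < d1" "dist y x < d2"
      using q(2) dist_fst_le[of q p] dist_snd_le[of q p] by (auto simp: sy tx)
    then have "dist (g y s) (g y t) < e / 2" "dist (g y t) (g x t) < e / 2"
      using near[OF sy(2) _ sy(3)] d2(2)[OF sy(3)] by (simp_all add: dist_real_def)
    then have "dist (g y s) (g x t) < e" using dist_triangle_half_l dist_commute by metis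
    then show "dist (case q of (t, x) \<Rightarrow> g x t) (case p of (t, x) \<Rightarrow> g x t) < e"
      by (simp add: sy tx)
  qed (use d1 d2 in auto)
qed

lemma is_solution_flow:
  assumes ab: "a < b" and \<tau>: "\<tau> > 0" and \<epsilon>: "\<epsilon> > 0"
    and DW: "\<And>w. (W has_real_derivative deriv W w) (at w)" and W1: "\<And>w. isCont (deriv W) w"
    and Wn: "\<And>w. W w \<ge> 0" and W1_bc: "deriv W \<alpha> = 0" "deriv W \<beta> = 0"
    and sol: "is_solution a b \<tau> W \<epsilon> \<alpha> \<beta> u ut"
  obtains ux uxx where "flow a b \<tau> \<epsilon> \<alpha> \<beta> W (deriv W) u ut ux uxx"
proof -
  obtain ux uxx uxxx utx where H:
     "(\<forall>t\<ge>0. weak_deriv_on a b (\<lambda>x. u x t) (\<lambda>x. ux x t) \<and>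
            weak_deriv_on a b (\<lambda>x. ux x t) (\<lambda>x. uxx x t) \<and>
            weak_deriv_on a b (\<lambda>x. uxx x t) (\<lambda>x. uxxx x t) \<and>
            L2_on a b (\<lambda>x. uxxx x t) \<and>
            weak_deriv_on a b (\<lambda>x. ut x t) (\<lambda>x. utx x t) \<and>
            L2_on a b (\<lambda>x. utx x t)) \<and>
     (\<forall>t\<ge>0. ((\<lambda>s. integral {a..b} (\<lambda>x.
              (u x s - u x t)\<^sup>2 + (ux x s - ux x t)\<^sup>2 + (uxx x s - uxx x t)\<^sup>2
              + (uxxx x s - uxxx x t)\<^sup>2 + (ut x s - ut x t)\<^sup>2 + (utx x s - utx x t)\<^sup>2))
            \<longlongrightarrow> 0) (at t within {0..})) \<and>
     (\<forall>x\<in>{a..b}. \<forall>t\<ge>0. ((\<lambda>s. u x s) has_real_derivative ut x t) (at t within {0..})) \<and>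
     (\<forall>t\<ge>0. u a t = \<alpha> \<and> u b t = \<beta> \<and> uxx a t = 0 \<and> uxx b t = 0) \<and>
     (\<forall>\<phi>. test_fun a b \<phi> \<longrightarrow>
        integral UNIV (\<lambda>(x, t). \<tau> * u x t * pd [False, False] \<phi> x t - u x t * pd [False] \<phi> x t)
        = integral UNIV (\<lambda>(x, t). (- (\<epsilon>\<^sup>2) * uxx x t + deriv W (u x t)) * pd [True, True] \<phi> x t))"
    using sol unfolding is_solution_def by (elim exE) (rule that)
  note reg = H[THEN conjunct1, rule_format]
    and lim = H[THEN conjunct2, THEN conjunct1, rule_format]
    and Dt = H[THEN conjunct2, THEN conjunct2, THEN conjunct1, rule_format]
    and bc = H[THEN conjunct2, THEN conjunct2, THEN conjunct2, THEN conjunct1, rule_format]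
    and weak = H[THEN conjunct2, THEN conjunct2, THEN conjunct2, THEN conjunct2, rule_format]
  have wu: "weak_deriv_on a b (\<lambda>x. u x t) (\<lambda>x. ux x t)" and wux: "weak_deriv_on a b (\<lambda>x. ux x t) (\<lambda>x. uxx x t)"
    and wuxx: "weak_deriv_on a b (\<lambda>x. uxx x t) (\<lambda>x. uxxx x t)" and wut: "weak_deriv_on a b (\<lambda>x. ut x t) (\<lambda>x. utx x t)"
    and L2: "L2_on a b (\<lambda>x. uxxx x t)" "L2_on a b (\<lambda>x. utx x t)"
    if "t \<ge> 0" for t
    using reg[OF that] by blast+
  have cu: "continuous_on {a..b} (\<lambda>x. u x t)" and cux: "continuous_on {a..b} (\<lambda>x. ux x t)"
    and cuxx: "continuous_on {a..b} (\<lambda>x. uxx x t)" and cut: "continuous_on {a..b} (\<lambda>x. ut x t)"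
    if "t \<ge> 0" for t
    using weak_deriv_cont wu[OF that] wux[OF that] wuxx[OF that] wut[OF that] by blast+
  have ints_cont: "(\<lambda>x. (u x s - u x t)\<^sup>2) integrable_on {a..b}" "(\<lambda>x. (ux x s - ux x t)\<^sup>2) integrable_on {a..b}"
    "(\<lambda>x. (uxx x s - uxx x t)\<^sup>2) integrable_on {a..b}" "(\<lambda>x. (ut x s - ut x t)\<^sup>2) integrable_on {a..b}"
    if "s \<ge> 0" "t \<ge> 0" for s t
    using that by (auto intro!: integrable_continuous_real continuous_intros cu cux cuxx cut)
  have ints_L2: "(\<lambda>x. (uxxx x s - uxxx x t)\<^sup>2) integrable_on {a..b}" "(\<lambda>x. (utx x s - utx x t)\<^sup>2) integrable_on {a..b}"
    if "s \<ge> 0" "t \<ge> 0" for s t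
    by (intro L2_diff_square_integrable L2 that)+
  note ints = ints_cont ints_L2
  let ?S = "\<lambda>s t x. (u x s - u x t)\<^sup>2 + (ux x s - ux x t)\<^sup>2 + (uxx x s - uxx x t)\<^sup>2
              + (uxxx x s - uxxx x t)\<^sup>2 + (ut x s - ut x t)\<^sup>2 + (utx x s - utx x t)\<^sup>2"
  have S: "?S s t integrable_on {a..b}" if "s \<ge> 0" "t \<ge> 0" for s t
    by (intro integrable_add ints that)
  \<comment> \<open>Continuity in time is given for the sum of six squares; each summand is
    dominated by the sum.\<close>
  have part: "((\<lambda>s. integral {a..b} (\<lambda>x. (g x s - g x t)\<^sup>2)) \<longlongrightarrow> 0) (at t within {0..})"
    if t: "t \<ge> 0" and gi: "\<And>s. s \<ge> 0 \<Longrightarrow> (\<lambda>x. (g x s - g x t)\<^sup>2) integrable_on {a..b}"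
      and le: "\<And>s x. (g x s - g x t)\<^sup>2 \<le> ?S s t x" for g :: "real \<Rightarrow> real \<Rightarrow> real" and t
  proof (rule tendsto_sandwich[OF _ _ tendsto_const lim[OF t]])
    show "\<forall>\<^sub>F s in at t within {0..}. 0 \<le> integral {a..b} (\<lambda>x. (g x s - g x t)\<^sup>2)"
      using eventually_at_atLeast by eventually_elim (use gi in \<open>auto intro!: integral_nonneg\<close>)
    show "\<forall>\<^sub>F s in at t within {0..}. integral {a..b} (\<lambda>x. (g x s - g x t)\<^sup>2) \<le> integral {a..b} (?S s t)"
      using eventually_at_atLeast by eventually_elim (use gi S t le in \<open>auto intro!: integral_le\<close>)
  qed
  have ju: "jcont a b u"
    by (rule jcont_from_L2[OF ab wu _ ints_cont(2) part]) (use bc ints in auto)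
  have juxx: "jcont a b uxx"
    by (rule jcont_from_L2[OF ab wuxx _ ints_L2(1) part]) (use bc ints in auto)
  \<comment> \<open>The constant value at \<open>a\<close> that the embedding requires for
    \<open>ut\<close> comes from differentiating the constant boundary value of
    \<open>u\<close>.\<close>
  have "ut a t = 0" if t: "t \<ge> 0" for t
  proof -
    have "((\<lambda>s. \<alpha>) has_real_derivative 0) (at t within {0..})" by simp
    then have "((\<lambda>s. u a s) has_real_derivative 0) (at t within {0..})"
      by (rule has_field_derivative_transform_within[where d = 1]) (use t bc in auto)
    moreover have "((\<lambda>s. u a s) has_real_derivative ut a t) (at t within {0..})"
      using Dt t ab by simp
    ultimately show ?thesis
      unfolding has_field_derivative_iff using tendsto_unique[OF at_within_atLeast_neq_bot[OF t]] by blast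
  qed
  then have jut: "jcont a b ut"
    by (intro jcont_from_L2[OF ab wut _ ints_L2(2) part]) (use ints in auto)
  have "flow a b \<tau> \<epsilon> \<alpha> \<beta> W (deriv W) u ut ux uxx"
  proof
    show "((\<lambda>x. u x t) has_real_derivative ux x t) (at x within {a..b})" if "t \<ge> 0" "x \<in> {a..b}" for x t
      by (rule weak_deriv_DERIV[OF wu cux]) (use that in auto)
    show "((\<lambda>x. ux x t) has_real_derivative uxx x t) (at x within {a..b})" if "t \<ge> 0" "x \<in> {a..b}" for x t
      by (rule weak_deriv_DERIV[OF wux cuxx]) (use that in auto)
    fix X T \<Theta> assume X: "test1 a b X" and \<Theta>: "test1 0 T \<Theta>"
    have s: "smooth X" "smooth \<Theta>" using X \<Theta> by (auto simp: test1_def)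
    show "integral UNIV (\<lambda>(x, t). \<tau> * u x t * (X x * deriv (deriv \<Theta>) t) - u x t * (X x * deriv \<Theta> t))
      = integral UNIV (\<lambda>(x, t). (- (\<epsilon>\<^sup>2) * uxx x t + deriv W (u x t)) * (deriv (deriv X) x * \<Theta> t))"
      using weak[OF test_fun_product[OF X \<Theta>]] unfolding pd_product_second[OF s] .
  qed (use assms ju jut juxx Dt bc in auto)
  then show ?thesis by (rule that)
qed

section \<open>Energy, transforms and suprema in the form of the statement\<close>

lemma (in flow) energy_eq:
  assumes t: "t \<ge> 0"
  shows "energy a b \<tau> W \<epsilon> (\<lambda>x. u x t) (bar a b (\<lambda>x. ut x t)) = En t"
proof -
  have "deriv (\<lambda>x. u x t) x = ux x t" if "x \<in> {a<..<b}" for x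
  proof -
    have "at x within {a..b} = at x" using that at_within_interior[of x "{a..b}"] by simp
    then show ?thesis using Dx[OF t, of x] that by (intro DERIV_imp_deriv) auto
  qed
  \<comment> \<open>At \<open>a\<close> and \<open>b\<close> the two-sided \<open>deriv\<close>
    depends on values of \<open>u\<close> outside the interval; these two points do not affect the
    integral.\<close>
  then have "integral {a..b} (\<lambda>x. \<epsilon> / 2 * (deriv (\<lambda>x. u x t) x)\<^sup>2 + W (u x t) / \<epsilon>) = pot t"
    unfolding pot_def by (intro integral_spike[of "{a, b}"]) auto
  then show ?thesis by (simp add: energy_def En_def Y_def)
qed

text \<open>Carries the closeness of the initial data over to their transforms. The factor 2 counts
  the antiderivative and its mean, each bounded by the \<open>L1\<close> distance.\<close>

lemma L1_dist_bar_le: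
  assumes ab: "a < b" and d: "(\<lambda>x. f x - g x) absolutely_integrable_on {a..b}"
    and f: "f integrable_on {a..b}" and g: "g integrable_on {a..b}"
  shows "L1_dist a b (bar a b f) (bar a b g) \<le> 2 * (b - a) * L1_dist a b f g"
proof -
  define D where "D x = f x - g x" for x
  define L where "L = L1_dist a b f g"
  have Di: "D integrable_on {a..b}" and Da: "(\<lambda>x. \<bar>D x\<bar>) integrable_on {a..b}"
    using d unfolding absolutely_integrable_on_def D_def by auto
  have I: "\<bar>integral {a..y} D\<bar> \<le> L" if y: "y \<in> {a..b}" for y
  proof -
    have 1: "D integrable_on {a..y}" "(\<lambda>x. \<bar>D x\<bar>) integrable_on {a..y}"
      using integrable_on_subinterval[OF Di, of a y] integrable_on_subinterval[OF Da, of a y] y by auto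
    have "norm (integral {a..y} D) \<le> integral {a..y} (\<lambda>x. \<bar>D x\<bar>)"
      by (rule integral_norm_bound_integral[OF 1]) auto
    also have "\<dots> \<le> integral {a..b} (\<lambda>x. \<bar>D x\<bar>)"
      by (rule integral_subset_le) (use 1 Da y in auto)
    finally show ?thesis by (simp add: L_def L1_dist_def D_def)
  qed
  have c: "continuous_on {a..b} (\<lambda>x. integral {a..x} D)" by (rule indefinite_integral_continuous_1[OF Di])
  have "norm (integral {a..b} (\<lambda>y. integral {a..y} D)) \<le> L * (b - a)"
    by (rule integral_bound) (use ab c I in auto)
  then have mean: "\<bar>1 / (b - a) * integral {a..b} (\<lambda>y. integral {a..y} D)\<bar> \<le> L"
    using ab by (simp add: abs_mult pos_divide_le_eq)
  have "\<bar>bar a b f x - bar a b g x\<bar> \<le> 2 * L" if x: "x \<in> {a..b}" for x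
  proof -
    have "bar a b f x - bar a b g x = bar a b D x"
      unfolding D_def using bar_minus[OF f g x] by simp
    then show ?thesis using I[OF x] mean unfolding bar_def[of a b D] by linarith
  qed
  moreover have "continuous_on {a..b} (\<lambda>x. \<bar>bar a b f x - bar a b g x\<bar>)"
    by (intro continuous_intros bar_continuous f g)
  ultimately have "integral {a..b} (\<lambda>x. \<bar>bar a b f x - bar a b g x\<bar>) \<le> integral {a..b} (\<lambda>x. 2 * L)"
    by (intro integral_le integrable_continuous_real) auto
  then have "L1_dist a b (bar a b f) (bar a b g) \<le> (b - a) * (2 * L)"
    using ab by (simp add: L1_dist_def)
  then show ?thesis by (simp only: L_def mult.commute mult.left_commute)
qed

text \<open>In \<open>ereal\<close> the supremum of the empty set is minus infinity, hence the
  requirement that the sets be nonempty.\<close>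

lemma SUP_tendsto_0:
  fixes g :: "real \<Rightarrow> real \<Rightarrow> real"
  assumes "\<forall>\<^sub>F \<epsilon> in F. S \<epsilon> \<noteq> {} \<and> (\<forall>t\<in>S \<epsilon>. 0 \<le> g \<epsilon> t \<and> g \<epsilon> t \<le> B \<epsilon>)" and "(B \<longlongrightarrow> 0) F"
  shows "((\<lambda>\<epsilon>. SUP t\<in>S \<epsilon>. ereal (g \<epsilon> t)) \<longlongrightarrow> 0) F"
proof (rule tendsto_sandwich)
  show "\<forall>\<^sub>F \<epsilon> in F. 0 \<le> (SUP t\<in>S \<epsilon>. ereal (g \<epsilon> t))"
    using assms(1)
  proof eventually_elim
    case (elim \<epsilon>)
    then obtain t where "t \<in> S \<epsilon>" by blast
    then show ?case using elim by (intro SUP_upper2[of t]) (auto simp: zero_ereal_def)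
  qed
  show "\<forall>\<^sub>F \<epsilon> in F. (SUP t\<in>S \<epsilon>. ereal (g \<epsilon> t)) \<le> ereal (B \<epsilon>)"
    using assms(1) by eventually_elim (auto intro!: SUP_least)
  show "((\<lambda>\<epsilon>. ereal (B \<epsilon>)) \<longlongrightarrow> 0) F"
    using tendsto_ereal[OF assms(2)] by (simp add: zero_ereal_def)
qed auto

lemma profile_absolutely_integrable:
  assumes J: "jump_profile a b N h v"
  shows "v absolutely_integrable_on {a..b}"
  unfolding absolutely_integrable_on_def
proof
  show "v integrable_on {a..b}" by (rule profile_integrable[OF J])
  show "(\<lambda>x. norm (v x)) integrable_on {a..b}"
  proof (rule integrable_eq[of "\<lambda>x. 1"])
    show "1 = norm (v x)" if "x \<in> {a..b}" for x
      using jump_profileD(2)[OF J that] by auto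
  qed auto
qed

theorem theorem2p5:
  fixes a b \<tau> r A \<alpha> \<beta> :: real and N :: nat
    and W v f :: "real \<Rightarrow> real" and h :: "nat \<Rightarrow> real"
    and u ut :: "real \<Rightarrow> real \<Rightarrow> real \<Rightarrow> real"
  assumes "a < b" and "\<tau> > 0"
    and "C3 W"
    and "W 1 = 0" "W (-1) = 0" "deriv W 1 = 0" "deriv W (-1) = 0"
    and "deriv (deriv W) 1 > 0" "deriv (deriv W) (-1) > 0"
    and "\<And>s. s \<noteq> 1 \<Longrightarrow> s \<noteq> -1 \<Longrightarrow> W s > 0"
    and "N \<ge> 1"
    and "jump_profile a b N h v"
    and "r > 0"
    and "\<And>i. 1 \<le> i \<Longrightarrow> i < N \<Longrightarrow> h i + r \<le> h (i + 1) - r"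
    and "a \<le> h 1 - r" and "h N + r \<le> b"
    and "0 < A" and "A < r * sqrt (2 * min (deriv (deriv W) 1) (deriv (deriv W) (-1)))"
    and "\<And>\<epsilon>. \<epsilon> > 0 \<Longrightarrow> f \<epsilon> > 0"
    and "\<alpha> \<in> {-1, 1}" and "\<beta> \<in> {-1, 1}"
    and "\<And>\<epsilon>. \<epsilon> > 0 \<Longrightarrow> is_solution a b \<tau> W \<epsilon> \<alpha> \<beta> (u \<epsilon>) (ut \<epsilon>)"
    and "((\<lambda>\<epsilon>. L1_dist a b (\<lambda>x. u \<epsilon> x 0) v) \<longlongrightarrow> 0) (at_right 0)"
    and "\<forall>\<^sub>F \<epsilon> in at_right 0.
           energy a b \<tau> W \<epsilon> (\<lambda>x. u \<epsilon> x 0) (bar a b (\<lambda>x. ut \<epsilon> x 0))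
             \<le> real N * integral {-1..1} (\<lambda>s. sqrt (2 * W s)) + 1 / f \<epsilon>"
  shows "((\<lambda>\<epsilon>. SUP t\<in>{0..min (f \<epsilon>) (exp (A / \<epsilon>))}.
            ereal (L1_dist a b (bar a b (\<lambda>x. u \<epsilon> x t)) (bar a b v))) \<longlongrightarrow> 0) (at_right 0) \<and>
         (\<forall>\<eta>. 0 < \<eta> \<and> \<eta> < 1 \<longrightarrow>
           ((\<lambda>\<epsilon>. SUP t\<in>{0..\<epsilon> powr \<eta> * min (f \<epsilon>) (exp (A / \<epsilon>))}.
              ereal (L1_dist a b (\<lambda>x. u \<epsilon> x t) v)) \<longlongrightarrow> 0) (at_right 0))"
proof -
  have DW: "(W has_real_derivative deriv W w) (at w)" and DW1: "(deriv W has_real_derivative deriv (deriv W) w) (at w)"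
    and W2c: "isCont (deriv (deriv W)) w" for w
    using assms(3) by (auto simp: C3_def DERIV_deriv_iff_real_differentiable intro: differentiable_imp_continuous_within)
  have W1c: "isCont (deriv W) w" and Wc: "isCont W w" for w using DW DW1 DERIV_isCont by blast+
  have Wn: "W w \<ge> 0" for w using assms(4,5) assms(10)[of w] by (cases "w = 1 \<or> w = -1") (auto simp: less_imp_le)
  have "isCont (\<lambda>w. sqrt (2 * W w)) w" for w by (intro continuous_intros Wc)
  then obtain \<Psi> where \<Psi>: "\<forall>w. (\<Psi> has_vector_derivative sqrt (2 * W w)) (at w)"
    using einterval_antiderivative[of "-\<infinity>" "\<infinity>" "\<lambda>w. sqrt (2 * W w)"] by auto
  define lam where "lam = min (deriv (deriv W) 1) (deriv (deriv W) (-1))"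
  \<comment> \<open>With \<open>lam / 2\<close> under the root, \<open>2 * \<kappa>\<close> is
    \<open>sqrt (2 * lam)\<close>, the factor in the hypothesis on \<open>A\<close>, and
    \<open>\<kappa>\<^sup>2\<close> is strictly below the curvature at both wells.\<close>
  define \<kappa> where "\<kappa> = sqrt (lam / 2)"
  have lam: "lam > 0" using assms(8,9) by (simp add: lam_def)
  then have \<kappa>: "\<kappa> > 0" "\<kappa>\<^sup>2 < lam" by (auto simp: \<kappa>_def)
  interpret dw: double_well W "deriv W" "deriv (deriv W)" \<Psi> \<kappa>
  proof
    show "(\<Psi> has_real_derivative sqrt (2 * W w)) (at w)" for w
      using \<Psi> by (simp add: has_real_derivative_iff_has_vector_derivative)
    show "\<kappa>\<^sup>2 < deriv (deriv W) s" if "s \<in> {-1, 1}" for s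
      using \<kappa>(2) that by (auto simp: lam_def)
  qed (use DW DW1 W2c Wn assms(4-7,10) \<kappa> in auto)
  have c0: "integral {-1..1} (\<lambda>s. sqrt (2 * W s)) = \<Psi> 1 - \<Psi> (-1)"
    by (rule integral_unique, rule has_integral_ftc) (auto intro: DERIV_subset[OF dw.D\<Psi>])
  have "2 * \<kappa> = sqrt (2 * lam)"
    by (rule real_sqrt_unique[symmetric]) (use lam \<kappa> in \<open>auto simp: \<kappa>_def power_mult_distrib\<close>)
  then have A: "A < 2 * \<kappa> * r" using assms(18) by (simp add: lam_def mult.commute)
  note J = assms(12)
  obtain \<delta> C where \<delta>: "\<delta> > 0" and C: "C \<ge> 0" and lower:
    "\<And>w w' \<epsilon>. \<epsilon> > 0 \<Longrightarrow>
        (\<And>x. x \<in> {a..b} \<Longrightarrow> (w has_real_derivative w' x) (at x within {a..b})) \<Longrightarrow>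
        continuous_on {a..b} w' \<Longrightarrow> L1_dist a b (bar a b w) (bar a b v) \<le> \<delta> \<Longrightarrow>
        real N * (\<Psi> 1 - \<Psi> (-1)) - C * exp (- A / \<epsilon>) \<le> integral {a..b} (dw.edens \<epsilon> w w')"
    using dw.energy_lower_bound[OF J assms(13,14,15,16,17) A] by metis
  define K where "K = real N * (\<Psi> 1 - \<Psi> (-1))"
  have K: "K \<ge> 0" using dw.\<Psi>_mono[of "-1" 1] by (simp add: K_def)
  have va: "v absolutely_integrable_on {a..b}" by (rule profile_absolutely_integrable[OF J])
  have vi: "v integrable_on {a..b}" by (rule profile_integrable[OF J])
  define l where "l \<epsilon> = L1_dist a b (\<lambda>x. u \<epsilon> x 0) v" for \<epsilon>
  define T where "T \<epsilon> = min (f \<epsilon>) (exp (A / \<epsilon>))" for \<epsilon>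
  \<comment> \<open>The bound of \<open>energy_times_displacement\<close> for times up to
    \<open>p * T \<epsilon>\<close>. It does not involve \<open>\<epsilon>\<close> and tends to 0
    with \<open>p\<close>; in the end \<open>p = \<epsilon> powr \<eta>\<close>.\<close>
  define R where "R p = 8 * (K + 1) * (1 + C) * p + 16 / \<tau> * (K + 1)\<^sup>2 * p\<^sup>2" for p
  let ?dbar = "\<lambda>\<epsilon> t. L1_dist a b (bar a b (\<lambda>x. u \<epsilon> x t)) (bar a b v)"
  let ?d = "\<lambda>\<epsilon> t. L1_dist a b (\<lambda>x. u \<epsilon> x t) v"
  let ?B = "\<lambda>\<epsilon>. 2 * (b - a) * l \<epsilon> + sqrt ((b - a) * (\<epsilon> * (1 + C)))"
  \<comment> \<open>The estimates are stated for one fixed \<open>\<epsilon>\<close> with explicit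
    smallness conditions, because each \<open>\<epsilon>\<close> has its own solution and its own
    instance of \<open>flow\<close>; limits are taken afterwards.\<close>
  have key: "(\<forall>t\<in>{0..T \<epsilon>}. ?dbar \<epsilon> t
          \<le> ?B \<epsilon>) \<and>
      (\<forall>p\<in>{0..1}. \<forall>t\<in>{0..p * T \<epsilon>}. ?d \<epsilon> t \<le> l \<epsilon> + sqrt ((b - a) * sqrt (R p)))"
    if \<epsilon>: "\<epsilon> > 0" and init: "2 * (b - a) * l \<epsilon> \<le> \<delta> / 2" and small: "(b - a) * (\<epsilon> * (1 + C)) < (\<delta> / 2)\<^sup>2"
      and E0: "energy a b \<tau> W \<epsilon> (\<lambda>x. u \<epsilon> x 0) (bar a b (\<lambda>x. ut \<epsilon> x 0)) \<le> K + 1 / f \<epsilon>" for \<epsilon>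
  proof -
    have bc0: "deriv W \<alpha> = 0" "deriv W \<beta> = 0" using assms(6,7,20,21) by auto
    obtain ux uxx where "flow a b \<tau> \<epsilon> \<alpha> \<beta> W (deriv W) (u \<epsilon>) (ut \<epsilon>) ux uxx"
      using is_solution_flow[OF assms(1,2) \<epsilon> DW W1c Wn bc0 assms(22)[OF \<epsilon>]] by metis
    then interpret fl: flow a b \<tau> \<epsilon> \<alpha> \<beta> W "deriv W" "u \<epsilon>" "ut \<epsilon>" ux uxx .
    define e where "e = exp (- A / \<epsilon>)"
    have e: "e \<ge> 0" by (simp add: e_def)
    have F: "f \<epsilon> > 0" by (rule assms(19)[OF \<epsilon>])
    have low: "K - C * e \<le> fl.pot t" if t: "t \<ge> 0" and L: "?dbar \<epsilon> t \<le> \<delta>" for t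
    proof -
      have "real N * (\<Psi> 1 - \<Psi> (-1)) - C * exp (- A / \<epsilon>) \<le> integral {a..b} (dw.edens \<epsilon> (\<lambda>x. u \<epsilon> x t) (\<lambda>x. ux x t))"
        by (rule lower[OF \<epsilon> fl.Dx[OF t] fl.ux_cont[OF t] L])
      then show ?thesis by (simp add: K_def e_def fl.pot_def dw.edens_def[abs_def])
    qed
    have ua: "(\<lambda>x. u \<epsilon> x t) absolutely_integrable_on {a..b}" if "t \<ge> 0" for t
      using absolutely_integrable_continuous_real[OF fl.slices(1)[OF that]] .
    have uv: "(\<lambda>x. u \<epsilon> x t - v x) absolutely_integrable_on {a..b}" if "t \<ge> 0" for t
      using set_integral_diff(1)[OF ua[OF that] va] .
    have uv': "(\<lambda>x. \<bar>u \<epsilon> x t - v x\<bar>) integrable_on {a..b}" if "t \<ge> 0" for t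
      using uv[OF that] by (simp add: absolutely_integrable_on_def)
    have bar0: "?dbar \<epsilon> 0 \<le> 2 * (b - a) * l \<epsilon>"
      unfolding l_def
      by (rule L1_dist_bar_le[OF assms(1) uv _ vi]) (auto intro!: integrable_continuous_real fl.slices)
    have Te: "T \<epsilon> \<le> f \<epsilon>" "T \<epsilon> * e \<le> 1"
    proof -
      show "T \<epsilon> \<le> f \<epsilon>" by (simp add: T_def)
      have "T \<epsilon> * e \<le> exp (A / \<epsilon>) * e" by (intro mult_right_mono e) (simp add: T_def)
      then show "T \<epsilon> * e \<le> 1" by (simp add: e_def flip: exp_add)
    qed
    have En0: "fl.En 0 \<le> K + 1 / f \<epsilon>" using E0 fl.energy_eq[of 0] by simp
    have init': "?dbar \<epsilon> 0 \<le> \<delta> / 2" using bar0 init by linarith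
    note slow = fl.slow_motion[OF vi \<delta> C F e low init' En0 small Te]
    have first: "?dbar \<epsilon> t \<le> ?B \<epsilon>"
      if t: "t \<in> {0..T \<epsilon>}" for t
    proof -
      have "sqrt ((b - a) * fl.disp t) \<le> sqrt ((b - a) * (\<epsilon> * (1 + C)))"
        using slow(2)[OF _ _ t] assms(1) by (intro real_sqrt_le_mono mult_left_mono) auto
      then show ?thesis using slow(3)[OF _ _ t] bar0 by linarith
    qed
    have second: "?d \<epsilon> t \<le> l \<epsilon> + sqrt ((b - a) * sqrt (R p))"
      if p: "p \<in> {0..1}" and t: "t \<in> {0..p * T \<epsilon>}" for p t
    proof -
      have "T \<epsilon> \<ge> 0" using F by (simp add: T_def)
      then have "p * T \<epsilon> \<le> T \<epsilon>" using p by (simp add: mult_left_le_one_le)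
      then have tT: "t \<in> {0..T \<epsilon>}" and t0: "0 \<le> t" "t \<le> p * T \<epsilon>" "0 \<le> p" using t p by auto
      have "8 / \<epsilon> * fl.En 0 * fl.disp t \<le> R p"
        unfolding R_def
        by (rule fl.energy_times_displacement[OF C F e K En0 Te t0(3,1,2) slow(1)[OF _ _ tT]]) auto
      then have "sqrt ((b - a) * sqrt (8 / \<epsilon> * fl.En 0 * fl.disp t)) \<le> sqrt ((b - a) * sqrt (R p))"
        using assms(1) by (intro real_sqrt_le_mono mult_left_mono) auto
      then have d: "integral {a..b} (\<lambda>x. \<bar>u \<epsilon> x t - u \<epsilon> x 0\<bar>) \<le> sqrt ((b - a) * sqrt (R p))"
        using fl.L1_displacement[OF t0(1)] by linarith
      have di: "(\<lambda>x. \<bar>u \<epsilon> x t - u \<epsilon> x 0\<bar>) integrable_on {a..b}"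
        by (intro integrable_continuous_real continuous_intros fl.slices t0 order_refl)
      have "?d \<epsilon> t \<le> integral {a..b} (\<lambda>x. \<bar>u \<epsilon> x 0 - v x\<bar> + \<bar>u \<epsilon> x t - u \<epsilon> x 0\<bar>)"
        unfolding L1_dist_def
        by (rule integral_le[OF uv'[OF t0(1)] integrable_add[OF uv'[OF order_refl] di]]) auto
      also have "\<dots> = l \<epsilon> + integral {a..b} (\<lambda>x. \<bar>u \<epsilon> x t - u \<epsilon> x 0\<bar>)"
        unfolding l_def L1_dist_def
        by (rule hk_integral_add[OF uv'[OF order_refl] di])
      finally show ?thesis using d by linarith
    qed
    show ?thesis using first second by blast
  qed
  have l0: "(l \<longlongrightarrow> 0) (at_right 0)" unfolding l_def by (rule assms(23))
  have id0: "((\<lambda>\<epsilon>. \<epsilon>) \<longlongrightarrow> 0) (at_right (0::real))" by (rule tendsto_ident_at)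
  have "((\<lambda>\<epsilon>. 2 * (b - a) * l \<epsilon>) \<longlongrightarrow> 2 * (b - a) * 0) (at_right 0)" by (intro tendsto_intros l0)
  then have ev1: "\<forall>\<^sub>F \<epsilon> in at_right 0. 2 * (b - a) * l \<epsilon> < \<delta> / 2"
    by (rule order_tendstoD) (use \<delta> in simp)
  have "((\<lambda>\<epsilon>. (b - a) * (\<epsilon> * (1 + C))) \<longlongrightarrow> (b - a) * (0 * (1 + C))) (at_right 0)"
    by (intro tendsto_intros id0)
  then have ev2: "\<forall>\<^sub>F \<epsilon> in at_right 0. (b - a) * (\<epsilon> * (1 + C)) < (\<delta> / 2)\<^sup>2"
    by (rule order_tendstoD) (use \<delta> in simp)
  \<comment> \<open>The bound \<open>\<epsilon> < 1\<close> ensures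
    \<open>\<epsilon> powr \<eta> \<le> 1\<close>, so that the shortened time interval lies within
    \<open>{0..T \<epsilon>}\<close>.\<close>
  have ev3: "\<forall>\<^sub>F \<epsilon> in at_right 0. (0::real) < \<epsilon> \<and> \<epsilon> < 1"
    unfolding eventually_at_right_field by (intro exI[of _ 1]) auto
  have ev: "\<forall>\<^sub>F \<epsilon> in at_right 0. 0 < \<epsilon> \<and> \<epsilon> < 1 \<and>
      (\<forall>t\<in>{0..T \<epsilon>}. ?dbar \<epsilon> t
          \<le> ?B \<epsilon>) \<and>
      (\<forall>p\<in>{0..1}. \<forall>t\<in>{0..p * T \<epsilon>}. ?d \<epsilon> t \<le> l \<epsilon> + sqrt ((b - a) * sqrt (R p)))"
    using ev1 ev2 ev3 assms(24)
  proof eventually_elim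
    case (elim \<epsilon>)
    then show ?case using key[of \<epsilon>] by (simp add: K_def c0)
  qed
  have L1_nonneg: "0 \<le> L1_dist a b g g'" for g g'
    unfolding L1_dist_def
    by (cases "(\<lambda>x. \<bar>g x - g' x\<bar>) integrable_on {a..b}") (auto intro: integral_nonneg simp: not_integrable_integral)
  have Tp: "T \<epsilon> > 0" if "\<epsilon> > 0" for \<epsilon> using assms(19)[OF that] by (simp add: T_def)
  have "((\<lambda>\<epsilon>. SUP t\<in>{0..T \<epsilon>}. ereal (?dbar \<epsilon> t)) \<longlongrightarrow> 0) (at_right 0)"
  proof (rule SUP_tendsto_0)
    show "\<forall>\<^sub>F \<epsilon> in at_right 0. {0..T \<epsilon>} \<noteq> {} \<and> (\<forall>t\<in>{0..T \<epsilon>}. 0 \<le> ?dbar \<epsilon> t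
        \<and> ?dbar \<epsilon> t \<le> ?B \<epsilon>)"
      using ev
    proof eventually_elim
      case (elim \<epsilon>)
      have "0 \<in> {0..T \<epsilon>}" using Tp[of \<epsilon>] elim by simp
      then show ?case using elim L1_nonneg by blast
    qed
    have "((\<lambda>\<epsilon>. ?B \<epsilon>) \<longlongrightarrow> 2 * (b - a) * 0 + sqrt ((b - a) * (0 * (1 + C)))) (at_right 0)"
      by (intro tendsto_intros l0 id0)
    then show "((\<lambda>\<epsilon>. ?B \<epsilon>) \<longlongrightarrow> 0) (at_right 0)" by simp
  qed
  moreover have "((\<lambda>\<epsilon>. SUP t\<in>{0..\<epsilon> powr \<eta> * T \<epsilon>}. ereal (?d \<epsilon> t)) \<longlongrightarrow> 0) (at_right 0)"
    if \<eta>: "0 < \<eta>" "\<eta> < 1" for \<eta>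
  proof (rule SUP_tendsto_0)
    show "\<forall>\<^sub>F \<epsilon> in at_right 0. {0..\<epsilon> powr \<eta> * T \<epsilon>} \<noteq> {} \<and> (\<forall>t\<in>{0..\<epsilon> powr \<eta> * T \<epsilon>}. 0 \<le> ?d \<epsilon> t
        \<and> ?d \<epsilon> t \<le> l \<epsilon> + sqrt ((b - a) * sqrt (R (\<epsilon> powr \<eta>))))"
      using ev
    proof eventually_elim
      case (elim \<epsilon>)
      have "0 \<in> {0..\<epsilon> powr \<eta> * T \<epsilon>}" using Tp[of \<epsilon>] elim by simp
      moreover have "\<epsilon> powr \<eta> \<in> {0..1}" using elim \<eta> by (auto simp: powr_le1)
      ultimately show ?case using elim L1_nonneg by blast
    qed
    have p0: "((\<lambda>\<epsilon>. \<epsilon> powr \<eta>) \<longlongrightarrow> 0) (at_right 0)"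
      by (rule tendsto_zero_powrI[OF id0 tendsto_const _ \<eta>(1)]) (use ev3 in \<open>auto elim: eventually_mono\<close>)
    have "((\<lambda>\<epsilon>. l \<epsilon> + sqrt ((b - a) * sqrt (R (\<epsilon> powr \<eta>)))) \<longlongrightarrow> 0 + sqrt ((b - a) * sqrt (8 * (K + 1) * (1 + C) * 0 + 16 / \<tau> * (K + 1)\<^sup>2 * 0\<^sup>2))) (at_right 0)"
      unfolding R_def by (intro tendsto_intros l0 p0)
    then show "((\<lambda>\<epsilon>. l \<epsilon> + sqrt ((b - a) * sqrt (R (\<epsilon> powr \<eta>)))) \<longlongrightarrow> 0) (at_right 0)" by simp
  qed
  ultimately show ?thesis unfolding T_def by blast
qed

end
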